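(* Let $d\ge1$, $r>0$ and let $U:\mathbb R^d\to\mathbb R$ be smooth and $1$-periodic (i.e. $x-z\in\mathbb Z^d\Rightarrow U(x)=U(z)$). There exist $c,\theta>0$ depending only on $d$, $r$ and $U$ such that for every constant temperature $\varepsilon>0$, denoting by $(P_t)_{t\ge0}$ the (homogeneous) semi-group of the velocity jump process on $\mathbb T^d\times\mathbb S^{d-1}$ at temperature $\varepsilon$ and by $\nu_0$ the probability measure proportional to $e^{-U(x)/\varepsilon}dx\times dy$, one has for all $t\ge0$ and all initial probability laws $\mu$ on $\mathbb T^d\times\mathbb S^{d-1}$ $$\|\mu P_t-\nu_0\|_{TV}\le e^{-c\,e^{-\theta/\varepsilon}\,(t-\sqrt d)}\,\|\mu-\nu_0\|_{TV}.$$
   Context: $\mathbb T^d=(\mathbb R/\mathbb Z)^d$; $dy$ (or $dz$) is the uniform probability measure on the unit sphere $\mathbb S^{d-1}$; $(g)_+=\max(g,0)$. Velocity jump process at constant temperature $\varepsilon$: the Markov process on $\mathbb T^d\times\mathbb S^{d-1}$ with generator $$Lf(x,y)=y\cdot\nabla_xf(x,y)+\frac{(y\cdot\nabla_xU(x))_+}{\varepsilon}\big(f(x,y^* )-f(x,y)\big)+r\Big(\int f(x,z)\,dz-f(x,y)\Big),$$ where $$y^*=y-2\Big(y\cdot\frac{\nabla_xU(x)}{|\nabla_xU(x)|}\Big)\frac{\nabla_xU(x)}{|\nabla_xU(x)|}$$ (where $\nabla_xU(x)=0$ the corresponding jump rate vanishes and $y^*$ is irrelevant). That is, $X$ moves with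 constant velocity $Y$ between jumps; at rate $(Y\cdot\nabla U(X))_+/\varepsilon$ the velocity is reflected, $Y\leftarrow Y^*$; and independently at rate $r$ the velocity is resampled uniformly on the sphere. $\mu P_t$ is the law at time $t$ of the process with initial law $\mu$. $\|\mu_1-\mu_2\|_{TV}=\inf_{Z_1\sim\mu_1,Z_2\sim\mu_2}\mathbb P(Z_1\ne Z_2)$. *)

theory Defs
  imports "HOL-Probability.Probability"
begin

text \<open>Not available in HOL-Analysis: the infinitely often differentiable functions.\<close>

primrec C_diff :: "nat \<Rightarrow> (real ^ 'n \<Rightarrow> real) \<Rightarrow> bool" where
  "C_diff 0 f \<longleftrightarrow> continuous_on UNIV f"
| "C_diff (Suc k) f \<longleftrightarrow>
     (\<forall>x. f differentiable at x) \<and>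
     (\<forall>i. C_diff k (\<lambda>x. frechet_derivative f (at x) (axis i 1)))"

definition smooth :: "(real ^ 'n \<Rightarrow> real) \<Rightarrow> bool" where
  "smooth f \<longleftrightarrow> (\<forall>k. C_diff k f)"

definition periodic :: "(real ^ 'n \<Rightarrow> 'b) \<Rightarrow> bool" where
  "periodic f \<longleftrightarrow> (\<forall>x z. (\<forall>i. x $ i - z $ i \<in> \<int>) \<longrightarrow> f x = f z)"

definition gradient :: "(real ^ 'n \<Rightarrow> real) \<Rightarrow> real ^ 'n \<Rightarrow> real ^ 'n" where
  "gradient f x = (THE D. GDERIV f x :> D)"

text \<open>
  The torus is represented by its fundamental domain: measures on the torus are measures on
  the cube below (whose Borel sets correspond to those of the quotient), and functions on the
  torus are periodic functions on the whole space, so that gradients at boundary points of the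
  cube are those taken on the torus.
\<close>

definition torus :: "(real ^ 'n) set" where
  "torus = {x. \<forall>i. 0 \<le> x $ i \<and> x $ i < 1}"

definition state_space :: "((real ^ 'n) \<times> (real ^ 'n)) measure" where
  "state_space = restrict_space borel torus \<Otimes>\<^sub>M restrict_space borel (sphere 0 1)"

text \<open>
  The uniform probability measure on the unit sphere is the image of the uniform measure on
  the unit ball under \<open>x \<mapsto> x / |x|\<close> (polar coordinates); the exceptional point \<open>0\<close>, which
  \<open>sgn\<close> fixes, is a null set.
\<close>

definition uniform_sphere :: "(real ^ 'n) measure" where
  "uniform_sphere =
     restrict_space (distr (uniform_measure lborel (ball 0 1)) borel sgn) (sphere 0 1)"

definition gibbs :: "(real ^ 'n \<Rightarrow> real) \<Rightarrow> real \<Rightarrow> ((real ^ 'n) \<times> (real ^ 'n)) measure" where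
  "gibbs U \<epsilon> =
     density (restrict_space lborel torus \<Otimes>\<^sub>M uniform_sphere)
       (\<lambda>(x, y). ennreal (exp (- U x / \<epsilon>) /
          (\<integral>x'. exp (- U x' / \<epsilon>) \<partial>restrict_space lborel torus)))"

text \<open>
  Here \<open>sgn v = v / |v|\<close>, and \<open>sgn 0 = 0\<close>: the velocity is unchanged at critical points, where
  the jump rate vanishes.
\<close>

definition reflect :: "(real ^ 'n \<Rightarrow> real) \<Rightarrow> real ^ 'n \<Rightarrow> real ^ 'n \<Rightarrow> real ^ 'n" where
  "reflect U x y = y - (2 * (y \<bullet> sgn (gradient U x))) *\<^sub>R sgn (gradient U x)"

definition vj_generator ::
  "(real ^ 'n \<Rightarrow> real) \<Rightarrow> real \<Rightarrow> real \<Rightarrow>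
     ((real ^ 'n) \<times> (real ^ 'n) \<Rightarrow> real) \<Rightarrow> (real ^ 'n) \<times> (real ^ 'n) \<Rightarrow> real" where
  "vj_generator U r \<epsilon> f = (\<lambda>(x, y).
     y \<bullet> gradient (\<lambda>x'. f (x', y)) x
     + max (y \<bullet> gradient U x) 0 / \<epsilon> * (f (x, reflect U x y) - f (x, y))
     + r * ((\<integral>z. f (x, z) \<partial>uniform_sphere) - f (x, y)))"

text \<open>
  The functions to which the generator is applied: continuous on the product of the torus and
  the sphere, and continuously differentiable in the position.
\<close>

definition vj_test_function :: "((real ^ 'n) \<times> (real ^ 'n) \<Rightarrow> real) \<Rightarrow> bool" where
  "vj_test_function f \<longleftrightarrow>
     (\<forall>y\<in>sphere 0 1. periodic (\<lambda>x. f (x, y))) \<and>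
     continuous_on (UNIV \<times> sphere 0 1) f \<and>
     (\<forall>y\<in>sphere 0 1. \<forall>x. (\<lambda>x'. f (x', y)) differentiable at x) \<and>
     continuous_on (UNIV \<times> sphere 0 1) (\<lambda>(x, y). gradient (\<lambda>x'. f (x', y)) x)"

text \<open>
  \<open>P\<close> is the transition semigroup of the Markov process with the above generator: a semigroup
  of Markov kernels whose infinitesimal generator (the uniform limit of difference quotients)
  is \<open>vj_generator U r \<epsilon>\<close> on all test functions. These functions form a core (they are dense and
  preserved by free transport, of which the jump part is a bounded perturbation), so this
  determines \<open>P t\<close> on the state space for all \<open>t \<ge> 0\<close>. Times \<open>t < 0\<close> are irrelevant.
\<close>

definition vj_semigroup ::
  "(real ^ 'n \<Rightarrow> real) \<Rightarrow> real \<Rightarrow> real \<Rightarrow>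
     (real \<Rightarrow> (real ^ 'n) \<times> (real ^ 'n) \<Rightarrow> ((real ^ 'n) \<times> (real ^ 'n)) measure) \<Rightarrow> bool" where
  "vj_semigroup U r \<epsilon> P \<longleftrightarrow>
     (\<forall>t\<ge>0. P t \<in> state_space \<rightarrow>\<^sub>M prob_algebra state_space) \<and>
     (\<forall>w\<in>space state_space. P 0 w = return state_space w) \<and>
     (\<forall>s\<ge>0. \<forall>t\<ge>0. \<forall>w\<in>space state_space. P (s + t) w = P s w \<bind> P t) \<and>
     (\<forall>f. vj_test_function f \<longrightarrow>
        uniform_limit (space state_space)
          (\<lambda>t w. ((\<integral>w'. f w' \<partial>P t w) - f w) / t) (vj_generator U r \<epsilon> f) (at_right 0))"

definition couplings :: "'a measure \<Rightarrow> 'a measure \<Rightarrow> ('a \<times> 'a) measure set" where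
  "couplings \<mu>\<^sub>1 \<mu>\<^sub>2 =
     {\<gamma> \<in> space (prob_algebra (\<mu>\<^sub>1 \<Otimes>\<^sub>M \<mu>\<^sub>2)). distr \<gamma> \<mu>\<^sub>1 fst = \<mu>\<^sub>1 \<and> distr \<gamma> \<mu>\<^sub>2 snd = \<mu>\<^sub>2}"

definition tv_dist :: "'a measure \<Rightarrow> 'a measure \<Rightarrow> real" where
  "tv_dist \<mu>\<^sub>1 \<mu>\<^sub>2 =
     (INF \<gamma>\<in>couplings \<mu>\<^sub>1 \<mu>\<^sub>2. measure \<gamma> {w \<in> space \<gamma>. fst w \<noteq> snd w})"

end

theory Submission
  imports Defs
begin

text \<open>
  The proof is a Doeblin minorization: on the time scale \<open>L = sqrt n\<close>, where \<open>n\<close> is the dimension,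
  all transition probabilities dominate a common multiple \<open>\<eta>\<close> of the uniform measure
  \<open>dx \<times> dy\<close>. Two laws evolved for a time \<open>L\<close> then share a common part, so their total
  variation distance contracts by the factor \<open>1 - \<eta>\<close>; since the Gibbs measure is invariant,
  iterating \<open>\<lfloor>t / L\<rfloor>\<close> times gives the exponential rate (\<open>semigroup_tv_decay\<close>).

  The dependence on the temperature comes from one place only. With \<open>M = sup |grad U|\<close> the total
  jump rate is at most \<open>\<Lambda> = M / \<epsilon> + r\<close>, so during a time \<open>L\<close> the process makes no jump other
  than prescribed ones with a probability at least \<open>exp (- \<Lambda> L)\<close>. Prescribing two resamplings of
  the velocity suffices. Up to the second one the process flies along a broken line, with its initial
  velocity \<open>y\<close> up to time \<open>\<tau> - s\<close> and with a uniformly random velocity \<open>z\<close> up to time \<open>\<tau>\<close>; when \<open>s\<close>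
  varies over \<open>[0, \<tau>]\<close>, the end point has a density bounded below on a unit cube, hence on the torus
  (\<open>two_leg_flight_lower_bound\<close>). The second resampling then makes the
  velocity uniform. So \<open>\<eta>\<close> is a constant times \<open>exp (- M L / \<epsilon>)\<close>.

  The semigroup is known only through its generator on test functions, and solutions of the
  backward equation need not be test functions, because the reflection rate is not smooth. All
  arguments therefore use the forward equation \<open>d/dt N\<^sub>t g = N\<^sub>t (A g)\<close> for test functions \<open>g\<close>,
  where \<open>A\<close> is the generator (\<open>forward_solution\<close>). Free transport \<open>T\<^sub>s f (x, y) = f (x + s y, y)\<close> does preserve
  test functions, and \<open>s \<mapsto> exp (- \<Lambda> s) N\<^bsub>t - s\<^esub> (T\<^sub>s f)\<close> has the derivative
  \<open>- exp (- \<Lambda> s) N\<^bsub>t - s\<^esub> ((B + \<Lambda>) T\<^sub>s f)\<close>, where \<open>B\<close> is the jump part of the generator. The operator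
  \<open>B + \<Lambda>\<close> is positive, has norm \<open>\<Lambda>\<close> and dominates \<open>r\<close> times the resampling operator. Its norm
  gives uniqueness of solutions of the forward equation (\<open>forward_solution_unique\<close>), hence
  invariance of the Gibbs measure, on which the generator integrates to zero; its lower bound gives
  the minorization (\<open>forward_solution_minorization\<close>). Test functions are dense in the continuous
  functions by mollification (\<open>test_functions_dense\<close>), which extends the inequalities to
  continuous functions and finally to sets (\<open>measure_le_of_test_functions\<close>).
\<close>

section \<open>Total variation distance and Doeblin contraction\<close>

lemma space_couplings:
  assumes "\<gamma> \<in> couplings M N"
  shows "sets \<gamma> = sets (M \<Otimes>\<^sub>M N)" "prob_space \<gamma>"
  using assms by (auto simp: couplings_def space_prob_algebra)

definition sum_measure :: "'a measure \<Rightarrow> 'a measure \<Rightarrow> 'a measure" where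
  "sum_measure M N = measure_of (space M) (sets M) (\<lambda>A. emeasure M A + emeasure N A)"

lemma sets_sum_measure [simp, measurable_cong]: "sets (sum_measure M N) = sets M"
  by (simp add: sum_measure_def)

lemma space_sum_measure [simp]: "space (sum_measure M N) = space M"
  by (simp add: sum_measure_def)

lemma emeasure_sum_measure:
  assumes "sets N = sets M" "A \<in> sets M"
  shows "emeasure (sum_measure M N) A = emeasure M A + emeasure N A"
  unfolding sum_measure_def
proof (rule emeasure_measure_of_sigma)
  show "sigma_algebra (space M) (sets M)" ..
  show "positive (sets M) (\<lambda>A. emeasure M A + emeasure N A)"
    by (simp add: positive_def)
  show "countably_additive (sets M) (\<lambda>A. emeasure M A + emeasure N A)"
  proof (rule countably_additiveI)
    fix F :: "nat \<Rightarrow> 'a set"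
    assume F: "range F \<subseteq> sets M" "disjoint_family F"
    then show "(\<Sum>i. emeasure M (F i) + emeasure N (F i)) = emeasure M (\<Union>i. F i) + emeasure N (\<Union>i. F i)"
      using assms(1) by (subst suminf_add[symmetric]) (auto simp: suminf_emeasure)
  qed
qed fact

text \<open>
  The maximal coupling: with densities \<open>f\<close> and \<open>g\<close> of the two laws with respect to their sum, the
  common part \<open>min f g\<close> is put on the diagonal, and the two remainders, both of mass \<open>p\<close>, are coupled
  independently. The set \<open>{g < f}\<close> carries the first remainder and no mass of the second, so the
  setwise bound applied to it gives \<open>p \<le> \<delta>\<close>.
\<close>

lemma tv_dist_le_of_setwise:
  fixes M N :: "'a measure"
  assumes M: "prob_space M" and N: "prob_space N" and sets: "sets N = sets M"
    and diag: "{w \<in> space (M \<Otimes>\<^sub>M M). fst w \<noteq> snd w} \<in> sets (M \<Otimes>\<^sub>M M)"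
    and le: "\<And>A. A \<in> sets M \<Longrightarrow> measure M A - measure N A \<le> \<delta>"
  shows "tv_dist M N \<le> \<delta>"
proof -
  interpret M: prob_space M by (rule M)
  interpret N: prob_space N by (rule N)
  have sp: "space N = space M" using sets by (rule sets_eq_imp_space_eq)
  define R where "R = sum_measure M N"
  have Rs [simp, measurable_cong]: "sets R = sets M" "space R = space M" by (simp_all add: R_def)
  have R: "emeasure R A = emeasure M A + emeasure N A" if "A \<in> sets M" for A
    unfolding R_def using sets that by (rule emeasure_sum_measure)
  interpret R: finite_measure R
    by (rule finite_measureI) (simp add: R M.emeasure_space_1 N.emeasure_space_1[unfolded sp])
  have "absolutely_continuous R M" "absolutely_continuous R N"
    unfolding absolutely_continuous_def by (auto simp: null_sets_def R sets)
  then obtain f g where [measurable]: "f \<in> borel_measurable R" "g \<in> borel_measurable R"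
    and f: "density R f = M" and g: "density R g = N"
    using R.Radon_Nikodym[of M] R.Radon_Nikodym[of N] sets by auto
  let ?h = "\<lambda>x. min (f x) (g x)"
  let ?a = "\<lambda>x. if g x < f x then f x - g x else 0"
  let ?b = "\<lambda>x. if f x < g x then g x - f x else 0"
  define \<rho> where "\<rho> = density R ?h"
  define \<alpha> where "\<alpha> = density R ?a"
  define \<beta> where "\<beta> = density R ?b"
  have [simp, measurable_cong]: "sets \<rho> = sets M" "sets \<alpha> = sets M" "sets \<beta> = sets M"
    and [simp]: "space \<rho> = space M" "space \<alpha> = space M" "space \<beta> = space M"
    by (simp_all add: \<rho>_def \<alpha>_def \<beta>_def)
  have Mf: "emeasure M A = emeasure \<rho> A + emeasure \<alpha> A"
    and Ng: "emeasure N A = emeasure \<rho> A + emeasure \<beta> A" if [measurable]: "A \<in> sets M" for A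
  proof -
    have *: "f x = ?h x + ?a x" "g x = ?h x + ?b x" for x
      by (auto simp: add_diff_inverse_ennreal min_def not_le intro!: antisym)
    have "emeasure M A = (\<integral>\<^sup>+x. (?h x + ?a x) * indicator A x \<partial>R)"
      by (subst f[symmetric], subst *(1)[symmetric]) (simp add: emeasure_density)
    also have "\<dots> = emeasure \<rho> A + emeasure \<alpha> A"
      unfolding \<rho>_def \<alpha>_def
      by (simp add: emeasure_density distrib_right nn_integral_add)
    finally show "emeasure M A = emeasure \<rho> A + emeasure \<alpha> A" .
    have "emeasure N A = (\<integral>\<^sup>+x. (?h x + ?b x) * indicator A x \<partial>R)"
      by (subst g[symmetric], subst *(2)[symmetric]) (simp add: emeasure_density)
    also have "\<dots> = emeasure \<rho> A + emeasure \<beta> A"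
      unfolding \<rho>_def \<beta>_def
      by (simp add: emeasure_density distrib_right nn_integral_add)
    finally show "emeasure N A = emeasure \<rho> A + emeasure \<beta> A" .
  qed
  \<comment> \<open>A Hahn set for the difference of the two laws.\<close>
  define S where "S = {x \<in> space M. g x < f x}"
  have S [measurable]: "S \<in> sets M"
    unfolding S_def using measurable_sets[of "\<lambda>x. (f x, g x)"] by measurable
  have \<beta>S: "emeasure \<beta> S = 0" "emeasure \<alpha> (space M - S) = 0"
    unfolding \<beta>_def \<alpha>_def
    by (auto simp: emeasure_density nn_integral_0_iff_AE S_def split: split_indicator intro!: AE_I2)
  have fin: "emeasure \<rho> A < \<infinity>" "emeasure \<alpha> A < \<infinity>" "emeasure \<beta> A < \<infinity>" if "A \<in> sets M" for A
    using Mf[OF that] Ng[OF that] M.emeasure_finite[of A] N.emeasure_finite[of A]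
    by (auto simp: top.not_eq_extremum)
  interpret \<alpha>: finite_measure \<alpha> by (rule finite_measureI) (use fin(2)[of "space M"] in auto)
  interpret \<beta>: finite_measure \<beta> by (rule finite_measureI) (use fin(3)[of "space M"] in auto)
  interpret \<rho>: finite_measure \<rho> by (rule finite_measureI) (use fin(1)[of "space M"] in auto)
  define p where "p = measure \<alpha> (space M)"
  have p\<alpha>: "emeasure \<alpha> (space M) = ennreal p"
    unfolding p_def by (rule \<alpha>.emeasure_eq_measure)
  have "emeasure \<rho> (space M) + emeasure \<alpha> (space M) = emeasure \<rho> (space M) + emeasure \<beta> (space M)"
    using Mf[of "space M"] Ng[of "space M"] M.emeasure_space_1 N.emeasure_space_1[unfolded sp] by simp
  then have p\<beta>: "emeasure \<beta> (space M) = ennreal p"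
    using fin(1)[of "space M"] p\<alpha> by (metis ennreal_add_left_cancel less_irrefl infinity_ennreal_def sets.top)
  have p0: "p \<ge> 0" by (simp add: p_def)
  have p\<delta>: "p \<le> \<delta>"
  proof -
    have "emeasure \<alpha> (space M) = emeasure \<alpha> S + emeasure \<alpha> (space M - S)"
      using sets.sets_into_space[OF S] by (subst plus_emeasure) (auto simp: Un_absorb1)
    then have "emeasure \<alpha> S = ennreal p" using \<beta>S(2) p\<alpha> by simp
    then have \<alpha>S: "measure \<alpha> S = p" by (simp add: measure_def p0)
    have "measure M S = measure \<rho> S + measure \<alpha> S"
      using Mf[OF S] by (simp add: M.emeasure_eq_measure \<alpha>.emeasure_eq_measure \<rho>.emeasure_eq_measure
        flip: ennreal_plus)
    moreover have "measure N S = measure \<rho> S + measure \<beta> S"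
      using Ng[OF S] by (simp add: N.emeasure_eq_measure \<beta>.emeasure_eq_measure \<rho>.emeasure_eq_measure
        flip: ennreal_plus)
    moreover have "measure \<beta> S = 0" using \<beta>S(1) by (simp add: measure_def)
    ultimately show ?thesis using le[OF S] \<alpha>S by simp
  qed
  let ?P = "M \<Otimes>\<^sub>M M"
  have PP: "sets (M \<Otimes>\<^sub>M N) = sets ?P" "sets (\<alpha> \<Otimes>\<^sub>M \<beta>) = sets ?P"
    using sets by (auto intro!: sets_pair_measure_cong)
  have dm [measurable]: "(\<lambda>x. (x, x)) \<in> \<rho> \<rightarrow>\<^sub>M ?P" by measurable
  define \<gamma> where "\<gamma> = sum_measure (distr \<rho> ?P (\<lambda>x. (x, x))) (scale_measure (ennreal (1 / p)) (\<alpha> \<Otimes>\<^sub>M \<beta>))"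
  have \<gamma>s [simp, measurable_cong]: "sets \<gamma> = sets ?P" and \<gamma>sp [simp]: "space \<gamma> = space ?P"
    by (simp_all add: \<gamma>_def)
  have \<gamma>: "emeasure \<gamma> A = emeasure \<rho> ((\<lambda>x. (x, x)) -` A \<inter> space M)
      + ennreal (1 / p) * emeasure (\<alpha> \<Otimes>\<^sub>M \<beta>) A" if "A \<in> sets ?P" for A
    unfolding \<gamma>_def using that by (subst emeasure_sum_measure) (simp_all add: PP emeasure_distr)
  \<comment> \<open>For \<open>p = 0\<close>, where \<open>1 / p = 0\<close>, both remainders vanish.\<close>
  have cancel: "ennreal (1 / p) * (ennreal p * emeasure \<alpha> A) = emeasure \<alpha> A"
     "ennreal (1 / p) * (ennreal p * emeasure \<beta> A) = emeasure \<beta> A" if "A \<in> sets M" for A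
  proof -
    have "emeasure \<alpha> A \<le> ennreal p" "emeasure \<beta> A \<le> ennreal p"
      using p\<alpha> p\<beta> emeasure_space[of \<alpha> A] emeasure_space[of \<beta> A] by simp_all
    then show "ennreal (1 / p) * (ennreal p * emeasure \<alpha> A) = emeasure \<alpha> A"
     "ennreal (1 / p) * (ennreal p * emeasure \<beta> A) = emeasure \<beta> A"
      using p0 by (cases "p = 0"; simp add: mult.assoc[symmetric] ennreal_mult[symmetric])+
  qed
  have mf: "distr \<gamma> M fst = M"
  proof (rule measure_eqI)
    fix A assume "A \<in> sets (distr \<gamma> M fst)"
    then have A [measurable]: "A \<in> sets M" by simp
    have A': "A \<subseteq> space M" using A by (rule sets.sets_into_space)
    have eq: "fst -` A \<inter> space ?P = A \<times> space M"
      using A' by (auto simp: space_pair_measure)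
    have "emeasure (distr \<gamma> M fst) A = emeasure \<gamma> (A \<times> space M)"
      by (subst emeasure_distr) (simp_all add: eq)
    also have "\<dots> = emeasure \<rho> A + ennreal (1 / p) * (ennreal p * emeasure \<alpha> A)"
      using A' by (subst \<gamma>) (auto simp: \<beta>.emeasure_pair_measure_Times p\<beta> mult.commute vimage_def Int_def
        intro!: arg_cong2[where f = "(+)"] arg_cong2[where f = emeasure] arg_cong2[where f = "(*)"])
    also have "\<dots> = emeasure M A" using cancel(1)[OF A] Mf[OF A] by simp
    finally show "emeasure (distr \<gamma> M fst) A = emeasure M A" .
  qed simp
  have mg: "distr \<gamma> N snd = N"
  proof (rule measure_eqI)
    fix A assume "A \<in> sets (distr \<gamma> N snd)"
    then have A [measurable]: "A \<in> sets M" by (simp add: sets)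
    have A': "A \<subseteq> space M" using A by (rule sets.sets_into_space)
    have eq: "snd -` A \<inter> space ?P = space M \<times> A"
      using A' by (auto simp: space_pair_measure)
    have sm: "snd \<in> \<gamma> \<rightarrow>\<^sub>M N" using sets by (simp cong: measurable_cong_sets)
    have "emeasure (distr \<gamma> N snd) A = emeasure \<gamma> (space M \<times> A)"
      using sm A sets by (subst emeasure_distr) (simp_all add: eq)
    also have "\<dots> = emeasure \<rho> A + ennreal (1 / p) * (ennreal p * emeasure \<beta> A)"
      using A' by (subst \<gamma>) (auto simp: \<beta>.emeasure_pair_measure_Times p\<alpha> vimage_def Int_def
        intro!: arg_cong2[where f = "(+)"] arg_cong2[where f = emeasure] arg_cong2[where f = "(*)"])
    also have "\<dots> = emeasure N A" using cancel(2)[OF A] Ng[OF A] by simp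
    finally show "emeasure (distr \<gamma> N snd) A = emeasure N A" .
  qed simp
  have "prob_space \<gamma>"
  proof (rule prob_space_distrD[where f = fst])
    show "fst \<in> \<gamma> \<rightarrow>\<^sub>M M" by measurable
    show "prob_space (distr \<gamma> M fst)" using M by (simp add: mf)
  qed
  then have in_c: "\<gamma> \<in> couplings M N"
    using mf mg by (simp add: couplings_def space_prob_algebra PP)
  let ?D = "{w \<in> space ?P. fst w \<noteq> snd w}"
  have "emeasure \<gamma> ?D = ennreal (1 / p) * emeasure (\<alpha> \<Otimes>\<^sub>M \<beta>) ?D"
    using diag by (subst \<gamma>) (auto simp: vimage_def)
  also have "\<dots> \<le> ennreal (1 / p) * emeasure (\<alpha> \<Otimes>\<^sub>M \<beta>) (space M \<times> space M)"
    by (intro mult_left_mono emeasure_mono) (auto simp: space_pair_measure)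
  also have "\<dots> = ennreal (1 / p) * (ennreal p * emeasure \<beta> (space M))"
    using \<beta>.emeasure_pair_measure_Times[of "space M" \<alpha> "space M"] by (simp add: p\<alpha>)
  also have "\<dots> = ennreal p"
    using cancel(2)[of "space M"] by (simp add: p\<beta>)
  finally have "measure \<gamma> ?D \<le> p"
    using p0 by (simp add: measure_def enn2real_leI)
  moreover have "tv_dist M N \<le> measure \<gamma> {w \<in> space \<gamma>. fst w \<noteq> snd w}"
    unfolding tv_dist_def by (rule cINF_lower[OF _ in_c]) (auto intro!: bdd_belowI[of _ 0])
  ultimately show ?thesis using p\<delta> by simp
qed

lemma pair_prob_in_couplings:
  assumes "prob_space M" "prob_space N"
  shows "M \<Otimes>\<^sub>M N \<in> couplings M N"
proof -
  interpret M: prob_space M by fact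
  interpret N: prob_space N by fact
  interpret pair_prob_space M N ..
  have "distr (M \<Otimes>\<^sub>M N) N snd = N"
  proof (rule measure_eqI)
    fix A assume "A \<in> sets (distr (M \<Otimes>\<^sub>M N) N snd)"
    then have A: "A \<in> sets N" by simp
    then have "snd -` A \<inter> space (M \<Otimes>\<^sub>M N) = space M \<times> A"
      by (auto simp: space_pair_measure dest: sets.sets_into_space)
    then show "emeasure (distr (M \<Otimes>\<^sub>M N) N snd) A = emeasure N A"
      using A by (simp add: emeasure_distr N.emeasure_pair_measure_Times M.emeasure_space_1)
  qed simp
  then show ?thesis
    unfolding couplings_def by (simp add: space_prob_algebra N.distr_pair_fst prob_space_axioms)
qed

lemma tv_dist_nonneg:
  assumes "prob_space M" "prob_space N"
  shows "0 \<le> tv_dist M N"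
  unfolding tv_dist_def
  by (rule cINF_greatest) (use pair_prob_in_couplings[OF assms] in auto)

text \<open>
  By the minorization the function \<open>w \<mapsto> K w A\<close> oscillates by at most \<open>1 - \<eta>\<close>, for every set \<open>A\<close>.
  Integrating its difference at the two components of a coupling of \<open>M\<close> and \<open>N\<close> therefore costs at
  most \<open>1 - \<eta>\<close> times the probability that the components differ.
\<close>

lemma tv_dist_bind_le:
  assumes K: "K \<in> S \<rightarrow>\<^sub>M prob_algebra S"
    and M: "M \<in> space (prob_algebra S)" and N: "N \<in> space (prob_algebra S)"
    and m: "m \<in> space (prob_algebra S)"
    and diag: "{w \<in> space (S \<Otimes>\<^sub>M S). fst w \<noteq> snd w} \<in> sets (S \<Otimes>\<^sub>M S)"
    and \<eta>: "0 \<le> \<eta>" "\<eta> \<le> 1"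
    and minor: "\<And>w A. w \<in> space S \<Longrightarrow> A \<in> sets S \<Longrightarrow> \<eta> * measure m A \<le> measure (K w) A"
  shows "tv_dist (M \<bind> K) (N \<bind> K) \<le> (1 - \<eta>) * tv_dist M N"
proof -
  have Ms: "sets M = sets S" "space M = space S" and Mp: "prob_space M"
    and Ns: "sets N = sets S" "space N = space S" and Np: "prob_space N"
    and ms: "sets m = sets S" "space m = space S" and mp: "prob_space m"
    using M N m sets_eq_imp_space_eq by (auto simp: space_prob_algebra)
  have K': "K \<in> S \<rightarrow>\<^sub>M subprob_algebra S" using K by (rule measurable_prob_algebraD)
  have KM: "K \<in> M \<rightarrow>\<^sub>M subprob_algebra S" and KN: "K \<in> N \<rightarrow>\<^sub>M subprob_algebra S"
    using K' by (simp_all cong: measurable_cong_sets add: Ms Ns)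
  have Kw: "prob_space (K w)" "sets (K w) = sets S" "space (K w) = space S" if "w \<in> space S" for w
    using measurable_space[OF K that] sets_eq_imp_space_eq by (auto simp: space_prob_algebra)
  have bs: "sets (M \<bind> K) = sets S" "sets (N \<bind> K) = sets S"
    using sets_bind'[OF M K] sets_bind'[OF N K] by simp_all
  have bsp: "space (M \<bind> K) = space S" "space (N \<bind> K) = space S"
    using bs by (auto dest: sets_eq_imp_space_eq)
  have le: "tv_dist (M \<bind> K) (N \<bind> K) \<le> (1 - \<eta>) * measure \<gamma> {w \<in> space \<gamma>. fst w \<noteq> snd w}"
    if \<gamma>: "\<gamma> \<in> couplings M N" for \<gamma>
  proof (rule tv_dist_le_of_setwise)
    show "prob_space (M \<bind> K)" "prob_space (N \<bind> K)"
      by (rule prob_space_bind'[OF M K], rule prob_space_bind'[OF N K])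
    show "sets (N \<bind> K) = sets (M \<bind> K)" by (simp add: bs)
    have pairs: "sets ((M \<bind> K) \<Otimes>\<^sub>M (M \<bind> K)) = sets (S \<Otimes>\<^sub>M S)"
      by (intro sets_pair_measure_cong bs)
    show "{w \<in> space ((M \<bind> K) \<Otimes>\<^sub>M (M \<bind> K)). fst w \<noteq> snd w} \<in> sets ((M \<bind> K) \<Otimes>\<^sub>M (M \<bind> K))"
      using diag pairs by (simp add: sets_eq_imp_space_eq[OF pairs])
    fix A assume "A \<in> sets (M \<bind> K)"
    then have A: "A \<in> sets S" by (simp add: bs)
    define k where "k w = measure (K w) A" for w
    have km [measurable]: "k \<in> borel_measurable S"
      unfolding k_def using K' A by (rule measurable_compose[OF _ measurable_measure_subprob_algebra])
    have k_le: "\<eta> * measure m A \<le> k w" "k w \<le> 1 - \<eta> + \<eta> * measure m A" "0 \<le> k w" "k w \<le> 1"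
      if w: "w \<in> space S" for w
    proof -
      interpret Kw: prob_space "K w" using w by (rule Kw)
      interpret m: prob_space m by (rule mp)
      show "\<eta> * measure m A \<le> k w" unfolding k_def using w A by (rule minor)
      show "0 \<le> k w" "k w \<le> 1" by (simp_all add: k_def)
      have "measure (K w) (space S - A) = 1 - k w"
        unfolding k_def using A Kw.prob_compl[of A] w by (simp add: Kw)
      moreover have "measure m (space S - A) = 1 - measure m A"
        using A m.prob_compl[of A] by (simp add: ms)
      ultimately have "\<eta> * (1 - measure m A) \<le> 1 - k w"
        using minor[OF w, of "space S - A"] A by simp
      then show "k w \<le> 1 - \<eta> + \<eta> * measure m A"
        by (simp add: algebra_simps)
    qed
    interpret g: prob_space \<gamma> using space_couplings[OF \<gamma>] by simp
    have gs: "sets \<gamma> = sets (S \<Otimes>\<^sub>M S)"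
      using space_couplings(1)[OF \<gamma>] sets_pair_measure_cong[OF Ms(1) Ns(1)] by simp
    have gsp: "space \<gamma> = space S \<times> space S"
      using sets_eq_imp_space_eq[OF gs] by (simp add: space_pair_measure)
    have fm: "fst \<in> \<gamma> \<rightarrow>\<^sub>M M" "snd \<in> \<gamma> \<rightarrow>\<^sub>M N"
      using Ms Ns by (simp_all cong: measurable_cong_sets add: gs)
    have kf: "(\<lambda>w. k (fst w)) \<in> borel_measurable \<gamma>" "(\<lambda>w. k (snd w)) \<in> borel_measurable \<gamma>"
      by (simp_all cong: measurable_cong_sets add: gs)
    have int: "integrable \<gamma> (\<lambda>w. k (fst w))" "integrable \<gamma> (\<lambda>w. k (snd w))"
      by (rule g.integrable_const_bound[where B = 1]; use kf k_le in \<open>auto simp: gsp\<close>)+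
    have dm: "{w \<in> space \<gamma>. fst w \<noteq> snd w} \<in> sets \<gamma>"
      using diag by (simp add: gs sets_eq_imp_space_eq[OF gs])
    have "measure (M \<bind> K) A = (\<integral>w. k w \<partial>M)"
      unfolding k_def using KM A by (intro subprob_space.measure_bind prob_space_imp_subprob_space Mp)
    also have "\<dots> = (\<integral>w. k w \<partial>distr \<gamma> M fst)"
      using \<gamma> by (simp add: couplings_def)
    also have "\<dots> = (\<integral>w. k (fst w) \<partial>\<gamma>)"
      using fm by (intro integral_distr) (simp_all cong: measurable_cong_sets add: Ms)
    finally have Mk: "measure (M \<bind> K) A = (\<integral>w. k (fst w) \<partial>\<gamma>)" .
    have "measure (N \<bind> K) A = (\<integral>w. k w \<partial>N)"
      unfolding k_def using KN A by (intro subprob_space.measure_bind prob_space_imp_subprob_space Np)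
    also have "\<dots> = (\<integral>w. k w \<partial>distr \<gamma> N snd)"
      using \<gamma> by (simp add: couplings_def)
    also have "\<dots> = (\<integral>w. k (snd w) \<partial>\<gamma>)"
      using fm by (intro integral_distr) (simp_all cong: measurable_cong_sets add: Ns)
    finally have Nk: "measure (N \<bind> K) A = (\<integral>w. k (snd w) \<partial>\<gamma>)" .
    have di: "integrable \<gamma> (indicat_real {w \<in> space \<gamma>. fst w \<noteq> snd w})"
      by (intro integrable_real_indicator dm) (simp add: g.emeasure_eq_measure)
    have "measure (M \<bind> K) A - measure (N \<bind> K) A = (\<integral>w. k (fst w) - k (snd w) \<partial>\<gamma>)"
      unfolding Mk Nk using int by simp
    also have "\<dots> \<le> (\<integral>w. (1 - \<eta>) * indicator {w \<in> space \<gamma>. fst w \<noteq> snd w} w \<partial>\<gamma>)"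
    proof (rule integral_mono)
      fix w assume "w \<in> space \<gamma>"
      then show "k (fst w) - k (snd w) \<le> (1 - \<eta>) * indicator {w \<in> space \<gamma>. fst w \<noteq> snd w} w"
        using k_le(2)[of "fst w"] k_le(1)[of "snd w"] by (auto simp: gsp split: split_indicator)
    qed (use int di in auto)
    also have "\<dots> = (1 - \<eta>) * measure \<gamma> {w \<in> space \<gamma>. fst w \<noteq> snd w}"
      using dm by simp
    finally show "measure (M \<bind> K) A - measure (N \<bind> K) A
      \<le> (1 - \<eta>) * measure \<gamma> {w \<in> space \<gamma>. fst w \<noteq> snd w}" .
  qed
  have ne: "couplings M N \<noteq> {}" using pair_prob_in_couplings[OF Mp Np] by auto
  show ?thesis
  proof (cases "\<eta> = 1")
    case True
    then show ?thesis using le ne by force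
  next
    case False
    then have "tv_dist (M \<bind> K) (N \<bind> K) / (1 - \<eta>) \<le> tv_dist M N"
      unfolding tv_dist_def[of M N] using le ne \<eta>
      by (intro cINF_greatest) (auto simp: divide_simps mult.commute)
    then show ?thesis using False \<eta> by (simp add: divide_simps mult.commute)
  qed
qed

section \<open>Lebesgue measure under orthogonal and Lipschitz maps\<close>

text \<open>
  Determinants enter changes of variables through an elimination that orders the coordinates, so
  the next results are first obtained for well-ordered index types. Enumerating a finite
  index type transfers them to it, since relabelling coordinates is a measure preserving isometry.
\<close>

typedef (overloaded) 'n ranked = "{..<CARD('n::finite)}"
  by (rule exI[of _ 0]) simp

instantiation ranked :: (finite) linorder
begin
definition "less_eq_ranked (x :: 'a ranked) (y :: 'a ranked) \<longleftrightarrow> Rep_ranked x \<le> Rep_ranked y"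
definition "less_ranked (x :: 'a ranked) (y :: 'a ranked) \<longleftrightarrow> Rep_ranked x < Rep_ranked y"
instance
proof
  fix x y z :: "'a ranked"
  show "(x < y) = (x \<le> y \<and> \<not> y \<le> x)" "x \<le> x" "x \<le> y \<or> y \<le> x"
    by (simp_all only: less_eq_ranked_def less_ranked_def) linarith+
  show "x \<le> y \<Longrightarrow> y \<le> z \<Longrightarrow> x \<le> z"
    unfolding less_eq_ranked_def by (rule order_trans)
  show "x \<le> y \<Longrightarrow> y \<le> x \<Longrightarrow> x = y"
    unfolding less_eq_ranked_def Rep_ranked_inject[symmetric] by (rule antisym)
qed
end

instance ranked :: (finite) wellorder
proof (rule wf_wellorderI)
  have "{(x, y). x < y} = inv_image {(m, n). m < n} (Rep_ranked :: 'a ranked \<Rightarrow> nat)"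
    by (auto simp: less_ranked_def inv_image_def)
  then show "wf {(x, y). (x :: 'a ranked) < y}"
    by (simp add: wf_inv_image wf)
qed intro_classes

lemma card_UNIV_ranked: "card (UNIV :: 'n::finite ranked set) = CARD('n)"
  using type_definition.card[OF type_definition_ranked[where 'n='n]] by simp

instance ranked :: (finite) finite
proof
  have "(UNIV :: 'a ranked set) = Abs_ranked ` {..<CARD('a)}"
    using type_definition.Abs_image[OF type_definition_ranked[where 'n='a]] by (rule sym)
  then show "finite (UNIV :: 'a ranked set)"
    by (metis finite_imageI finite_lessThan)
qed

lemma ex_bij_ranked: "\<exists>b :: 'n::finite ranked \<Rightarrow> 'n. bij b"
  using finite_same_card_bij[of "UNIV :: 'n ranked set" "UNIV :: 'n set"]
  by (simp add: card_UNIV_ranked)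

definition relabel :: "('m \<Rightarrow> 'n) \<Rightarrow> real ^ 'n \<Rightarrow> real ^ 'm" where
  "relabel b x = (\<chi> i. x $ b i)"

lemma linear_relabel: "linear (relabel b)"
  by (rule linearI) (simp_all add: relabel_def vec_eq_iff)

lemma relabel_inner:
  fixes b :: "'m::finite \<Rightarrow> 'n::finite"
  assumes "bij b" shows "relabel b x \<bullet> relabel b y = x \<bullet> y"
  using sum.reindex_bij_betw[of b UNIV UNIV "\<lambda>i. x $ i * y $ i"] assms
  by (simp add: inner_vec_def relabel_def)

lemma relabel_inverse:
  assumes "bij b"
  shows "relabel (inv b) (relabel b x) = x" "relabel b (relabel (inv b) z) = z"
  using assms by (auto simp: relabel_def vec_eq_iff bij_is_inj bij_is_surj surj_f_inv_f)

lemma prod_Basis_vec: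
  fixes l u :: "real ^ 'n"
  shows "(\<Prod>c\<in>Basis. (u - l) \<bullet> c) = (\<Prod>i\<in>UNIV. u $ i - l $ i)"
proof -
  have B: "(Basis :: (real ^ 'n) set) = (\<lambda>i. axis i 1) ` UNIV"
    by (auto simp: Basis_vec_def)
  show ?thesis
    unfolding B by (subst prod.reindex) (auto simp: inj_on_def axis_eq_axis inner_axis)
qed

lemma distr_lborel_relabel:
  fixes b :: "'m::finite \<Rightarrow> 'n::finite"
  assumes "bij b"
  shows "distr lborel borel (relabel b) = lborel"
proof (rule lborel_eqI[symmetric])
  have [measurable]: "relabel b \<in> borel_measurable borel"
    by (intro borel_measurable_continuous_onI linear_continuous_on linear_conv_bounded_linear[THEN iffD1] linear_relabel)
  fix l u :: "real ^ 'm" assume le: "\<And>c. c \<in> Basis \<Longrightarrow> l \<bullet> c \<le> u \<bullet> c"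
  have le': "l $ i \<le> u $ i" for i
    using le[of "axis i 1"] by (simp add: inner_axis)
  let ?l = "relabel (inv b) l" and ?u = "relabel (inv b) u"
  have "relabel b -` box l u = box ?l ?u"
  proof -
    have "(\<forall>i. l $ i < x $ b i \<and> x $ b i < u $ i) \<longleftrightarrow>
       (\<forall>j. l $ inv b j < x $ j \<and> x $ j < u $ inv b j)" for x :: "real ^ 'n"
      using assms by (metis bij_inv_eq_iff)
    then show ?thesis by (auto simp: mem_box_cart relabel_def)
  qed
  then have "emeasure (distr lborel borel (relabel b)) (box l u) = emeasure lborel (box ?l ?u)"
    by (simp add: emeasure_distr)
  also have "\<dots> = ennreal (\<Prod>c\<in>Basis. (?u - ?l) \<bullet> c)"
    by (intro emeasure_lborel_box) (auto simp: Basis_vec_def inner_axis relabel_def le')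
  also have "(\<Prod>c\<in>Basis. (?u - ?l) \<bullet> c) = (\<Prod>i\<in>UNIV. u $ inv b i - l $ inv b i)"
    unfolding prod_Basis_vec by (simp add: relabel_def)
  also have "\<dots> = (\<Prod>i\<in>UNIV. u $ i - l $ i)"
    using prod.reindex_bij_betw[of "inv b" UNIV UNIV "\<lambda>i. u $ i - l $ i"] assms
    by (simp add: bij_imp_bij_inv)
  finally show "emeasure (distr lborel borel (relabel b)) (box l u)
      = ennreal (\<Prod>c\<in>Basis. (u - l) \<bullet> c)"
    unfolding prod_Basis_vec .
qed simp

lemma continuous_on_linear_vec: "linear (f :: real^'m \<Rightarrow> real^'n) \<Longrightarrow> continuous_on S f"
  by (intro linear_continuous_on linear_conv_bounded_linear[THEN iffD1])

lemma distr_lborel_orthogonal_wellorder: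
  fixes f :: "real ^ 'n::{finite,wellorder} \<Rightarrow> real ^ 'n::_"
  assumes f: "orthogonal_transformation f"
  shows "distr lborel borel f = lborel"
proof (rule lborel_eqI[symmetric])
  have [measurable]: "f \<in> borel_measurable borel"
    by (intro borel_measurable_continuous_onI continuous_on_linear_vec orthogonal_transformation_linear f)
  have bf: "bij f" using f by (rule orthogonal_transformation_bij)
  have g: "orthogonal_transformation (inv f)"
    using f by (rule orthogonal_transformation_inv)
  fix l u :: "real ^ 'n::_" assume le: "\<And>c. c \<in> Basis \<Longrightarrow> l \<bullet> c \<le> u \<bullet> c"
  have eq: "f -` box l u = inv f ` box l u"
    using bf by (simp add: bij_vimage_eq_inv_image)
  have lm: "inv f ` box l u \<in> lmeasurable"
    by (rule measurable_orthogonal_image[OF g]) simp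
  have "emeasure (distr lborel borel f) (box l u) = emeasure lborel (f -` box l u)"
    by (simp add: emeasure_distr)
  also have "\<dots> = emeasure lebesgue (inv f ` box l u)"
    unfolding eq[symmetric]
    using measurable_sets_borel[OF \<open>f \<in> borel_measurable borel\<close>, of "box l u"]
    by simp
  also have "\<dots> = measure lebesgue (inv f ` box l u)"
    using lm by (rule emeasure_eq_measure2)
  also have "\<dots> = measure lebesgue (box l u)"
    by (subst measure_orthogonal_image[OF g]) (rule lmeasurable_box, rule refl)
  also have "\<dots> = ennreal (\<Prod>c\<in>Basis. (u - l) \<bullet> c)"
    using emeasure_lborel_box[OF le]
    by (subst emeasure_eq_measure2[symmetric]) (simp_all only: lmeasurable_box, simp)
  finally show "emeasure (distr lborel borel f) (box l u)
      = ennreal (\<Prod>c\<in>Basis. (u - l) \<bullet> c)" by simp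
qed simp

lemma distr_lborel_orthogonal:
  fixes f :: "real ^ 'n \<Rightarrow> real ^ 'n"
  assumes f: "orthogonal_transformation f"
  shows "distr lborel borel f = lborel"
proof -
  obtain b :: "'n ranked \<Rightarrow> 'n" where b: "bij b" using ex_bij_ranked by blast
  then have b': "bij (inv b)" by (rule bij_imp_bij_inv)
  let ?h = "relabel b" and ?k = "relabel (inv b)"
  define g where "g = ?h \<circ> f \<circ> ?k"
  have lf: "linear f" using f by (rule orthogonal_transformation_linear)
  have lg: "linear g"
    unfolding g_def by (intro linear_compose linear_relabel lf)
  have "orthogonal_transformation g"
    unfolding orthogonal_transformation_def
  proof (intro conjI allI lg)
    show "g v \<bullet> g w = v \<bullet> w" for v w
      using f relabel_inner[OF b] relabel_inner[OF b']
      by (simp add: g_def orthogonal_transformation_def)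
  qed
  then have dg: "distr lborel borel g = lborel"
    by (rule distr_lborel_orthogonal_wellorder)
  have m: "linear h \<Longrightarrow> h \<in> borel_measurable borel" for h :: "real^'x \<Rightarrow> real^'y"
    by (intro borel_measurable_continuous_onI continuous_on_linear_vec)
  have [measurable]: "f \<in> borel_measurable borel" "g \<in> borel_measurable borel"
    "?h \<in> borel_measurable borel" "?k \<in> borel_measurable borel"
    by (intro m lf lg linear_relabel)+
  have fg: "f = ?k \<circ> g \<circ> ?h"
    by (auto simp: g_def relabel_inverse b)
  have "distr lborel borel f = distr (distr (distr lborel borel ?h) borel g) borel ?k"
    by (subst fg) (simp add: distr_distr comp_assoc)
  also have "\<dots> = lborel"
    by (simp add: distr_lborel_relabel b b' dg)
  finally show ?thesis .
qed

text \<open>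
  The Leibniz expansion has \<open>n!\<close> summands. A crude bound is enough, as the minorization constant
  may depend on the dimension in any way.
\<close>

lemma abs_det_le:
  fixes A :: "real ^ 'n ^ 'n"
  assumes "\<And>i j. \<bar>A $ i $ j\<bar> \<le> L"
  shows "\<bar>det A\<bar> \<le> fact CARD('n) * L ^ CARD('n)"
proof -
  have "\<bar>det A\<bar> \<le> (\<Sum>p | p permutes (UNIV :: 'n set). \<bar>of_int (sign p) * (\<Prod>i\<in>UNIV. A $ i $ p i)\<bar>)"
    unfolding det_def by (rule sum_abs)
  also have "\<dots> \<le> (\<Sum>p | p permutes (UNIV :: 'n set). L ^ CARD('n))"
  proof (rule sum_mono)
    fix p :: "'n \<Rightarrow> 'n"
    have "\<bar>of_int (sign p) * (\<Prod>i\<in>UNIV. A $ i $ p i)\<bar> = (\<Prod>i\<in>UNIV. \<bar>A $ i $ p i\<bar>)"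
      by (simp add: abs_mult abs_prod sign_def)
    also have "\<dots> \<le> (\<Prod>i\<in>(UNIV :: 'n set). L)"
      by (intro prod_mono) (auto simp: assms)
    finally show "\<bar>of_int (sign p) * (\<Prod>i\<in>UNIV. A $ i $ p i)\<bar> \<le> L ^ CARD('n)"
      by simp
  qed
  also have "\<dots> = fact CARD('n) * L ^ CARD('n)"
    by (simp add: card_permutations)
  finally show ?thesis .
qed

text \<open>
  All entries of the Jacobian matrix are at most \<open>L\<close> in absolute value, which bounds the Jacobian
  determinant and hence the expansion of volume.
\<close>

lemma emeasure_image_le_wellorder:
  fixes f :: "real ^ 'n::{finite,wellorder} \<Rightarrow> real ^ 'n::_"
  assumes S: "S \<in> sets borel" and fS: "f ` S \<in> sets borel" and "bounded S"
    and deriv: "\<And>x. x \<in> S \<Longrightarrow> (f has_derivative f' x) (at x within S)"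
    and le: "\<And>x h. x \<in> S \<Longrightarrow> norm (f' x h) \<le> L * norm h"
  shows "emeasure lborel (f ` S) \<le> ennreal (fact CARD('n) * L ^ CARD('n)) * emeasure lborel S"
proof -
  let ?B = "fact CARD('n) * L ^ CARD('n)"
  have SL: "S \<in> lmeasurable"
    using \<open>bounded S\<close> S by (intro bounded_set_imp_lmeasurable) auto
  have det_le: "\<bar>det (matrix (f' x))\<bar> \<le> ?B" if "x \<in> S" for x
  proof (rule abs_det_le)
    fix i j :: 'n
    have "\<bar>matrix (f' x) $ i $ j\<bar> \<le> norm (f' x (axis j 1))"
      by (simp add: matrix_def component_le_norm_cart)
    also have "\<dots> \<le> L" using le[OF that, of "axis j 1"] by simp
    finally show "\<bar>matrix (f' x) $ i $ j\<bar> \<le> L" .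
  qed
  have "(\<lambda>x. det (matrix (f' x))) \<in> borel_measurable (lebesgue_on S)"
    using SL deriv by (intro borel_measurable_det_Jacobian) (auto simp: fmeasurableD)
  then have m: "(\<lambda>x. \<bar>det (matrix (f' x))\<bar>) \<in> borel_measurable (lebesgue_on S)"
    by (rule borel_measurable_abs)
  have i: "(\<lambda>x. \<bar>det (matrix (f' x))\<bar>) integrable_on S"
    by (rule measurable_bounded_by_integrable_imp_integrable_real[where g = "\<lambda>_. ?B",
          OF m integrable_on_const[OF SL]])
      (use SL det_le in \<open>auto intro: fmeasurableD\<close>)
  note * = measurable_bounded_differentiable_image[OF SL deriv i det_le]
           measure_bounded_differentiable_image[OF SL deriv i det_le]
  have "emeasure lborel (f ` S) = emeasure lebesgue (f ` S)" "emeasure lborel S = emeasure lebesgue S"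
    using S fS by simp_all
  moreover have "emeasure lebesgue (f ` S) = ennreal (measure lebesgue (f ` S))"
     "emeasure lebesgue S = ennreal (measure lebesgue S)"
    by (simp_all only: emeasure_eq_measure2[OF *(1)] emeasure_eq_measure2[OF SL])
  moreover have "ennreal (measure lebesgue (f ` S)) \<le> ennreal (?B * measure lebesgue S)"
    using *(2) by (intro ennreal_leI)
  ultimately show ?thesis
    by (simp add: ennreal_mult'')
qed

lemma emeasure_image_le:
  fixes f :: "real ^ 'n \<Rightarrow> real ^ 'n"
  assumes S: "S \<in> sets borel" and fS: "f ` S \<in> sets borel" and "bounded S"
    and deriv: "\<And>x. x \<in> S \<Longrightarrow> (f has_derivative f' x) (at x within S)"
    and le: "\<And>x h. x \<in> S \<Longrightarrow> norm (f' x h) \<le> L * norm h"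
  shows "emeasure lborel (f ` S) \<le> ennreal (fact CARD('n) * L ^ CARD('n)) * emeasure lborel S"
proof -
  obtain b :: "'n ranked \<Rightarrow> 'n" where b: "bij b" using ex_bij_ranked by blast
  then have b': "bij (inv b)" by (rule bij_imp_bij_inv)
  let ?h = "relabel b" and ?k = "relabel (inv b)"
  have bl: "bounded_linear ?h" "bounded_linear ?k"
    by (intro linear_conv_bounded_linear[THEN iffD1] linear_relabel)+
  have nh: "norm (?h v) = norm v" "norm (?k w) = norm w" for v w
    by (simp_all add: norm_eq_sqrt_inner relabel_inner b b')
  have meas: "?h \<in> borel_measurable borel" "?k \<in> borel_measurable borel"
    by (intro borel_measurable_continuous_onI continuous_on_linear_vec linear_relabel)+
  have img: "?h ` X = ?k -` X" for X
    by (auto simp: image_iff) (metis relabel_inverse[OF b])+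
  have hX: "?h ` X \<in> sets borel" "emeasure lborel (?h ` X) = emeasure lborel X"
    if X: "X \<in> sets borel" for X
  proof -
    show "?h ` X \<in> sets borel"
      unfolding img using measurable_sets_borel[OF meas(2) X] by simp
    have "emeasure lborel X = emeasure (distr lborel borel ?k) X"
      by (simp add: distr_lborel_relabel b')
    also have "\<dots> = emeasure lborel (?h ` X)"
      unfolding img using X meas by (simp add: emeasure_distr)
    finally show "emeasure lborel (?h ` X) = emeasure lborel X" by simp
  qed
  define g where "g = ?h \<circ> f \<circ> ?k"
  have gS: "g ` (?h ` S) = ?h ` (f ` S)"
    by (auto simp: g_def image_image relabel_inverse b)
  have "emeasure lborel (g ` (?h ` S))
    \<le> ennreal (fact CARD('n ranked) * L ^ CARD('n ranked)) * emeasure lborel (?h ` S)"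
  proof (rule emeasure_image_le_wellorder)
    show "?h ` S \<in> sets borel" "g ` (?h ` S) \<in> sets borel"
      unfolding gS using S fS by (auto intro: hX)
    show "bounded (?h ` S)"
      using \<open>bounded S\<close> bl(1) by (rule bounded_linear_image)
    show "(g has_derivative (\<lambda>v. ?h (f' (?k x) (?k v)))) (at x within ?h ` S)"
      if "x \<in> ?h ` S" for x
    proof -
      have kx: "?k x \<in> S" using that by (auto simp: relabel_inverse b)
      have "(?k has_derivative ?k) (at x within ?h ` S)"
        using bl(2) by (rule bounded_linear_imp_has_derivative)
      moreover have "?k ` (?h ` S) = S"
        by (auto simp: image_image relabel_inverse b)
      ultimately have "((\<lambda>x. f (?k x)) has_derivative (\<lambda>v. f' (?k x) (?k v))) (at x within ?h ` S)"
        using has_derivative_in_compose[of ?k ?k x "?h ` S" f "f' (?k x)"] deriv[OF kx] by metis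
      from bounded_linear.has_derivative[OF bl(1) this]
      show ?thesis by (simp add: g_def comp_def)
    qed
    show "norm (?h (f' (?k x) (?k h))) \<le> L * norm h" if "x \<in> ?h ` S" for x h
      using that le[of "?k x" "?k h"] by (auto simp: nh relabel_inverse b)
  qed
  then show ?thesis
    unfolding gS using S fS by (simp add: hX card_UNIV_ranked)
qed

text \<open>
  The push-forward of Lebesgue measure on \<open>D\<close> dominates a multiple of Lebesgue measure on \<open>f ` D\<close>:
  an upper bound for a derivative is a lower bound for a density. Points of the image that are hit
  several times only help, so \<open>f\<close> may fold \<open>D\<close>.
\<close>

lemma nn_integral_image_le:
  fixes f :: "real ^ 'n \<Rightarrow> real ^ 'n" and G :: "real ^ 'n \<Rightarrow> ennreal"
  assumes D: "compact D" and cont: "continuous_on D f"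
    and deriv: "\<And>x. x \<in> D \<Longrightarrow> (f has_derivative f' x) (at x)"
    and le: "\<And>x h. x \<in> D \<Longrightarrow> norm (f' x h) \<le> L * norm h"
    and G: "G \<in> borel_measurable borel"
  shows "(\<integral>\<^sup>+p. G p * indicator (f ` D) p \<partial>lborel)
    \<le> ennreal (fact CARD('n) * L ^ CARD('n)) * (\<integral>\<^sup>+v. G (f v) * indicator D v \<partial>lborel)"
proof -
  let ?C = "ennreal (fact CARD('n) * L ^ CARD('n))"
  have Dm [measurable]: "D \<in> sets borel" using D by (intro borel_compact)
  have fDm [measurable]: "f ` D \<in> sets borel"
    using D cont by (intro borel_compact compact_continuous_image)
  have fm [measurable]: "f \<in> borel_measurable (restrict_space borel D)"
    using cont by (rule borel_measurable_continuous_on_restrict)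
  have fm' [measurable]: "f \<in> borel_measurable (restrict_space lborel D)"
    using fm unfolding measurable_cong_sets[OF sets_restrict_space_cong[OF sets_lborel] refl] .
  let ?M = "density lborel (indicator (f ` D))"
  let ?N = "scale_measure ?C (distr (restrict_space lborel D) borel f)"
  have "?M \<le> ?N"
  proof (subst le_measure)
    show "\<forall>A\<in>sets ?M. emeasure ?M A \<le> emeasure ?N A"
    proof
      fix A assume "A \<in> sets ?M"
      then have A [measurable]: "A \<in> sets borel" by simp
      define S where "S = f -` A \<inter> D"
      have S: "S \<in> sets borel"
        using measurable_sets[OF fm A] unfolding S_def
        by (simp add: space_restrict_space sets_restrict_space_iff)
      have fS: "f ` S = f ` D \<inter> A" unfolding S_def by auto
      have "emeasure ?M A = emeasure lborel (f ` S)"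
        unfolding fS by (simp add: emeasure_density indicator_inter_arith[symmetric] Int_commute)
      also have "\<dots> \<le> ?C * emeasure lborel S"
        using S fS le by (intro emeasure_image_le[where f' = f'])
          (auto simp: S_def intro: bounded_subset compact_imp_bounded[OF D]
             has_derivative_at_withinI deriv)
      also have "\<dots> = emeasure ?N A"
        by (simp add: emeasure_distr S_def space_restrict_space emeasure_restrict_space)
      finally show "emeasure ?M A \<le> emeasure ?N A" .
    qed
  qed simp
  then have "nn_integral ?M G \<le> nn_integral ?N G"
    by (intro nn_integral_mono_measure) simp
  also have "nn_integral ?N G = ?C * (\<integral>\<^sup>+v. G (f v) * indicator D v \<partial>lborel)"
    using G by (simp add: nn_integral_scale_measure nn_integral_distr nn_integral_restrict_space)
  also have "nn_integral ?M G = (\<integral>\<^sup>+p. G p * indicator (f ` D) p \<partial>lborel)"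
    using G by (subst nn_integral_density) (auto simp: mult.commute)
  finally show ?thesis .
qed

section \<open>Integration over the torus\<close>

lemma torus_measurable [measurable]: "torus \<in> sets (borel :: (real ^ 'n) measure)"
proof -
  have "torus = (\<Inter>i. {x :: real ^ 'n. 0 \<le> x $ i \<and> x $ i < 1})"
    by (auto simp: torus_def)
  also have "\<dots> \<in> sets borel" by measurable
  finally show ?thesis .
qed

definition int_vec :: "int ^ 'n \<Rightarrow> real ^ 'n" where
  "int_vec z = (\<chi> i. of_int (z $ i))"

lemma periodic_add_int_vec: "periodic f \<Longrightarrow> f (x + int_vec z) = f x"
  unfolding periodic_def int_vec_def by auto

lemma nn_integral_torus_shifts:
  fixes q :: "real ^ 'n"
  shows "(\<integral>\<^sup>+z. indicator torus (q + int_vec z) \<partial>count_space UNIV) = (1 :: ennreal)"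
proof -
  define z0 :: "int ^ 'n" where "z0 = (\<chi> i. - \<lfloor>q $ i\<rfloor>)"
  have "q + int_vec z \<in> torus \<longleftrightarrow> z = z0" for z :: "int ^ 'n"
  proof -
    have "0 \<le> q $ i + of_int (z $ i) \<and> q $ i + of_int (z $ i) < 1 \<longleftrightarrow> z $ i = - \<lfloor>q $ i\<rfloor>" for i
      by linarith
    then show ?thesis by (simp add: torus_def int_vec_def z0_def vec_eq_iff)
  qed
  then have "indicator torus (q + int_vec z) = (indicator {z0} z :: ennreal)" for z
    by (simp add: indicator_def)
  then show ?thesis by simp
qed

lemma nn_integral_lborel_shift:
  fixes f :: "'a::euclidean_space \<Rightarrow> ennreal"
  assumes [measurable]: "f \<in> borel_measurable borel"
  shows "(\<integral>\<^sup>+x. f (c + x) \<partial>lborel) = (\<integral>\<^sup>+x. f x \<partial>lborel)"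
proof -
  have "(\<integral>\<^sup>+x. f x \<partial>lborel) = (\<integral>\<^sup>+x. f x \<partial>distr lborel borel ((+) c))"
    by (simp add: lborel_distr_plus)
  also have "\<dots> = (\<integral>\<^sup>+x. f (c + x) \<partial>lborel)"
    by (rule nn_integral_distr) simp_all
  finally show ?thesis ..
qed

text \<open>
  Cut the translated cube along the integer lattice and move the pieces back into the fundamental
  cube by periodicity; the integer translates of the cube partition the space.
\<close>

lemma nn_integral_torus_translate:
  fixes k :: "real ^ 'n \<Rightarrow> ennreal"
  assumes [measurable]: "k \<in> borel_measurable borel" and per: "periodic k"
  shows "(\<integral>\<^sup>+p. k (v + p) * indicator torus p \<partial>lborel) = (\<integral>\<^sup>+p. k p * indicator torus p \<partial>lborel)"
proof -
  let ?T = "indicator torus :: real ^ 'n \<Rightarrow> ennreal"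
  have cnt: "countable (UNIV :: (int ^ 'n) set)" by simp
  have "(\<integral>\<^sup>+p. k (v + p) * ?T p \<partial>lborel) = (\<integral>\<^sup>+q. k q * ?T (q - v) \<partial>lborel)"
    using nn_integral_lborel_shift[of "\<lambda>q. k q * ?T (q - v)" v] by simp
  also have "\<dots> = (\<integral>\<^sup>+q. \<integral>\<^sup>+z. k q * ?T (q - v) * ?T (q + int_vec z) \<partial>count_space UNIV \<partial>lborel)"
    by (simp add: nn_integral_cmult nn_integral_torus_shifts)
  also have "\<dots> = (\<integral>\<^sup>+z. \<integral>\<^sup>+q. k q * ?T (q - v) * ?T (q + int_vec z) \<partial>lborel \<partial>count_space UNIV)"
    by (rule nn_integral_count_space_nn_integral[OF cnt]) measurable
  also have "\<dots> = (\<integral>\<^sup>+z. \<integral>\<^sup>+q. k q * ?T (q - v - int_vec z) * ?T q \<partial>lborel \<partial>count_space UNIV)"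
  proof (rule nn_integral_cong)
    fix z :: "int ^ 'n"
    have "k (q - int_vec z) = k q" for q
      using periodic_add_int_vec[OF per, of "q - int_vec z" z] by simp
    then show "(\<integral>\<^sup>+q. k q * ?T (q - v) * ?T (q + int_vec z) \<partial>lborel)
        = (\<integral>\<^sup>+q. k q * ?T (q - v - int_vec z) * ?T q \<partial>lborel)"
      using nn_integral_lborel_shift[of "\<lambda>q. k q * ?T (q - v) * ?T (q + int_vec z)" "- int_vec z"]
      by (simp add: algebra_simps)
  qed
  also have "\<dots> = (\<integral>\<^sup>+q. \<integral>\<^sup>+z. k q * ?T (q - v - int_vec z) * ?T q \<partial>count_space UNIV \<partial>lborel)"
    by (rule nn_integral_count_space_nn_integral[OF cnt, symmetric]) measurable
  also have "\<dots> = (\<integral>\<^sup>+q. k q * ?T q * (\<integral>\<^sup>+z. ?T (q - v + int_vec z) \<partial>count_space UNIV) \<partial>lborel)"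
  proof (rule nn_integral_cong)
    fix q :: "real ^ 'n"
    have "bij (\<lambda>z :: int ^ 'n. - z)" by (rule bij_uminus)
    then have "(\<integral>\<^sup>+z. ?T (q - v - int_vec z) \<partial>count_space UNIV)
        = (\<integral>\<^sup>+z. ?T (q - v - int_vec (- z)) \<partial>count_space UNIV)"
      by (subst nn_integral_bij_count_space[symmetric, where g = uminus]) auto
    then have "(\<integral>\<^sup>+z. ?T (q - v - int_vec z) \<partial>count_space UNIV)
        = (\<integral>\<^sup>+z. ?T (q - v + int_vec z) \<partial>count_space UNIV)"
      by (simp add: int_vec_def minus_vec_def plus_vec_def)
    then show "(\<integral>\<^sup>+z. k q * ?T (q - v - int_vec z) * ?T q \<partial>count_space UNIV)
       = k q * ?T q * (\<integral>\<^sup>+z. ?T (q - v + int_vec z) \<partial>count_space UNIV)"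
      by (simp add: nn_integral_cmult nn_integral_multc mult_ac)
  qed
  finally show ?thesis by (simp add: nn_integral_torus_shifts)
qed

lemma emeasure_torus: "emeasure lborel (torus :: (real ^ 'n) set) = 1"
proof -
  have one: "emeasure lborel (box 0 1 :: (real ^ 'n) set) = 1" "emeasure lborel (cbox 0 1 :: (real ^ 'n) set) = 1"
    by (subst emeasure_lborel_box emeasure_lborel_cbox; auto simp: Basis_vec_def inner_axis prod.neutral)+
  have "emeasure lborel (box 0 1 :: (real ^ 'n) set) \<le> emeasure lborel (torus :: (real ^ 'n) set)"
    by (rule emeasure_mono) (auto simp: torus_def mem_box_cart intro: less_imp_le)
  moreover have "emeasure lborel (torus :: (real ^ 'n) set) \<le> emeasure lborel (cbox 0 1 :: (real ^ 'n) set)"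
    by (rule emeasure_mono) (auto simp: torus_def mem_box_cart less_imp_le)
  ultimately show ?thesis unfolding one by (rule antisym[rotated])
qed

section \<open>The uniform measure on the sphere\<close>

lemma measure_unit_ball_pos: "measure lborel (ball 0 1 :: (real ^ 'n) set) > 0"
  by (rule content_ball_pos) simp

lemma emeasure_unit_ball:
  "emeasure lborel (ball 0 1 :: (real ^ 'n) set) = ennreal (measure lborel (ball 0 1 :: (real ^ 'n) set))"
  using emeasure_lborel_ball_finite[of "0 :: real ^ 'n" 1] by (intro emeasure_eq_ennreal_measure) auto

lemma emeasure_unit_ball_nz:
  "emeasure lborel (ball 0 1 :: (real ^ 'n) set) \<noteq> 0" "emeasure lborel (ball 0 1 :: (real ^ 'n) set) \<noteq> \<top>"
  using measure_unit_ball_pos[where 'n = 'n] unfolding emeasure_unit_ball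
  by (simp_all add: ennreal_eq_0_iff not_le)

lemma sets_uniform_sphere [measurable_cong]:
  "sets uniform_sphere = sets (restrict_space borel (sphere 0 1))"
  unfolding uniform_sphere_def by (intro sets_restrict_space_cong) simp

lemma space_uniform_sphere: "space uniform_sphere = sphere 0 1"
  unfolding uniform_sphere_def by (simp add: space_restrict_space)

lemma AE_sgn_in_sphere:
  "AE v in uniform_measure lborel (ball 0 1). sgn (v :: real ^ 'n) \<in> sphere 0 1"
proof -
  have "AE v in lborel. v \<noteq> (0 :: real ^ 'n)" by (rule AE_lborel_singleton)
  then have "AE v in lborel. v \<in> ball 0 1 \<longrightarrow> sgn (v :: real ^ 'n) \<in> sphere 0 1"
    by eventually_elim (simp add: norm_sgn)
  then show ?thesis
    using emeasure_unit_ball_nz[where 'n = 'n]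
    by (subst AE_uniform_measure) (simp_all add: less_top)
qed

lemma nn_integral_uniform_sphere:
  fixes h :: "real ^ 'n \<Rightarrow> ennreal"
  assumes [measurable]: "h \<in> borel_measurable borel"
  shows "(\<integral>\<^sup>+z. h z \<partial>uniform_sphere)
    = (\<integral>\<^sup>+v. h (sgn v) * indicator (ball 0 1) v \<partial>lborel) / emeasure lborel (ball 0 1 :: (real ^ 'n) set)"
proof -
  have [measurable]: "sphere (0 :: real ^ 'n) 1 \<in> sets borel" by (intro borel_closed) simp
  have "(\<integral>\<^sup>+z. h z \<partial>uniform_sphere)
      = (\<integral>\<^sup>+v. h (sgn v) * indicator (sphere 0 1) (sgn v) \<partial>uniform_measure lborel (ball 0 1))"
    unfolding uniform_sphere_def by (subst nn_integral_restrict_space) (simp_all add: nn_integral_distr)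
  also have "\<dots> = (\<integral>\<^sup>+v. h (sgn v) \<partial>uniform_measure lborel (ball 0 1))"
    using AE_sgn_in_sphere by (intro nn_integral_cong_AE) (auto simp: indicator_def elim!: eventually_mono)
  finally show ?thesis by (simp add: nn_integral_uniform_measure)
qed

lemma prob_space_uniform_sphere: "prob_space (uniform_sphere :: (real ^ 'n) measure)"
proof
  show "emeasure uniform_sphere (space (uniform_sphere :: (real ^ 'n) measure)) = 1"
    using nn_integral_uniform_sphere[of "\<lambda>_::real ^ 'n. 1"] emeasure_unit_ball_nz[where 'n='n]
    by (simp add: ennreal_divide_self less_top[symmetric])
qed

text \<open>
  An orthogonal map commutes with the radial projection \<open>sgn\<close> and preserves both Lebesgue measure
  and the ball.
\<close>

lemma distr_uniform_sphere_orthogonal: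
  fixes f :: "real ^ 'n \<Rightarrow> real ^ 'n"
  assumes f: "orthogonal_transformation f"
  shows "distr uniform_sphere uniform_sphere f = uniform_sphere"
proof (rule measure_eqI)
  have lf: "linear f" and nf: "norm (f x) = norm x" for x
    using f by (auto simp: orthogonal_transformation)
  have [measurable]: "f \<in> borel_measurable borel"
    by (intro borel_measurable_continuous_onI continuous_on_linear_vec lf)
  have fm: "f \<in> uniform_sphere \<rightarrow>\<^sub>M uniform_sphere"
    unfolding measurable_cong_sets[OF sets_uniform_sphere sets_uniform_sphere]
    by (rule measurable_restrict_space3) (auto simp: nf)
  have sf: "sgn (f v) = f (sgn v)" for v
    by (simp add: sgn_div_norm nf linear_scale[OF lf])
  have [measurable]: "ball (0 :: real ^ 'n) 1 \<in> sets borel" by simp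
  have ball: "indicator (ball 0 1) (f v) = (indicator (ball 0 1) v :: ennreal)" for v
    by (simp add: indicator_def nf)
  have [measurable]: "sphere (0 :: real ^ 'n) 1 \<in> sets borel" by (intro borel_closed) simp
  fix A assume "A \<in> sets (distr uniform_sphere uniform_sphere f)"
  then have As: "A \<in> sets uniform_sphere" by simp
  then have A [measurable]: "A \<in> sets borel"
    unfolding sets_uniform_sphere by (subst (asm) sets_restrict_space_iff) auto
  have "emeasure (distr uniform_sphere uniform_sphere f) A = (\<integral>\<^sup>+z. indicator A z \<partial>distr uniform_sphere uniform_sphere f)"
    using As by simp
  also have "\<dots> = (\<integral>\<^sup>+z. indicator A (f z) \<partial>uniform_sphere)"
    using fm As by (intro nn_integral_distr) auto
  also have "\<dots> = (\<integral>\<^sup>+v. indicator A (sgn (f v)) * indicator (ball 0 1) (f v) \<partial>lborel) / emeasure lborel (ball 0 1 :: (real ^ 'n) set)"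
    by (subst nn_integral_uniform_sphere) (simp_all add: sf ball)
  also have "(\<integral>\<^sup>+v. indicator A (sgn (f v)) * indicator (ball 0 1) (f v) \<partial>lborel)
     = (\<integral>\<^sup>+v. indicator A (sgn v) * indicator (ball 0 1) v \<partial>distr lborel borel f)"
    by (subst nn_integral_distr) simp_all
  also have "\<dots> = (\<integral>\<^sup>+v. indicator A (sgn v) * indicator (ball 0 1) v \<partial>lborel)"
    by (simp only: distr_lborel_orthogonal[OF f])
  also have "\<dots> / emeasure lborel (ball 0 1 :: (real ^ 'n) set) = (\<integral>\<^sup>+z. indicator A z \<partial>uniform_sphere)"
    by (subst nn_integral_uniform_sphere) simp_all
  also have "\<dots> = emeasure uniform_sphere A" using As by simp
  finally show "emeasure (distr uniform_sphere uniform_sphere f) A = emeasure uniform_sphere A" .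
qed simp

section \<open>Flights with one random change of velocity\<close>

text \<open>
  The end points of the flights \<open>0 \<rightarrow> (\<tau> - s) y \<rightarrow> (\<tau> - s) y + s z\<close> with \<open>|z| = 1\<close> are the \<open>p\<close> at distance
  \<open>s\<close> from \<open>(\<tau> - s) y\<close>. At \<open>s = \<tau>\<close> this distance is at most \<open>s\<close>, and at \<open>s = s0\<close> at least \<open>s\<close>; the
  intermediate value theorem yields a suitable duration, bounded away from \<open>0\<close>.
\<close>

lemma two_leg_map_surj:
  fixes p y :: "real ^ 'n"
  assumes y: "norm y = 1" and p: "norm p \<le> \<tau> - 2 * s0" and s0: "0 \<le> s0"
  shows "\<exists>s. s0 \<le> s \<and> s \<le> \<tau> \<and> norm (p - (\<tau> - s) *\<^sub>R y) = s"
proof -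
  have le: "s0 \<le> \<tau>" using p s0 norm_ge_zero[of p] by linarith
  let ?q = "\<lambda>s. s - norm (p - (\<tau> - s) *\<^sub>R y)"
  have "\<exists>s\<ge>s0. s \<le> \<tau> \<and> ?q s = 0"
  proof (rule IVT)
    have "\<tau> - s0 = norm ((\<tau> - s0) *\<^sub>R y)" using le y by simp
    also have "\<dots> \<le> norm p + norm (p - (\<tau> - s0) *\<^sub>R y)"
      using norm_triangle_ineq4[of p "p - (\<tau> - s0) *\<^sub>R y"] by simp
    finally show "?q s0 \<le> 0" using p by simp
    show "0 \<le> ?q \<tau>" using p s0 by simp
    show "\<forall>s. s0 \<le> s \<and> s \<le> \<tau> \<longrightarrow> isCont ?q s"
      by (intro allI impI continuous_intros)
  qed (rule le)
  then show ?thesis by auto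
qed

lemma has_derivative_two_leg_map:
  fixes v y :: "real ^ 'n"
  assumes "v \<noteq> 0"
  shows "((\<lambda>v. a *\<^sub>R v + (\<tau> - a * norm v) *\<^sub>R y) has_derivative
          (\<lambda>h. a *\<^sub>R h - (a * (h \<bullet> sgn v)) *\<^sub>R y)) (at v)"
proof -
  have "((\<lambda>v. a *\<^sub>R v + (\<tau> - a * norm v) *\<^sub>R y) has_derivative
          (\<lambda>h. a *\<^sub>R h + (0 - a * (h \<bullet> sgn v)) *\<^sub>R y)) (at v)"
    by (intro has_derivative_add has_derivative_scaleR_left has_derivative_scaleR_right
      has_derivative_diff has_derivative_mult_right has_derivative_const has_derivative_ident
      has_derivative_norm assms)
  then show ?thesis by simp
qed

lemma norm_derivative_two_leg_map:
  fixes v y :: "real ^ 'n"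
  assumes y: "norm y = 1" and a: "0 \<le> a" "a \<le> b"
  shows "norm (a *\<^sub>R h - (a * (h \<bullet> sgn v)) *\<^sub>R y) \<le> (2 * b) * norm h"
proof -
  have "\<bar>h \<bullet> sgn v\<bar> \<le> norm h * 1"
    using Cauchy_Schwarz_ineq2[of h "sgn v"] by (simp add: norm_sgn split: if_splits)
  then have "a * \<bar>h \<bullet> sgn v\<bar> \<le> a * norm h" using a by (simp add: mult_left_mono)
  have "norm (a *\<^sub>R h - (a * (h \<bullet> sgn v)) *\<^sub>R y) \<le> a * norm h + a * \<bar>h \<bullet> sgn v\<bar>"
    using norm_triangle_ineq4[of "a *\<^sub>R h" "(a * (h \<bullet> sgn v)) *\<^sub>R y"] a y by (simp add: abs_mult)
  also have "\<dots> \<le> 2 * (a * norm h)" using \<open>a * \<bar>h \<bullet> sgn v\<bar> \<le> a * norm h\<close> by simp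
  also have "\<dots> \<le> (2 * b) * norm h" using a by (simp add: mult_right_mono)
  finally show ?thesis .
qed

text \<open>
  With \<open>v = (s / a) z\<close>, for a fixed scale \<open>a\<close>, the end point of a flight is \<open>a v + (\<tau> - a |v|) y\<close>. As a
  function of \<open>v\<close> it has a derivative bounded by \<open>2 a \<le> 6 L\<close>. Its image contains the ball of radius
  \<open>\<tau> - L / 4 \<ge> L / 2\<close>, hence the centred unit cube, whose circumradius is \<open>L / 2\<close>.
  The constraint \<open>s \<ge> L / 8\<close> keeps away from \<open>v = 0\<close>, where the polar volume element degenerates.
\<close>

lemma nn_integral_two_leg_map:
  fixes y :: "real ^ 'n" and k :: "real ^ 'n \<Rightarrow> ennreal"
  defines "L \<equiv> sqrt (real CARD('n))"
  assumes y: "norm y = 1" and k [measurable]: "k \<in> borel_measurable borel" and per: "periodic k"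
    and \<tau>: "3 / 4 * L \<le> \<tau>" "\<tau> \<le> L" and a: "2 * \<tau> \<le> a" "a \<le> 3 * \<tau>"
  defines "D \<equiv> {v. L / 8 \<le> a * norm v \<and> a * norm v \<le> \<tau>}"
  shows "(\<integral>\<^sup>+p. k p * indicator torus p \<partial>lborel)
    \<le> ennreal (fact CARD('n) * (6 * L) ^ CARD('n))
      * (\<integral>\<^sup>+v. k (x + (a *\<^sub>R v + (\<tau> - a * norm v) *\<^sub>R y)) * indicator D v \<partial>lborel)"
proof -
  let ?F = "\<lambda>v. a *\<^sub>R v + (\<tau> - a * norm v) *\<^sub>R y"
  let ?h = "(\<chi> i. 1 / 2) :: real ^ 'n"
  have L: "L > 0" by (simp add: L_def)
  have a0: "a > 0" using a \<tau> L by linarith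
  have D: "compact D"
  proof -
    have "closed D" unfolding D_def
      by (intro closed_Collect_conj closed_Collect_le continuous_intros)
    moreover have "D \<subseteq> cball 0 (\<tau> / a)"
      using a0 by (auto simp: D_def divide_simps mult.commute)
    ultimately show ?thesis
      using compact_cball compact_eq_bounded_closed bounded_subset bounded_cball by metis
  qed
  have D0: "v \<noteq> 0" if "v \<in> D" for v using that L by (auto simp: D_def)
  \<comment> \<open>Shifted by \<open>?h\<close>, the fundamental cube becomes the centred one, which the map covers.\<close>
  have cube: "indicator torus (p + ?h) \<le> (indicator (?F ` D) p :: ennreal)" for p :: "real ^ 'n"
  proof (cases "p + ?h \<in> torus")
    case True
    have "norm p \<le> L * (1 / 2)"
    proof -
      have "\<bar>p $ i\<bar> \<le> 1 / 2" for i
        using True by (auto simp: torus_def abs_le_iff dest!: spec[of _ i])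
      then have "(p $ i)\<^sup>2 \<le> (1 / 2)\<^sup>2" for i
        by (metis abs_le_square_iff abs_of_nonneg zero_le_divide_1_iff zero_le_numeral)
      then have "(\<Sum>i\<in>UNIV. (p $ i)\<^sup>2) \<le> (\<Sum>i\<in>(UNIV :: 'n set). (1 / 2)\<^sup>2)"
        by (intro sum_mono) auto
      then have "norm p \<le> sqrt (real CARD('n) * (1 / 2)\<^sup>2)"
        unfolding norm_vec_def L2_set_def by (simp add: real_sqrt_le_mono)
      also have "\<dots> = L * (1 / 2)" by (simp add: real_sqrt_mult L_def)
      finally show ?thesis .
    qed
    then have "norm p \<le> \<tau> - 2 * (L / 8)" using \<tau> by simp
    then obtain s where s: "L / 8 \<le> s" "s \<le> \<tau>" "norm (p - (\<tau> - s) *\<^sub>R y) = s"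
      using two_leg_map_surj[OF y, of p \<tau> "L / 8"] L by auto
    define v where "v = (1 / a) *\<^sub>R (p - (\<tau> - s) *\<^sub>R y)"
    have "a * norm v = s" using s a0 by (simp add: v_def)
    then have "v \<in> D" "?F v = p" using s a0 by (auto simp: D_def v_def)
    then show ?thesis by (auto simp: indicator_def)
  qed simp
  have "(\<integral>\<^sup>+p. k p * indicator torus p \<partial>lborel) = (\<integral>\<^sup>+p. k (x - ?h + p) * indicator torus p \<partial>lborel)"
    using per by (intro nn_integral_torus_translate[symmetric]) auto
  also have "\<dots> = (\<integral>\<^sup>+p. k (x + p) * indicator torus (p + ?h) \<partial>lborel)"
    using nn_integral_lborel_shift[of "\<lambda>p. k (x - ?h + p) * indicator torus p" ?h]
    by (simp add: algebra_simps)
  also have "\<dots> \<le> (\<integral>\<^sup>+p. k (x + p) * indicator (?F ` D) p \<partial>lborel)"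
    by (intro nn_integral_mono mult_left_mono cube) simp
  also have "\<dots> \<le> ennreal (fact CARD('n) * (6 * L) ^ CARD('n))
      * (\<integral>\<^sup>+v. k (x + ?F v) * indicator D v \<partial>lborel)"
  proof (rule nn_integral_image_le[OF D])
    show "continuous_on D ?F" by (intro continuous_intros)
    show "(?F has_derivative (\<lambda>h. a *\<^sub>R h - (a * (h \<bullet> sgn v)) *\<^sub>R y)) (at v)" if "v \<in> D" for v
      using D0[OF that] by (rule has_derivative_two_leg_map)
    show "norm (a *\<^sub>R h - (a * (h \<bullet> sgn v)) *\<^sub>R y) \<le> (6 * L) * norm h" for v h
      using norm_derivative_two_leg_map[OF y, of a "3 * L"] a \<tau> a0 by simp
  qed measurable
  finally show ?thesis .
qed

text \<open>
  A random duration \<open>s\<close> and direction \<open>v / |v|\<close> are traded for a volume integral by substituting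
  \<open>s = a |v|\<close> for fixed \<open>v\<close> and exchanging the integrals over \<open>a\<close> and \<open>v\<close>. Only scales
  \<open>a\<close> between \<open>2 \<tau>\<close> and \<open>3 \<tau>\<close> are kept: then \<open>s \<le> \<tau>\<close> forces \<open>|v| \<le> 1 / 2\<close>, so that \<open>v\<close>
  ranges over the interior of the unit ball, and \<open>|v| \<ge> L / (24 \<tau>)\<close> on the relevant region.
\<close>

lemma two_leg_flight_lower_bound:
  fixes y :: "real ^ 'n" and k :: "real ^ 'n \<Rightarrow> ennreal"
  defines "L \<equiv> sqrt (real CARD('n))"
  defines "\<kappa> \<equiv> L / 24 / (fact CARD('n) * (6 * L) ^ CARD('n) * measure lborel (ball 0 1 :: (real ^ 'n) set))"
  assumes y: "norm y = 1" and k [measurable]: "k \<in> borel_measurable borel" and per: "periodic k"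
    and \<tau>: "3 / 4 * L \<le> \<tau>" "\<tau> \<le> L"
  shows "ennreal \<kappa> * (\<integral>\<^sup>+p. k p * indicator torus p \<partial>lborel)
    \<le> (\<integral>\<^sup>+s. (\<integral>\<^sup>+z. k (x + (\<tau> - s) *\<^sub>R y + s *\<^sub>R z) \<partial>uniform_sphere) * indicator {0..\<tau>} s \<partial>lborel)"
proof -
  let ?T = "(\<integral>\<^sup>+p. k p * indicator torus p \<partial>lborel)"
  let ?\<omega> = "measure lborel (ball 0 1 :: (real ^ 'n) set)"
  let ?C = "fact CARD('n) * (6 * L) ^ CARD('n)"
  let ?F = "\<lambda>a v. a *\<^sub>R v + (\<tau> - a * norm v) *\<^sub>R y"
  let ?D = "\<lambda>a. {v :: real ^ 'n. L / 8 \<le> a * norm v \<and> a * norm v \<le> \<tau>}"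
  let ?H = "\<lambda>s v. k (x + (\<tau> - s) *\<^sub>R y + s *\<^sub>R sgn v) * indicator (ball 0 1) v * indicator {0..\<tau>} s"
  have L: "L > 0" by (simp add: L_def)
  have \<tau>0: "\<tau> > 0" using \<tau> L by linarith
  have C: "?C > 0" using L by simp
  have \<omega>: "?\<omega> > 0" by (rule measure_unit_ball_pos)
  have [measurable]: "ball (0 :: real ^ 'n) 1 \<in> sets borel" by simp
  have step: "(\<integral>\<^sup>+a. ennreal (norm v) * k (x + ?F a v) * indicator (?D a) v * indicator {2 * \<tau>..3 * \<tau>} a \<partial>lborel)
      \<le> (\<integral>\<^sup>+s. ?H s v \<partial>lborel)" for v :: "real ^ 'n"
  proof (cases "v = 0")
    case True
    then show ?thesis using L by (simp add: indicator_def)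
  next
    case False
    then have nv: "norm v \<noteq> 0" "norm v > 0" by auto
    have "(\<integral>\<^sup>+s. ?H s v \<partial>lborel) = ennreal \<bar>norm v\<bar> * (\<integral>\<^sup>+a. ?H (0 + norm v * a) v \<partial>lborel)"
      by (rule nn_integral_real_affine[OF _ nv(1)]) measurable
    also have "\<dots> = (\<integral>\<^sup>+a. ennreal (norm v) * ?H (norm v * a) v \<partial>lborel)"
      by (simp add: nn_integral_cmult)
    finally have eq: "(\<integral>\<^sup>+s. ?H s v \<partial>lborel) = (\<integral>\<^sup>+a. ennreal (norm v) * ?H (norm v * a) v \<partial>lborel)" .
    show ?thesis unfolding eq
    proof (rule nn_integral_mono)
      fix a :: real
      show "ennreal (norm v) * k (x + ?F a v) * indicator (?D a) v * indicator {2 * \<tau>..3 * \<tau>} a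
        \<le> ennreal (norm v) * ?H (norm v * a) v"
      proof (cases "v \<in> ?D a \<and> a \<in> {2 * \<tau>..3 * \<tau>}")
        case True
        then have "2 * \<tau> * norm v \<le> a * norm v" using nv by (intro mult_right_mono) auto
        then have "\<tau> * (2 * norm v) \<le> \<tau> * 1" using True by (simp add: mult_ac)
        then have "norm v < 1" using \<tau>0 by (subst (asm) mult_le_cancel_left_pos) auto
        moreover have "0 \<le> norm v * a" "norm v * a \<le> \<tau>" using True \<tau>0 by (auto simp: mult.commute)
        moreover have "(\<tau> - norm v * a) *\<^sub>R y + (norm v * a) *\<^sub>R sgn v = ?F a v"
          using nv by (simp add: sgn_div_norm mult.commute)
        ultimately show ?thesis by (simp add: add.assoc mult.assoc indicator_def)
      qed (auto simp: indicator_def)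
    qed
  qed
  have c: "ennreal (L / 24 / ?C) = ennreal (L / (24 * \<tau>)) * ennreal (1 / ?C) * ennreal \<tau>"
    using \<tau>0 C L by (simp add: ennreal_mult[symmetric] del: fact_Suc)
  have "ennreal (L / 24 / ?C) * ?T = (\<integral>\<^sup>+a. ennreal (L / (24 * \<tau>)) * (ennreal (1 / ?C) * ?T) * indicator {2 * \<tau>..3 * \<tau>} a \<partial>lborel)"
    unfolding c using \<tau>0 by (subst nn_integral_cmult_indicator) (simp_all add: mult_ac)
  also have "\<dots> \<le> (\<integral>\<^sup>+a. ennreal (L / (24 * \<tau>)) * (\<integral>\<^sup>+v. k (x + ?F a v) * indicator (?D a) v \<partial>lborel) * indicator {2 * \<tau>..3 * \<tau>} a \<partial>lborel)"
  proof (rule nn_integral_mono)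
    fix a :: real
    have "ennreal (1 / ?C) * ?T \<le> (\<integral>\<^sup>+v. k (x + ?F a v) * indicator (?D a) v \<partial>lborel)"
      if "a \<in> {2 * \<tau>..3 * \<tau>}"
    proof -
      have "ennreal (1 / ?C) * ?T \<le> ennreal (1 / ?C) * (ennreal ?C * (\<integral>\<^sup>+v. k (x + ?F a v) * indicator (?D a) v \<partial>lborel))"
        using nn_integral_two_leg_map[OF y k per, of \<tau> a x] \<tau> that
        by (intro mult_left_mono) (auto simp: L_def)
      also have "\<dots> = (\<integral>\<^sup>+v. k (x + ?F a v) * indicator (?D a) v \<partial>lborel)"
        using C L by (simp add: mult.assoc[symmetric] ennreal_mult[symmetric])
      finally show ?thesis .
    qed
    then show "ennreal (L / (24 * \<tau>)) * (ennreal (1 / ?C) * ?T) * indicator {2 * \<tau>..3 * \<tau>} a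
      \<le> ennreal (L / (24 * \<tau>)) * (\<integral>\<^sup>+v. k (x + ?F a v) * indicator (?D a) v \<partial>lborel) * indicator {2 * \<tau>..3 * \<tau>} a"
      by (auto simp: indicator_def intro!: mult_left_mono)
  qed
  also have "\<dots> = (\<integral>\<^sup>+a. \<integral>\<^sup>+v. ennreal (L / (24 * \<tau>)) * k (x + ?F a v) * indicator (?D a) v * indicator {2 * \<tau>..3 * \<tau>} a \<partial>lborel \<partial>lborel)"
  proof (rule nn_integral_cong)
    fix a :: real
    let ?I = "indicator {2 * \<tau>..3 * \<tau>} a :: ennreal" and ?c = "ennreal (L / (24 * \<tau>))"
    have "(\<integral>\<^sup>+v. ?c * k (x + ?F a v) * indicator (?D a) v * ?I \<partial>lborel)
      = (\<integral>\<^sup>+v. ?c * k (x + ?F a v) * indicator (?D a) v \<partial>lborel) * ?I"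
      by (rule nn_integral_multc) measurable
    also have "(\<integral>\<^sup>+v. ?c * k (x + ?F a v) * indicator (?D a) v \<partial>lborel)
      = ?c * (\<integral>\<^sup>+v. k (x + ?F a v) * indicator (?D a) v \<partial>lborel)"
      unfolding mult.assoc by (rule nn_integral_cmult) measurable
    finally show "?c * (\<integral>\<^sup>+v. k (x + ?F a v) * indicator (?D a) v \<partial>lborel) * ?I
      = (\<integral>\<^sup>+v. ?c * k (x + ?F a v) * indicator (?D a) v * ?I \<partial>lborel)" ..
  qed
  also have "\<dots> \<le> (\<integral>\<^sup>+a. \<integral>\<^sup>+v. ennreal (norm v) * k (x + ?F a v) * indicator (?D a) v * indicator {2 * \<tau>..3 * \<tau>} a \<partial>lborel \<partial>lborel)"
  proof (intro nn_integral_mono)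
    fix a :: real and v :: "real ^ 'n"
    have "L / (24 * \<tau>) \<le> norm v" if "L / 8 \<le> a * norm v" "a \<le> 3 * \<tau>"
    proof -
      have "a * norm v \<le> 3 * \<tau> * norm v" using that by (intro mult_right_mono) auto
      then show ?thesis using that \<tau>0 by (simp add: divide_simps mult.commute)
    qed
    then show "ennreal (L / (24 * \<tau>)) * k (x + ?F a v) * indicator (?D a) v * indicator {2 * \<tau>..3 * \<tau>} a
      \<le> ennreal (norm v) * k (x + ?F a v) * indicator (?D a) v * indicator {2 * \<tau>..3 * \<tau>} a"
      by (auto simp: indicator_def intro!: mult_right_mono ennreal_leI)
  qed
  also have "\<dots> = (\<integral>\<^sup>+v. \<integral>\<^sup>+a. ennreal (norm v) * k (x + ?F a v) * indicator (?D a) v * indicator {2 * \<tau>..3 * \<tau>} a \<partial>lborel \<partial>lborel)"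
    by (rule lborel_pair.Fubini'[symmetric]) measurable
  also have "\<dots> \<le> (\<integral>\<^sup>+v. \<integral>\<^sup>+s. ?H s v \<partial>lborel \<partial>lborel)"
    by (intro nn_integral_mono step)
  also have "\<dots> = (\<integral>\<^sup>+s. \<integral>\<^sup>+v. ?H s v \<partial>lborel \<partial>lborel)"
    by (rule lborel_pair.Fubini') measurable
  finally have main: "ennreal (L / 24 / ?C) * ?T \<le> (\<integral>\<^sup>+s. \<integral>\<^sup>+v. ?H s v \<partial>lborel \<partial>lborel)" .
  have sph: "(\<integral>\<^sup>+v. ?H s v \<partial>lborel) = ennreal ?\<omega> * ((\<integral>\<^sup>+z. k (x + (\<tau> - s) *\<^sub>R y + s *\<^sub>R z) \<partial>uniform_sphere) * indicator {0..\<tau>} s)" for s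
  proof -
    have "(\<integral>\<^sup>+z. k (x + (\<tau> - s) *\<^sub>R y + s *\<^sub>R z) \<partial>uniform_sphere)
      = (\<integral>\<^sup>+v. k (x + (\<tau> - s) *\<^sub>R y + s *\<^sub>R sgn v) * indicator (ball 0 1) v \<partial>lborel) / ennreal ?\<omega>"
      by (subst nn_integral_uniform_sphere) (simp_all add: emeasure_unit_ball)
    then have "ennreal ?\<omega> * (\<integral>\<^sup>+z. k (x + (\<tau> - s) *\<^sub>R y + s *\<^sub>R z) \<partial>uniform_sphere)
      = (\<integral>\<^sup>+v. k (x + (\<tau> - s) *\<^sub>R y + s *\<^sub>R sgn v) * indicator (ball 0 1) v \<partial>lborel)"
      using \<omega> by (simp add: ennreal_times_divide mult.commute[of "ennreal ?\<omega>"] ennreal_mult_divide_eq)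
    then show ?thesis by (simp add: nn_integral_multc mult.assoc[symmetric])
  qed
  have \<kappa>: "\<kappa> = 1 / ?\<omega> * (L / 24 / ?C)" by (simp add: \<kappa>_def)
  have "ennreal \<kappa> * ?T = ennreal (1 / ?\<omega>) * (ennreal (L / 24 / ?C) * ?T)"
    unfolding \<kappa> using \<omega> L C by (subst ennreal_mult) (simp_all add: mult.assoc)
  also have "\<dots> \<le> ennreal (1 / ?\<omega>) * (\<integral>\<^sup>+s. \<integral>\<^sup>+v. ?H s v \<partial>lborel \<partial>lborel)"
    by (intro mult_left_mono main) simp
  also have "\<dots> = (\<integral>\<^sup>+s. ennreal (1 / ?\<omega>) * (\<integral>\<^sup>+v. ?H s v \<partial>lborel) \<partial>lborel)"
    by (rule nn_integral_cmult[symmetric]) measurable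
  also have "\<dots> = (\<integral>\<^sup>+s. (\<integral>\<^sup>+z. k (x + (\<tau> - s) *\<^sub>R y + s *\<^sub>R z) \<partial>uniform_sphere) * indicator {0..\<tau>} s \<partial>lborel)"
    unfolding sph using \<omega> by (simp add: mult.assoc[symmetric] ennreal_mult[symmetric])
  finally show ?thesis .
qed

section \<open>Continuous functions on the product of torus and sphere\<close>

text \<open>
  The continuous functions on the product of the torus and the sphere, as periodic functions.
\<close>

definition state_continuous :: "((real ^ 'n) \<times> (real ^ 'n) \<Rightarrow> real) \<Rightarrow> bool" where
  "state_continuous f \<longleftrightarrow> continuous_on (UNIV \<times> sphere 0 1) f \<and>
     (\<forall>y\<in>sphere 0 1. periodic (\<lambda>x. f (x, y)))"

lemma state_continuous_cont: "state_continuous f \<Longrightarrow> continuous_on (UNIV \<times> sphere 0 1) f"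
  by (simp add: state_continuous_def)

lemma state_continuous_shift:
  "state_continuous f \<Longrightarrow> y \<in> sphere 0 1 \<Longrightarrow> f (x + int_vec z, y) = f (x, y)"
  using periodic_add_int_vec[of "\<lambda>x. f (x, y)"] by (simp add: state_continuous_def)

lemma test_imp_state_continuous: "vj_test_function f \<Longrightarrow> state_continuous f"
  by (simp add: vj_test_function_def state_continuous_def)

lemma ex_shift_torus: "\<exists>z. (x :: real ^ 'n) + int_vec z \<in> torus"
proof
  show "x + int_vec (\<chi> i. - \<lfloor>x $ i\<rfloor>) \<in> torus"
    unfolding torus_def int_vec_def by (auto simp: algebra_simps) linarith
qed

lemma state_continuous_bounded:
  assumes f: "state_continuous f"
  obtains C where "0 < C" "\<And>x y. y \<in> sphere 0 1 \<Longrightarrow> \<bar>f (x, y)\<bar> \<le> C"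
proof -
  have "compact (f ` (cbox 0 1 \<times> sphere 0 1))"
    by (intro compact_continuous_image compact_Times continuous_on_subset[OF state_continuous_cont[OF f]]) auto
  then obtain C where "\<forall>t\<in>f ` (cbox 0 1 \<times> sphere 0 1). norm t \<le> C"
    by (meson bounded_iff compact_imp_bounded)
  then have C: "\<bar>f w\<bar> \<le> C" if "w \<in> cbox 0 1 \<times> sphere 0 1" for w
    using that by auto
  have "\<bar>f (x, y)\<bar> \<le> max C 1" if y: "y \<in> sphere 0 1" for x y
  proof -
    obtain z where z: "x + int_vec z \<in> torus" using ex_shift_torus by blast
    then have "x + int_vec z \<in> cbox 0 1" by (auto simp: torus_def mem_box_cart less_imp_le)
    then have "\<bar>f (x + int_vec z, y)\<bar> \<le> C" using y by (intro C) auto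
    then show ?thesis using state_continuous_shift[OF f y] by simp
  qed
  then show thesis by (intro that[of "max C 1"]) auto
qed

text \<open>
  By periodicity the first point can be moved into the fundamental cube; the second one, within
  distance \<open>1\<close>, then lies in \<open>[-1, 2]\<^sup>n\<close>.
\<close>

lemma state_continuous_uniformly:
  fixes f :: "(real ^ 'n) \<times> (real ^ 'n) \<Rightarrow> real"
  assumes f: "state_continuous f"
  shows "uniformly_continuous_on (UNIV \<times> sphere 0 1) f"
  unfolding uniformly_continuous_on_def
proof (intro allI impI)
  fix e :: real assume e: "e > 0"
  let ?K = "cbox (- 1) 2 \<times> sphere 0 1 :: ((real ^ 'n) \<times> (real ^ 'n)) set"
  have "uniformly_continuous_on ?K f"
    by (intro compact_uniformly_continuous compact_Times
      continuous_on_subset[OF state_continuous_cont[OF f]]) auto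
  then obtain d where d: "d > 0"
    and D: "\<And>w w'. w \<in> ?K \<Longrightarrow> w' \<in> ?K \<Longrightarrow> dist w' w < d \<Longrightarrow> dist (f w') (f w) < e"
    using e unfolding uniformly_continuous_on_def by metis
  show "\<exists>d>0. \<forall>w\<in>UNIV \<times> sphere 0 1. \<forall>w'\<in>UNIV \<times> sphere 0 1. dist w' w < d \<longrightarrow> dist (f w') (f w) < e"
  proof (intro exI[of _ "min d 1"] conjI ballI impI)
    fix w w' :: "(real ^ 'n) \<times> (real ^ 'n)"
    assume w: "w \<in> UNIV \<times> sphere 0 1" and w': "w' \<in> UNIV \<times> sphere 0 1" and dd: "dist w' w < min d 1"
    obtain x y x' y' where xy: "w = (x, y)" "w' = (x', y')" by (cases w, cases w')
    obtain z where z: "x + int_vec z \<in> torus" using ex_shift_torus by blast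
    have "dist x' x < 1" using dd dist_fst_le[of w' w] by (simp add: xy)
    then have "\<bar>x' $ i - x $ i\<bar> < 1" for i
      using component_le_norm_cart[of "x' - x" i] by (simp add: dist_norm)
    then have "- 1 \<le> x' $ i + of_int (z $ i) \<and> x' $ i + of_int (z $ i) \<le> 2" for i
      using z unfolding torus_def int_vec_def by (auto dest!: spec[of _ i] simp: abs_less_iff) (smt (verit))+
    then have x'K: "x' + int_vec z \<in> cbox (- 1) 2"
      by (simp add: mem_box_cart int_vec_def)
    have "- 1 \<le> x $ i + of_int (z $ i) \<and> x $ i + of_int (z $ i) \<le> 2" for i
      using z unfolding torus_def int_vec_def by (auto dest!: spec[of _ i])
    then have xK: "x + int_vec z \<in> cbox (- 1) 2"
      by (simp add: mem_box_cart int_vec_def)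
    have "dist (x' + int_vec z, y') (x + int_vec z, y) = dist w' w"
      by (simp add: xy dist_Pair_Pair)
    then have "dist (f (x' + int_vec z, y')) (f (x + int_vec z, y)) < e"
      using D[of "(x + int_vec z, y)" "(x' + int_vec z, y')"] xK x'K w w' dd xy by auto
    then show "dist (f w') (f w) < e"
      using w w' state_continuous_shift[OF f] by (simp add: xy)
  qed (use d in auto)
qed

lemma state_continuous_uniformD:
  fixes f :: "(real ^ 'n) \<times> (real ^ 'n) \<Rightarrow> real"
  assumes "state_continuous f" "e > 0"
  obtains d where "d > 0"
    "\<And>x x' y y'. y \<in> sphere 0 1 \<Longrightarrow> y' \<in> sphere 0 1 \<Longrightarrow> norm (x' - x) + norm (y' - y) < d
       \<Longrightarrow> \<bar>f (x', y') - f (x, y)\<bar> < e"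
proof -
  obtain d where d: "d > 0"
    and D: "\<And>w w'. w \<in> UNIV \<times> sphere 0 1 \<Longrightarrow> w' \<in> UNIV \<times> sphere 0 1 \<Longrightarrow> dist w' w < d \<Longrightarrow> dist (f w') (f w) < e"
    using state_continuous_uniformly[OF assms(1)] assms(2) unfolding uniformly_continuous_on_def by metis
  show thesis
  proof (rule that[OF d])
    fix x x' y y' :: "real ^ 'n" assume "y \<in> sphere 0 1" "y' \<in> sphere 0 1" "norm (x' - x) + norm (y' - y) < d"
    moreover have "dist (x', y') (x, y) \<le> norm (x' - x) + norm (y' - y)"
      by (simp add: dist_norm norm_Pair sqrt_sum_squares_le_sum)
    ultimately show "\<bar>f (x', y') - f (x, y)\<bar> < e"
      using D[of "(x, y)" "(x', y')"] by (simp add: dist_real_def)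
  qed
qed

lemma continuous_on_of_uniform_estimate:
  fixes f :: "(real ^ 'n) \<times> (real ^ 'n) \<Rightarrow> 'b::real_normed_vector"
  assumes "\<And>e. e > 0 \<Longrightarrow> \<exists>d>0. \<forall>x x'. \<forall>y\<in>sphere 0 1. \<forall>y'\<in>sphere 0 1.
      norm (x' - x) + norm (y' - y) < d \<longrightarrow> norm (f (x', y') - f (x, y)) < e"
  shows "continuous_on (UNIV \<times> sphere 0 1) f"
  unfolding continuous_on_iff
proof (intro ballI allI impI)
  fix w :: "(real ^ 'n) \<times> (real ^ 'n)" and e :: real assume w: "w \<in> UNIV \<times> sphere 0 1" and "e > 0"
  then obtain d where d: "d > 0" "\<And>x x' y y'. y \<in> sphere 0 1 \<Longrightarrow> y' \<in> sphere 0 1 \<Longrightarrow>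
      norm (x' - x) + norm (y' - y) < d \<Longrightarrow> norm (f (x', y') - f (x, y)) < e"
    using assms by meson
  have "dist (f w') (f w) < e" if "w' \<in> UNIV \<times> sphere 0 1" "dist w' w < d / 2" for w'
  proof -
    have "norm (fst w' - fst w) + norm (snd w' - snd w) < d"
      using dist_fst_le[of w' w] dist_snd_le[of w' w] that by (simp add: dist_norm)
    then show ?thesis
      using d(2)[of "snd w" "snd w'" "fst w'" "fst w"] w that by (auto simp: dist_norm)
  qed
  then show "\<exists>d>0. \<forall>w'\<in>UNIV \<times> sphere 0 1. dist w' w < d \<longrightarrow> dist (f w') (f w) < e"
    using d(1) by (intro exI[of _ "d / 2"]) auto
qed

lemma space_state_space: "space state_space = torus \<times> sphere 0 1"
  by (simp add: state_space_def space_pair_measure space_restrict_space)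

lemma sphere_borel [measurable]: "sphere a r \<in> sets borel" for a :: "'a::euclidean_space"
  by (intro borel_closed) simp

lemma id_measurable_state_space: "(\<lambda>w. w) \<in> state_space \<rightarrow>\<^sub>M borel"
proof -
  have 1: "fst \<in> state_space \<rightarrow>\<^sub>M (borel :: (real ^ 'n) measure)"
    unfolding state_space_def
    by (rule measurable_compose[OF measurable_fst measurable_restrict_space1]) simp
  have 2: "snd \<in> state_space \<rightarrow>\<^sub>M (borel :: (real ^ 'n) measure)"
    unfolding state_space_def
    by (rule measurable_compose[OF measurable_snd measurable_restrict_space1]) simp
  have "(\<lambda>w :: (real ^ 'n) \<times> (real ^ 'n). (fst w, snd w)) \<in> state_space \<rightarrow>\<^sub>M borel"
    using 1 2 by (rule borel_measurable_Pair)
  then show ?thesis by simp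
qed

lemma state_continuous_measurable_pair:
  assumes "state_continuous f"
  shows "f \<in> borel_measurable (borel \<Otimes>\<^sub>M restrict_space borel (sphere 0 1))"
proof -
  have "(\<lambda>w :: (real ^ 'n) \<times> (real ^ 'n). (fst w, snd w)) \<in> (borel \<Otimes>\<^sub>M restrict_space borel (sphere 0 1)) \<rightarrow>\<^sub>M borel"
    by (intro borel_measurable_Pair measurable_compose[OF measurable_snd measurable_restrict_space1]) auto
  then have "(\<lambda>w. w) \<in> (borel \<Otimes>\<^sub>M restrict_space borel (sphere 0 1)) \<rightarrow>\<^sub>M
      restrict_space (borel :: ((real ^ 'n) \<times> (real ^ 'n)) measure) (UNIV \<times> sphere 0 1)"
    by (simp add: measurable_restrict_space2_iff space_pair_measure space_restrict_space)
  from measurable_compose[OF this borel_measurable_continuous_on_restrict[OF state_continuous_cont[OF assms]]]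
  show ?thesis .
qed

lemma state_continuous_measurable:
  assumes "state_continuous f" shows "f \<in> borel_measurable state_space"
proof -
  have "(\<lambda>w. w) \<in> state_space \<rightarrow>\<^sub>M
      restrict_space (borel :: ((real ^ 'n) \<times> (real ^ 'n)) measure) (UNIV \<times> sphere 0 1)"
    using id_measurable_state_space by (auto simp: measurable_restrict_space2_iff space_state_space)
  from measurable_compose[OF this borel_measurable_continuous_on_restrict[OF state_continuous_cont[OF assms]]]
  show ?thesis .
qed

lemma sets_state_space:
  fixes A :: "((real ^ 'n) \<times> (real ^ 'n)) set"
  shows "A \<in> sets state_space \<Longrightarrow> A \<in> sets borel"
proof -
  have T: "torus \<times> sphere 0 1 \<in> sets (borel :: ((real ^ 'n) \<times> (real ^ 'n)) measure)"
    unfolding borel_prod[symmetric] by (intro pair_measureI torus_measurable sphere_borel)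
  have "sets state_space \<subseteq> sets (restrict_space borel (torus \<times> sphere 0 1 :: ((real ^ 'n) \<times> (real ^ 'n)) set))"
    unfolding state_space_def sets_pair_measure
  proof (rule sets.sigma_sets_subset'[where M = "restrict_space borel (torus \<times> sphere 0 1)"])
    show "space (restrict_space borel torus) \<times> space (restrict_space borel (sphere 0 1))
      \<in> sets (restrict_space borel (torus \<times> sphere 0 1 :: ((real ^ 'n) \<times> (real ^ 'n)) set))"
      using T by (simp add: space_restrict_space sets_restrict_space_iff)
    show "{a \<times> b |a b. a \<in> sets (restrict_space borel torus) \<and> b \<in> sets (restrict_space borel (sphere 0 1))}
      \<subseteq> sets (restrict_space borel (torus \<times> sphere 0 1 :: ((real ^ 'n) \<times> (real ^ 'n)) set))"
    proof safe
      fix a b :: "(real ^ 'n) set"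
      assume "a \<in> sets (restrict_space borel torus)" "b \<in> sets (restrict_space borel (sphere 0 1))"
      then have ab: "a \<subseteq> torus" "a \<in> sets borel" "b \<subseteq> sphere 0 1" "b \<in> sets borel"
        by (simp_all add: sets_restrict_space_iff)
      then have "a \<times> b \<in> sets borel"
        unfolding borel_prod[symmetric] by (intro pair_measureI)
      then show "a \<times> b \<in> sets (restrict_space borel (torus \<times> sphere 0 1))"
        using ab T by (auto simp: sets_restrict_space_iff)
    qed
  qed
  then show "A \<in> sets state_space \<Longrightarrow> A \<in> sets borel"
    using T by (auto simp: sets_restrict_space_iff)
qed

lemma state_space_diagonal:
  "{w \<in> space (state_space \<Otimes>\<^sub>M state_space). fst w \<noteq> snd w}
     \<in> sets (state_space \<Otimes>\<^sub>M (state_space :: ((real ^ 'n) \<times> (real ^ 'n)) measure))"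
proof -
  have [measurable]: "fst \<in> state_space \<Otimes>\<^sub>M state_space \<rightarrow>\<^sub>M (borel :: ((real ^ 'n) \<times> (real ^ 'n)) measure)"
    "snd \<in> state_space \<Otimes>\<^sub>M state_space \<rightarrow>\<^sub>M (borel :: ((real ^ 'n) \<times> (real ^ 'n)) measure)"
    using measurable_compose[OF measurable_fst id_measurable_state_space]
      measurable_compose[OF measurable_snd id_measurable_state_space] by auto
  show ?thesis by measurable
qed

lemma state_continuous_integrable:
  assumes f: "state_continuous f" and N: "N \<in> space (prob_algebra state_space)"
  shows "integrable N f"
proof -
  interpret prob_space N using N by (simp add: space_prob_algebra)
  have s: "sets N = sets state_space" using N by (simp add: space_prob_algebra)
  obtain C where "0 < C" "\<And>x y. y \<in> sphere 0 1 \<Longrightarrow> \<bar>f (x, y)\<bar> \<le> C" using state_continuous_bounded[OF f] by blast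
  then show ?thesis
    using state_continuous_measurable[OF f]
    by (intro integrable_const_bound[where B = C])
      (auto simp: measurable_cong_sets[OF s refl] sets_eq_imp_space_eq[OF s] space_state_space)
qed

lemma state_continuous_integral_bound:
  assumes f: "state_continuous f" and N: "N \<in> space (prob_algebra state_space)"
    and C: "\<And>x y. y \<in> sphere 0 1 \<Longrightarrow> \<bar>f (x, y)\<bar> \<le> C"
  shows "\<bar>\<integral>w. f w \<partial>N\<bar> \<le> C"
proof -
  interpret prob_space N using N by (simp add: space_prob_algebra)
  have s: "sets N = sets state_space" using N by (simp add: space_prob_algebra)
  have "\<bar>\<integral>w. f w \<partial>N\<bar> \<le> (\<integral>w. \<bar>f w\<bar> \<partial>N)"
    using integral_norm_bound[of N f] by simp
  also have "\<dots> \<le> (\<integral>w. C \<partial>N)"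
    using C by (intro integral_mono integrable_abs state_continuous_integrable[OF f N])
      (auto simp: sets_eq_imp_space_eq[OF s] space_state_space)
  finally show ?thesis by (simp add: prob_space)
qed

lemma state_continuous_const [simp]: "state_continuous (\<lambda>w. c)"
  by (auto simp: state_continuous_def periodic_def)

lemma state_continuous_add:
  "state_continuous f \<Longrightarrow> state_continuous g \<Longrightarrow> state_continuous (\<lambda>w. f w + g w)"
  unfolding state_continuous_def periodic_def by (fastforce intro!: continuous_intros)

lemma state_continuous_diff:
  "state_continuous f \<Longrightarrow> state_continuous g \<Longrightarrow> state_continuous (\<lambda>w. f w - g w)"
  unfolding state_continuous_def periodic_def by (fastforce intro!: continuous_intros)

lemma state_continuous_mult:
  "state_continuous f \<Longrightarrow> state_continuous g \<Longrightarrow> state_continuous (\<lambda>w. f w * g w)"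
  unfolding state_continuous_def periodic_def by (fastforce intro!: continuous_intros)

definition transport :: "real \<Rightarrow> ((real ^ 'n) \<times> (real ^ 'n) \<Rightarrow> real) \<Rightarrow> (real ^ 'n) \<times> (real ^ 'n) \<Rightarrow> real" where
  "transport s f = (\<lambda>(x, y). f (x + s *\<^sub>R y, y))"

lemma transport_apply: "transport s f (x, y) = f (x + s *\<^sub>R y, y)"
  by (simp add: transport_def)

lemma state_continuous_transport:
  fixes f :: "(real ^ 'n) \<times> (real ^ 'n) \<Rightarrow> real"
  assumes f: "state_continuous f" shows "state_continuous (transport s f)"
  unfolding state_continuous_def
proof (intro conjI ballI)
  have "continuous_on (UNIV \<times> sphere 0 1) (\<lambda>w. f (fst w + s *\<^sub>R snd w, snd w))"
    by (rule continuous_on_compose2[OF state_continuous_cont[OF f]]) (auto intro!: continuous_intros)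
  then show "continuous_on (UNIV \<times> sphere 0 1) (transport s f)"
    by (simp add: transport_def case_prod_beta)
  fix y :: "real ^ 'n" assume "y \<in> sphere 0 1"
  then have "periodic (\<lambda>x. f (x, y))" using f by (simp add: state_continuous_def)
  then show "periodic (\<lambda>x. transport s f (x, y))"
    by (simp add: periodic_def transport_apply)
qed

definition resample :: "((real ^ 'n) \<times> (real ^ 'n) \<Rightarrow> real) \<Rightarrow> (real ^ 'n) \<times> (real ^ 'n) \<Rightarrow> real" where
  "resample f = (\<lambda>(x, y). \<integral>z. f (x, z) \<partial>uniform_sphere)"

lemma resample_apply: "resample f (x, y) = (\<integral>z. f (x, z) \<partial>uniform_sphere)"
  by (simp add: resample_def)

lemma state_continuous_integrable_sphere:
  fixes f :: "(real ^ 'n) \<times> (real ^ 'n) \<Rightarrow> real"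
  assumes f: "state_continuous f"
  shows "integrable uniform_sphere (\<lambda>z. f (x, z))"
proof -
  interpret prob_space "uniform_sphere :: (real ^ 'n) measure" by (rule prob_space_uniform_sphere)
  obtain C where "0 < C" and C: "\<And>x y. y \<in> sphere 0 1 \<Longrightarrow> \<bar>f (x, y)\<bar> \<le> C" using state_continuous_bounded[OF f] by blast
  have "(\<lambda>z. f (x, z)) \<in> borel_measurable uniform_sphere"
    using measurable_compose[OF measurable_Pair1' state_continuous_measurable_pair[OF f], of x]
    by (simp add: measurable_cong_sets[OF sets_uniform_sphere refl])
  then show ?thesis
    using C by (intro integrable_const_bound[where B = C]) (auto simp: space_uniform_sphere)
qed

lemma resample_bounds:
  fixes f :: "(real ^ 'n) \<times> (real ^ 'n) \<Rightarrow> real"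
  assumes f: "state_continuous f"
  shows "(\<And>z. z \<in> sphere 0 1 \<Longrightarrow> a \<le> f (x, z)) \<Longrightarrow> a \<le> resample f (x, y)"
    and "(\<And>z. z \<in> sphere 0 1 \<Longrightarrow> f (x, z) \<le> b) \<Longrightarrow> resample f (x, y) \<le> b"
proof -
  interpret prob_space "uniform_sphere :: (real ^ 'n) measure" by (rule prob_space_uniform_sphere)
  show "(\<And>z. z \<in> sphere 0 1 \<Longrightarrow> a \<le> f (x, z)) \<Longrightarrow> a \<le> resample f (x, y)"
    unfolding resample_apply
    by (intro integral_ge_const state_continuous_integrable_sphere[OF f]) (auto simp: space_uniform_sphere)
  show "(\<And>z. z \<in> sphere 0 1 \<Longrightarrow> f (x, z) \<le> b) \<Longrightarrow> resample f (x, y) \<le> b"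
    unfolding resample_apply
    by (intro integral_le_const state_continuous_integrable_sphere[OF f]) (auto simp: space_uniform_sphere)
qed

lemma resample_diff_bound:
  fixes f :: "(real ^ 'n) \<times> (real ^ 'n) \<Rightarrow> real"
  assumes f: "state_continuous f" and g: "state_continuous g"
    and e: "\<And>z. z \<in> sphere 0 1 \<Longrightarrow> \<bar>f (x', z) - g (x, z)\<bar> \<le> e"
  shows "\<bar>resample f (x', y') - resample g (x, y)\<bar> \<le> e"
proof -
  interpret prob_space "uniform_sphere :: (real ^ 'n) measure" by (rule prob_space_uniform_sphere)
  note [simp] = state_continuous_integrable_sphere[OF f] state_continuous_integrable_sphere[OF g]
  have eq: "resample f (x', y') - resample g (x, y) = (\<integral>z. f (x', z) - g (x, z) \<partial>uniform_sphere)"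
    by (simp add: resample_apply)
  have "(\<integral>z. f (x', z) - g (x, z) \<partial>uniform_sphere) \<le> e"
    by (rule integral_le_const) (use e in \<open>auto simp: space_uniform_sphere abs_le_iff\<close>)
  moreover have "- e \<le> (\<integral>z. f (x', z) - g (x, z) \<partial>uniform_sphere)"
    by (rule integral_ge_const) (use e in \<open>force simp: space_uniform_sphere abs_le_iff\<close>)+
  ultimately show ?thesis unfolding eq by simp
qed

lemma state_continuous_resample:
  fixes f :: "(real ^ 'n) \<times> (real ^ 'n) \<Rightarrow> real"
  assumes f: "state_continuous f" shows "state_continuous (resample f)"
  unfolding state_continuous_def
proof (intro conjI ballI)
  show "continuous_on (UNIV \<times> sphere 0 1) (resample f)"
  proof (rule continuous_on_of_uniform_estimate)
    fix e :: real assume "e > 0"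
    then have "e / 2 > 0" by simp
    from state_continuous_uniformD[OF f this]
    obtain d where d: "d > 0" "\<And>x x' y y'. y \<in> sphere 0 1 \<Longrightarrow> y' \<in> sphere 0 1 \<Longrightarrow>
        norm (x' - x) + norm (y' - y) < d \<Longrightarrow> \<bar>f (x', y') - f (x, y)\<bar> < e / 2" by blast
    have "norm (resample f (x', y') - resample f (x, y)) < e"
      if lt: "norm (x' - x) + norm (y' - y) < d" for x x' y y'
    proof -
      have "norm (x' - x) < d" using lt norm_ge_zero[of "y' - y"] by linarith
      then have "\<bar>f (x', z) - f (x, z)\<bar> \<le> e / 2" if "z \<in> sphere 0 1" for z
        using d(2)[of z z x' x] that by (simp add: less_imp_le)
      from resample_diff_bound[OF f f this] have "\<bar>resample f (x', y') - resample f (x, y)\<bar> \<le> e / 2" by blast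
      then show ?thesis using \<open>e > 0\<close> by simp
    qed
    then show "\<exists>d>0. \<forall>x x'. \<forall>y\<in>sphere 0 1. \<forall>y'\<in>sphere 0 1. norm (x' - x) + norm (y' - y) < d \<longrightarrow>
        norm (resample f (x', y') - resample f (x, y)) < e"
      using d(1) by blast
  qed
  fix y :: "real ^ 'n"
  show "periodic (\<lambda>x. resample f (x, y))"
    unfolding periodic_def resample_apply
  proof (intro allI impI Bochner_Integration.integral_cong refl)
    fix x z :: "real ^ 'n" and u :: "real ^ 'n"
    assume "\<forall>i. x $ i - z $ i \<in> \<int>" "u \<in> space uniform_sphere"
    then show "f (x, u) = f (z, u)"
      using f unfolding state_continuous_def periodic_def by (simp add: space_uniform_sphere)
  qed
qed

section \<open>Density of the test functions\<close>

lemma gradient_eq: 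
  assumes "GDERIV f x :> D" shows "gradient f x = D"
  unfolding gradient_def
proof (rule the_equality)
  fix E assume "GDERIV f x :> E"
  then have "(\<lambda>h. h \<bullet> E) = (\<lambda>h. h \<bullet> D)"
    using assms unfolding gderiv_def by (rule has_derivative_unique)
  then show "E = D" by (metis vector_eq_ldot)
qed fact

lemma GDERIV_gradient:
  fixes f :: "real ^ 'n \<Rightarrow> real"
  assumes "f differentiable at x" shows "GDERIV f x :> gradient f x"
proof -
  obtain f' where f': "(f has_derivative f') (at x)" using assms by (auto simp: differentiable_def)
  then have lin: "linear f'" by (rule has_derivative_linear)
  have "f' h = h \<bullet> (\<Sum>b\<in>Basis. f' b *\<^sub>R b)" for h
  proof -
    have "f' h = f' (\<Sum>b\<in>Basis. (h \<bullet> b) *\<^sub>R b)" by (simp add: euclidean_representation)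
    also have "\<dots> = (\<Sum>b\<in>Basis. (h \<bullet> b) * f' b)"
      by (simp add: linear_sum[OF lin] linear_scale[OF lin])
    finally show ?thesis by (simp add: inner_sum_right mult.commute)
  qed
  then have "f' = (\<lambda>h. h \<bullet> (\<Sum>b\<in>Basis. f' b *\<^sub>R b))" by blast
  then have "GDERIV f x :> (\<Sum>b\<in>Basis. f' b *\<^sub>R b)" using f' by (simp add: gderiv_def)
  then show ?thesis using gradient_eq by metis
qed

text \<open>
  The square of this function serves as mollifier: it has compact support and, unlike the function
  itself, is continuously differentiable.
\<close>

definition bump :: "real \<Rightarrow> real ^ 'n \<Rightarrow> real" where
  "bump h u = max 0 (h\<^sup>2 - (norm u)\<^sup>2)"

lemma bump_nonneg [simp]: "0 \<le> bump h u" by (simp add: bump_def)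

lemma bump_le: "0 < h \<Longrightarrow> h \<le> 1 \<Longrightarrow> bump h u \<le> 1"
  using power_le_one[of h 2] by (auto simp: bump_def) (smt (verit) zero_le_power2)

lemma bump_eq_0: "0 < h \<Longrightarrow> h \<le> norm u \<Longrightarrow> bump h u = 0"
  using power_mono[of h "norm u" 2] by (simp add: bump_def)

lemma bump_measurable [measurable]: "bump h \<in> borel_measurable borel"
  unfolding bump_def by measurable

text \<open>
  The function \<open>t \<mapsto> (max 0 t)\<^sup>2\<close> has the derivative \<open>2 max 0 t\<close>, with Lipschitz constant \<open>2\<close>.
\<close>

lemma square_positive_part_expansion:
  "\<bar>(max 0 b)\<^sup>2 - (max 0 a)\<^sup>2 - 2 * max 0 a * (b - a)\<bar> \<le> (b - a)\<^sup>2" for a b :: real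
proof -
  consider "0 \<le> a" "0 \<le> b" | "0 \<le> a" "b < 0" | "a < 0" "0 \<le> b" | "a < 0" "b < 0" by linarith
  then show ?thesis
  proof cases
    case 1
    then have "(max 0 b)\<^sup>2 - (max 0 a)\<^sup>2 - 2 * max 0 a * (b - a) = (b - a)\<^sup>2"
      by (simp add: power2_eq_square algebra_simps)
    then show ?thesis by simp
  next
    case 2
    then have eq: "(max 0 b)\<^sup>2 - (max 0 a)\<^sup>2 - 2 * max 0 a * (b - a) = a\<^sup>2 - 2 * (a * b)"
      "(b - a)\<^sup>2 = a\<^sup>2 - 2 * (a * b) + b\<^sup>2"
      by (simp_all add: power2_eq_square algebra_simps)
    have "a * b \<le> 0" using 2 by (simp add: mult_nonneg_nonpos)
    then show ?thesis unfolding eq by (smt (verit) zero_le_power2)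
  next
    case 3
    then have "b\<^sup>2 \<le> (b - a)\<^sup>2" by (intro power_mono) auto
    then show ?thesis using 3 by simp
  next
    case 4 then show ?thesis by simp
  qed
qed

lemma bump_sq_expansion:
  fixes u e :: "real ^ 'n"
  assumes h: "0 < h" "h \<le> 1" and e: "norm e \<le> 1"
  shows "\<bar>(bump h (u - e))\<^sup>2 - (bump h u)\<^sup>2 - 4 * bump h u * (e \<bullet> u)\<bar>
    \<le> 27 * (norm e)\<^sup>2 * indicator (cball 0 2) u"
proof (cases "norm u \<le> 2")
  case False
  have "norm u \<le> norm (u - e) + norm e" by (metis norm_triangle_sub add.commute)
  then have "h \<le> norm (u - e)" "h \<le> norm u" using False e h by linarith+
  then have "bump h (u - e) = 0" "bump h u = 0" by (auto intro: bump_eq_0[OF h(1)])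
  then show ?thesis by simp
next
  case True
  let ?a = "h\<^sup>2 - (norm u)\<^sup>2" and ?b = "h\<^sup>2 - (norm (u - e))\<^sup>2"
  have ba: "?b - ?a = 2 * (e \<bullet> u) - (norm e)\<^sup>2"
    by (simp add: power2_norm_eq_inner inner_diff_left inner_diff_right inner_commute)
  have "\<bar>e \<bullet> u\<bar> \<le> norm e * norm u" by (rule Cauchy_Schwarz_ineq2)
  also have "\<dots> \<le> norm e * 2" using True by (intro mult_left_mono) auto
  finally have "\<bar>e \<bullet> u\<bar> \<le> norm e * 2" .
  moreover have "(norm e)\<^sup>2 \<le> norm e" using e by (simp add: power2_eq_square mult_left_le)
  ultimately have "\<bar>?b - ?a\<bar> \<le> 5 * norm e" unfolding ba by (smt (verit) zero_le_power2)
  then have "(?b - ?a)\<^sup>2 \<le> 25 * (norm e)\<^sup>2"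
    using power_mono[of "\<bar>?b - ?a\<bar>" "5 * norm e" 2] by (simp add: power_mult_distrib)
  then have 1: "\<bar>(bump h (u - e))\<^sup>2 - (bump h u)\<^sup>2 - 2 * bump h u * (?b - ?a)\<bar> \<le> 25 * (norm e)\<^sup>2"
    using square_positive_part_expansion[of ?b ?a] unfolding bump_def by linarith
  have 2: "2 * bump h u * (?b - ?a) = 4 * bump h u * (e \<bullet> u) - 2 * (bump h u * (norm e)\<^sup>2)"
    unfolding ba by (simp add: algebra_simps)
  have "bump h u * (norm e)\<^sup>2 \<le> (norm e)\<^sup>2" "0 \<le> bump h u * (norm e)\<^sup>2"
    using mult_right_mono[OF bump_le[OF h, of u], of "(norm e)\<^sup>2"] by auto
  then have "\<bar>(bump h (u - e))\<^sup>2 - (bump h u)\<^sup>2 - 4 * bump h u * (e \<bullet> u)\<bar> \<le> 27 * (norm e)\<^sup>2"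
    using 1 unfolding 2 abs_le_iff by linarith
  then show ?thesis using True by simp
qed

lemma integral_lborel_shift:
  fixes g :: "'a::euclidean_space \<Rightarrow> 'b::{banach, second_countable_topology}"
  assumes "g \<in> borel_measurable borel"
  shows "(\<integral>u. g (c + u) \<partial>lborel) = (\<integral>u. g u \<partial>lborel)"
proof -
  have "(\<integral>u. g u \<partial>lborel) = (\<integral>u. g u \<partial>distr lborel borel ((+) c))"
    by (simp add: lborel_distr_plus)
  also have "\<dots> = (\<integral>u. g (c + u) \<partial>lborel)"
    using assms by (intro integral_distr) simp_all
  finally show ?thesis ..
qed

lemma integrable_indicator_cball: "integrable lborel (indicat_real (cball (0 :: real ^ 'n) 2))"
  by (rule integrable_real_indicator) (simp, rule emeasure_lborel_cball_finite)

lemma integrable_compact_support: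
  fixes g :: "real ^ 'n \<Rightarrow> 'b::{banach, second_countable_topology}"
  assumes "g \<in> borel_measurable borel" "\<And>u. norm (g u) \<le> C * indicator (cball 0 2) u"
  shows "integrable lborel g"
  by (rule Bochner_Integration.integrable_bound[OF integrable_mult_right[OF integrable_indicator_cball, of C]])
    (use assms in \<open>auto intro!: AE_I2 intro: order_trans[OF _ abs_ge_self]\<close>)

lemma state_continuous_section:
  fixes f :: "(real ^ 'n) \<times> (real ^ 'n) \<Rightarrow> real"
  assumes f: "state_continuous f" and y: "y \<in> sphere 0 1" and g: "continuous_on UNIV g"
  shows "continuous_on UNIV (\<lambda>u. f (g u, y))"
  by (rule continuous_on_compose2[OF state_continuous_cont[OF f]]) (use y g in \<open>auto intro!: continuous_intros\<close>)

definition convolve :: "(real ^ 'n \<Rightarrow> 'b) \<Rightarrow> ((real ^ 'n) \<times> (real ^ 'n) \<Rightarrow> real) \<Rightarrow> (real ^ 'n) \<times> (real ^ 'n)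
    \<Rightarrow> 'b::{banach, second_countable_topology}" where
  "convolve k f = (\<lambda>(x, y). \<integral>u. f (x + u, y) *\<^sub>R k u \<partial>lborel)"

lemma convolve_apply: "convolve k f (x, y) = (\<integral>u. f (x + u, y) *\<^sub>R k u \<partial>lborel)"
  by (simp add: convolve_def)

lemma convolve_integrable:
  fixes f :: "(real ^ 'n) \<times> (real ^ 'n) \<Rightarrow> real" and k :: "real ^ 'n \<Rightarrow> 'b::{banach, second_countable_topology}"
  assumes f: "state_continuous f" and k [measurable]: "k \<in> borel_measurable borel"
    and B: "\<And>u. norm (k u) \<le> B * indicator (cball 0 2) u" and y: "y \<in> sphere 0 1"
  shows "integrable lborel (\<lambda>u. f (x + u, y) *\<^sub>R k u)"
proof -
  obtain C where "0 < C" and C: "\<And>x y. y \<in> sphere 0 1 \<Longrightarrow> \<bar>f (x, y)\<bar> \<le> C"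
    using state_continuous_bounded[OF f] by blast
  have [measurable]: "(\<lambda>u. f (x + u, y)) \<in> borel_measurable borel"
    by (intro borel_measurable_continuous_onI state_continuous_section[OF f y] continuous_intros)
  show ?thesis
  proof (rule integrable_compact_support[where C = "C * B"])
    show "norm (f (x + u, y) *\<^sub>R k u) \<le> C * B * indicator (cball 0 2) u" for u
      using mult_mono[OF C[OF y, of "x + u"] B[of u]] \<open>0 < C\<close> by (simp add: mult.assoc)
  qed measurable
qed

lemma convolve_continuous:
  fixes f :: "(real ^ 'n) \<times> (real ^ 'n) \<Rightarrow> real" and k :: "real ^ 'n \<Rightarrow> 'b::{banach, second_countable_topology}"
  assumes f: "state_continuous f" and k [measurable]: "k \<in> borel_measurable borel"
    and B: "\<And>u. norm (k u) \<le> B * indicator (cball 0 2) u" and B0: "0 \<le> B"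
  shows "continuous_on (UNIV \<times> sphere 0 1) (convolve k f)"
proof (rule continuous_on_of_uniform_estimate)
  fix e :: real assume e: "e > 0"
  let ?V = "measure lborel (cball (0 :: real ^ 'n) 2)"
  define e' where "e' = e / (B * ?V + 1)"
  have BV: "0 \<le> B * ?V" using B0 by simp
  then have e': "e' > 0" "e' * (B * ?V) < e"
    using e by (simp_all add: e'_def divide_simps)
  from state_continuous_uniformD[OF f e'(1)]
  obtain d where d: "d > 0" "\<And>x x' y y'. y \<in> sphere 0 1 \<Longrightarrow> y' \<in> sphere 0 1 \<Longrightarrow>
      norm (x' - x) + norm (y' - y) < d \<Longrightarrow> \<bar>f (x', y') - f (x, y)\<bar> < e'" by blast
  have "norm (convolve k f (x', y') - convolve k f (x, y)) < e"
    if y: "y \<in> sphere 0 1" "y' \<in> sphere 0 1" and lt: "norm (x' - x) + norm (y' - y) < d" for x x' y y'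
  proof -
    note i = convolve_integrable[OF f k B y(1), of x] convolve_integrable[OF f k B y(2), of x']
    have "convolve k f (x', y') - convolve k f (x, y) = (\<integral>u. (f (x' + u, y') - f (x + u, y)) *\<^sub>R k u \<partial>lborel)"
      using i by (simp add: convolve_apply scaleR_diff_left)
    also have "norm \<dots> \<le> (\<integral>u. norm ((f (x' + u, y') - f (x + u, y)) *\<^sub>R k u) \<partial>lborel)"
      by (rule integral_norm_bound)
    also have "\<dots> \<le> (\<integral>u. e' * B * indicator (cball (0 :: real ^ 'n) 2) u \<partial>lborel)"
    proof (rule integral_mono)
      show "integrable lborel (\<lambda>u. norm ((f (x' + u, y') - f (x + u, y)) *\<^sub>R k u))"
        using i by (intro integrable_norm) (simp add: scaleR_diff_left)
      show "integrable lborel (\<lambda>u. e' * B * indicator (cball (0 :: real ^ 'n) 2) u)"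
        by (intro integrable_mult_right integrable_indicator_cball)
      fix u :: "real ^ 'n"
      have "\<bar>f (x' + u, y') - f (x + u, y)\<bar> \<le> e'"
        using d(2)[OF y, of "x' + u" "x + u"] lt by simp
      then show "norm ((f (x' + u, y') - f (x + u, y)) *\<^sub>R k u) \<le> e' * B * indicator (cball 0 2) u"
        using mult_mono[OF _ B[of u], of "\<bar>f (x' + u, y') - f (x + u, y)\<bar>" e'] e' by (simp add: mult.assoc)
    qed
    also have "\<dots> = e' * (B * ?V)" by simp
    also have "\<dots> < e" by (rule e')
    finally show ?thesis .
  qed
  then show "\<exists>d>0. \<forall>x x'. \<forall>y\<in>sphere 0 1. \<forall>y'\<in>sphere 0 1. norm (x' - x) + norm (y' - y) < d \<longrightarrow>
      norm (convolve k f (x', y') - convolve k f (x, y)) < e"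
    using d(1) by blast
qed

lemma bump_sq_kernel:
  assumes "0 < h" "h \<le> 1"
  shows "norm ((bump h u)\<^sup>2) \<le> 1 * indicator (cball 0 2) u"
    and "norm ((4 * bump h u) *\<^sub>R u) \<le> 8 * indicator (cball 0 2) u"
proof -
  have *: "bump h u = 0" if "\<not> norm u \<le> 2" using that assms by (intro bump_eq_0) auto
  then show "norm ((bump h u)\<^sup>2) \<le> 1 * indicator (cball 0 2) u"
    using bump_le[OF assms, of u] by (auto simp: indicator_def power_le_one)
  have "bump h u * norm u \<le> 1 * 2" if "norm u \<le> 2"
    using that bump_le[OF assms, of u] by (intro mult_mono) auto
  with * show "norm ((4 * bump h u) *\<^sub>R u) \<le> 8 * indicator (cball 0 2) u"
    by (auto simp: indicator_def abs_mult mult.commute)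
qed

text \<open>
  Translating the integration variable moves the increment of \<open>x\<close> from \<open>f\<close> to the kernel, whose
  first order expansion is uniform with a compactly supported remainder.
\<close>

lemma convolve_bump_GDERIV:
  fixes f :: "(real ^ 'n) \<times> (real ^ 'n) \<Rightarrow> real"
  assumes f: "state_continuous f" and h: "0 < h" "h \<le> 1" and y: "y \<in> sphere 0 1"
  shows "GDERIV (\<lambda>x. convolve (\<lambda>u. (bump h u)\<^sup>2) f (x, y)) x :> convolve (\<lambda>u. (4 * bump h u) *\<^sub>R u) f (x, y)"
proof -
  let ?G = "\<lambda>x. convolve (\<lambda>u. (bump h u)\<^sup>2) f (x, y)" and ?D = "convolve (\<lambda>u. (4 * bump h u) *\<^sub>R u) f (x, y)"
  let ?V = "measure lborel (cball (0 :: real ^ 'n) 2)"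
  obtain C where C0: "0 < C" and C: "\<And>x y. y \<in> sphere 0 1 \<Longrightarrow> \<bar>f (x, y)\<bar> \<le> C"
    using state_continuous_bounded[OF f] by blast
  have bl: "bounded_linear (\<lambda>h. h \<bullet> ?D)" by (rule bounded_linear_inner_left)
  have le: "norm (?G x' - ?G x - (x' - x) \<bullet> ?D) / norm (x' - x) \<le> 27 * C * ?V * norm (x' - x)"
    if "x' \<noteq> x" "dist x' x < 1" for x'
  proof -
    define e where "e = x' - x"
    have e: "norm e \<le> 1" "norm e \<noteq> 0" using that by (simp_all add: e_def dist_norm)
    have m1 [measurable]: "(\<lambda>u. (bump h u)\<^sup>2) \<in> borel_measurable (borel :: (real ^ 'n) measure)"
      and m2: "(\<lambda>u. (4 * bump h u) *\<^sub>R u) \<in> borel_measurable (borel :: (real ^ 'n) measure)"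
      by measurable
    have fm [measurable]: "(\<lambda>u. f (c + u, y)) \<in> borel_measurable borel" for c
      by (intro borel_measurable_continuous_onI state_continuous_section[OF f y] continuous_intros)
    have mm: "(\<lambda>u. f (x + u, y) *\<^sub>R (bump h (u - e))\<^sup>2) \<in> borel_measurable borel" by measurable
    note i1 = convolve_integrable[OF f m1 bump_sq_kernel(1)[OF h] y]
    note i2 = convolve_integrable[OF f m2 bump_sq_kernel(2)[OF h] y]
    have G': "?G x' = (\<integral>u. f (x + u, y) *\<^sub>R (bump h (u - e))\<^sup>2 \<partial>lborel)"
      unfolding convolve_apply using integral_lborel_shift[OF mm, of e]
      by (simp add: e_def algebra_simps)
    have i3: "integrable lborel (\<lambda>u. f (x + u, y) *\<^sub>R (bump h (u - e))\<^sup>2)"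
    proof -
      have "integrable (distr lborel borel ((+) (- e))) (\<lambda>u. f (x' + u, y) *\<^sub>R (bump h u)\<^sup>2)"
        using i1[of x'] by (simp add: lborel_distr_plus)
      moreover have "(\<lambda>u. f (x' + u, y) *\<^sub>R (bump h u)\<^sup>2) \<in> borel_measurable borel" by measurable
      ultimately have "integrable lborel (\<lambda>u. f (x' + (- e + u), y) *\<^sub>R (bump h (- e + u))\<^sup>2)"
        by (subst (asm) integrable_distr_eq) simp_all
      then show ?thesis by (simp add: e_def algebra_simps)
    qed
    have D': "(x' - x) \<bullet> ?D = (\<integral>u. f (x + u, y) *\<^sub>R (4 * bump h u * (e \<bullet> u)) \<partial>lborel)"
      using integral_inner_right[of e lborel "\<lambda>u. f (x + u, y) *\<^sub>R ((4 * bump h u) *\<^sub>R u)"] i2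
      by (simp add: convolve_apply e_def mult_ac)
    have i4: "integrable lborel (\<lambda>u. f (x + u, y) *\<^sub>R (4 * bump h u * (e \<bullet> u)))"
      using integrable_inner_right[OF _ , of e lborel "\<lambda>u. f (x + u, y) *\<^sub>R ((4 * bump h u) *\<^sub>R u)"] i2
      by (simp add: mult_ac)
    have "?G x' - ?G x - (x' - x) \<bullet> ?D
      = (\<integral>u. f (x + u, y) *\<^sub>R ((bump h (u - e))\<^sup>2 - (bump h u)\<^sup>2 - 4 * bump h u * (e \<bullet> u)) \<partial>lborel)"
      unfolding G' D' using i1[of x] i3 i4 by (simp add: convolve_apply right_diff_distrib)
    also have "norm \<dots> \<le> (\<integral>u. norm (f (x + u, y) *\<^sub>R ((bump h (u - e))\<^sup>2 - (bump h u)\<^sup>2 - 4 * bump h u * (e \<bullet> u))) \<partial>lborel)"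
      by (rule integral_norm_bound)
    also have "\<dots> \<le> (\<integral>u. C * (27 * (norm e)\<^sup>2) * indicator (cball (0 :: real ^ 'n) 2) u \<partial>lborel)"
    proof (rule integral_mono)
      show "integrable lborel (\<lambda>u. norm (f (x + u, y) *\<^sub>R ((bump h (u - e))\<^sup>2 - (bump h u)\<^sup>2 - 4 * bump h u * (e \<bullet> u))))"
        using i1[of x] i3 i4 by (intro integrable_norm) (simp add: right_diff_distrib)
      show "integrable lborel (\<lambda>u. C * (27 * (norm e)\<^sup>2) * indicator (cball (0 :: real ^ 'n) 2) u)"
        by (intro integrable_mult_right integrable_indicator_cball)
      fix u :: "real ^ 'n"
      show "norm (f (x + u, y) *\<^sub>R ((bump h (u - e))\<^sup>2 - (bump h u)\<^sup>2 - 4 * bump h u * (e \<bullet> u)))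
        \<le> C * (27 * (norm e)\<^sup>2) * indicator (cball 0 2) u"
        using mult_mono[OF C[OF y, of "x + u"] bump_sq_expansion[OF h e(1), of u]] C0
        by (simp add: abs_mult mult.assoc)
    qed
    also have "\<dots> = 27 * C * ?V * norm e * norm e" by (simp add: power2_eq_square)
    finally show ?thesis using e(2) unfolding e_def[symmetric] by (simp add: divide_simps)
  qed
  have "((\<lambda>x'. 27 * C * ?V * norm (x' - x)) \<longlongrightarrow> 27 * C * ?V * norm (x - x)) (at x)"
    by (intro tendsto_intros)
  then have lim: "((\<lambda>x'. 27 * C * ?V * norm (x' - x)) \<longlongrightarrow> 0) (at x)" by simp
  show ?thesis
    unfolding gderiv_def by (rule has_derivativeI_sandwich[OF zero_less_one bl le lim])
qed

lemma bump_integral_pos: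
  assumes h: "0 < h" "h \<le> 1"
  shows "integrable lborel (\<lambda>u :: real ^ 'n. (bump h u)\<^sup>2)" "0 < (\<integral>u. (bump h (u :: real ^ 'n))\<^sup>2 \<partial>lborel)"
proof -
  show i: "integrable lborel (\<lambda>u :: real ^ 'n. (bump h u)\<^sup>2)"
    by (rule integrable_compact_support[OF _ bump_sq_kernel(1)[OF h]]) measurable
  have "0 < ((3 / 4) * h\<^sup>2)\<^sup>2 * measure lborel (ball (0 :: real ^ 'n) (h / 2))"
    using h by (intro mult_pos_pos content_ball_pos) auto
  also have "\<dots> = (\<integral>u. ((3 / 4) * h\<^sup>2)\<^sup>2 * indicator (ball (0 :: real ^ 'n) (h / 2)) u \<partial>lborel)"
    by simp
  also have "\<dots> \<le> (\<integral>u. (bump h (u :: real ^ 'n))\<^sup>2 \<partial>lborel)"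
  proof (rule integral_mono[OF _ i])
    show "integrable lborel (\<lambda>u. ((3 / 4) * h\<^sup>2)\<^sup>2 * indicator (ball (0 :: real ^ 'n) (h / 2)) u)"
      by (rule integrable_mult_right, rule integrable_real_indicator)
        (simp, rule emeasure_lborel_ball_finite)
    fix u :: "real ^ 'n"
    have "(3 / 4) * h\<^sup>2 \<le> bump h u" if "norm u < h / 2"
    proof -
      have "(norm u)\<^sup>2 \<le> (h / 2)\<^sup>2" using that by (intro power_mono) auto
      moreover have "h\<^sup>2 - (norm u)\<^sup>2 \<le> bump h u" by (simp add: bump_def)
      ultimately show ?thesis by (simp add: power_divide)
    qed
    then show "((3 / 4) * h\<^sup>2)\<^sup>2 * indicator (ball 0 (h / 2)) u \<le> (bump h u)\<^sup>2"
      by (auto simp: indicator_def intro!: power_mono)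
  qed
  finally show "0 < (\<integral>u. (bump h (u :: real ^ 'n))\<^sup>2 \<partial>lborel)" .
qed

text \<open>
  Mollification in the position variable alone; it preserves the range, being an average, and is
  uniformly close to \<open>f\<close> by uniform continuity.
\<close>

lemma test_functions_dense:
  fixes f :: "(real ^ 'n) \<times> (real ^ 'n) \<Rightarrow> real"
  assumes f: "state_continuous f" and \<delta>: "\<delta> > 0"
    and ab: "\<And>x y. y \<in> sphere 0 1 \<Longrightarrow> a \<le> f (x, y) \<and> f (x, y) \<le> b"
  shows "\<exists>g. vj_test_function g \<and> (\<forall>x. \<forall>y\<in>sphere 0 1.
    a \<le> g (x, y) \<and> g (x, y) \<le> b \<and> \<bar>g (x, y) - f (x, y)\<bar> \<le> \<delta>)"
proof -
  from state_continuous_uniformD[OF f \<delta>] obtain d where d: "d > 0"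
    "\<And>x x' y y'. y \<in> sphere 0 1 \<Longrightarrow> y' \<in> sphere 0 1 \<Longrightarrow>
      norm (x' - x) + norm (y' - y) < d \<Longrightarrow> \<bar>f (x', y') - f (x, y)\<bar> < \<delta>" by blast
  define h where "h = min d 1"
  have h: "0 < h" "h \<le> 1" "h \<le> d" using d by (auto simp: h_def)
  define k where "k = (\<lambda>u :: real ^ 'n. (bump h u)\<^sup>2)"
  define I where "I = (\<integral>u. k u \<partial>lborel)"
  have ki: "integrable lborel k" and I: "I > 0"
    using bump_integral_pos[OF h(1,2), where 'n = 'n] by (simp_all add: I_def k_def)
  have km: "k \<in> borel_measurable borel" unfolding k_def by measurable
  have kB: "norm (k u) \<le> 1 * indicator (cball 0 2) u" for u
    unfolding k_def by (rule bump_sq_kernel(1)[OF h(1,2)])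
  define g where "g w = (1 / I) * convolve k f w" for w
  let ?Dg = "\<lambda>w. (1 / I) *\<^sub>R convolve (\<lambda>u. (4 * bump h u) *\<^sub>R u) f w"
  have gd: "GDERIV (\<lambda>x. g (x, y)) x :> ?Dg (x, y)" if "y \<in> sphere 0 1" for x y
    using has_derivative_mult_right[OF convolve_bump_GDERIV[OF f h(1,2) that, unfolded gderiv_def], of "1 / I" x]
    by (simp add: g_def k_def gderiv_def)
  have ci: "integrable lborel (\<lambda>u. f (x + u, y) *\<^sub>R k u)" if "y \<in> sphere 0 1" for x y
    by (rule convolve_integrable[OF f km kB that])
  have bounds: "\<alpha> \<le> g (x, y) \<and> g (x, y) \<le> \<beta>"
    if y: "y \<in> sphere 0 1" and *: "\<And>u. norm u < h \<Longrightarrow> \<alpha> \<le> f (x + u, y) \<and> f (x + u, y) \<le> \<beta>" for x y \<alpha> \<beta>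
  proof -
    have **: "\<alpha> * k u \<le> f (x + u, y) * k u \<and> f (x + u, y) * k u \<le> \<beta> * k u" for u
    proof (cases "norm u < h")
      case True then show ?thesis using *[OF True] by (simp add: mult_right_mono k_def)
    next
      case False then show ?thesis using bump_eq_0[OF h(1), of u] by (simp add: k_def)
    qed
    have "\<alpha> * I \<le> convolve k f (x, y)"
      using integral_mono[OF integrable_mult_right[OF ki, of \<alpha>] ci[OF y, of x]] **
      by (simp add: convolve_apply I_def)
    moreover have "convolve k f (x, y) \<le> \<beta> * I"
      using integral_mono[OF ci[OF y, of x] integrable_mult_right[OF ki, of \<beta>]] **
      by (simp add: convolve_apply I_def)
    ultimately show ?thesis using I by (simp add: g_def divide_simps mult.commute)
  qed
  have range: "a \<le> g (x, y) \<and> g (x, y) \<le> b" if "y \<in> sphere 0 1" for x y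
    using that ab by (intro bounds) auto
  have near: "\<bar>g (x, y) - f (x, y)\<bar> \<le> \<delta>" if y: "y \<in> sphere 0 1" for x y
  proof -
    have "f (x, y) - \<delta> \<le> f (x + u, y) \<and> f (x + u, y) \<le> f (x, y) + \<delta>" if "norm u < h" for u
      using d(2)[OF y y, of "x + u" x] that h by (simp add: abs_less_iff)
    from bounds[OF y this] show ?thesis by (simp add: abs_le_iff)
  qed
  have "vj_test_function g"
    unfolding vj_test_function_def
  proof (intro conjI ballI allI)
    fix y :: "real ^ 'n" assume y: "y \<in> sphere 0 1"
    show "periodic (\<lambda>x. g (x, y))"
      unfolding periodic_def g_def convolve_apply
    proof (intro allI impI arg_cong2[where f = "(*)"] refl Bochner_Integration.integral_cong)
      fix x z u :: "real ^ 'n" assume "\<forall>i. x $ i - z $ i \<in> \<int>"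
      then have "f (x + u, y) = f (z + u, y)"
        using f y unfolding state_continuous_def periodic_def by simp
      then show "f (x + u, y) *\<^sub>R k u = f (z + u, y) *\<^sub>R k u" by simp
    qed
    show "(\<lambda>x'. g (x', y)) differentiable at x" for x
      using gd[OF y] unfolding gderiv_def differentiable_def by blast
  next
    show "continuous_on (UNIV \<times> sphere 0 1) g"
      unfolding g_def by (intro continuous_intros convolve_continuous[OF f km kB]) simp
    have m2: "(\<lambda>u. (4 * bump h u) *\<^sub>R u) \<in> borel_measurable (borel :: (real ^ 'n) measure)" by measurable
    have "continuous_on (UNIV \<times> sphere 0 1) ?Dg"
      by (intro continuous_intros convolve_continuous[OF f m2 bump_sq_kernel(2)[OF h(1,2)]]) simp
    then show "continuous_on (UNIV \<times> sphere 0 1) (\<lambda>(x, y). gradient (\<lambda>x'. g (x', y)) x)"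
      by (rule continuous_on_eq) (auto simp: gradient_eq[OF gd])
  qed
  then show ?thesis using range near by blast
qed

lemma test_functions_dense_nonneg:
  fixes f :: "(real ^ 'n) \<times> (real ^ 'n) \<Rightarrow> real"
  assumes f: "state_continuous f" and nn: "\<And>x y. y \<in> sphere 0 1 \<Longrightarrow> 0 \<le> f (x, y)" and \<delta>: "\<delta> > 0"
  shows "\<exists>g. vj_test_function g \<and> (\<forall>x. \<forall>y\<in>sphere 0 1. 0 \<le> g (x, y) \<and> \<bar>g (x, y) - f (x, y)\<bar> \<le> \<delta>)"
proof -
  obtain C where "\<And>x y. y \<in> sphere 0 1 \<Longrightarrow> \<bar>f (x, y)\<bar> \<le> C"
    using state_continuous_bounded[OF f] by blast
  then have "\<And>x y. y \<in> sphere 0 1 \<Longrightarrow> 0 \<le> f (x, y) \<and> f (x, y) \<le> C" using nn by (simp add: abs_le_iff)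
  from test_functions_dense[OF f \<delta> this] show ?thesis by blast
qed

lemma test_functions_dense_uniformly:
  fixes f :: "(real ^ 'n) \<times> (real ^ 'n) \<Rightarrow> real"
  assumes f: "state_continuous f" and \<delta>: "\<delta> > 0"
  shows "\<exists>g. vj_test_function g \<and> (\<forall>x. \<forall>y\<in>sphere 0 1. \<bar>g (x, y) - f (x, y)\<bar> \<le> \<delta>)"
proof -
  obtain C where "\<And>x y. y \<in> sphere 0 1 \<Longrightarrow> \<bar>f (x, y)\<bar> \<le> C"
    using state_continuous_bounded[OF f] by blast
  then have "\<And>x y. y \<in> sphere 0 1 \<Longrightarrow> - C \<le> f (x, y) \<and> f (x, y) \<le> C" by (simp add: abs_le_iff minus_le_iff)
  from test_functions_dense[OF f \<delta> this] show ?thesis by blast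
qed

section \<open>Comparison of measures through test functions\<close>

lemma measurable_state_space_borel_subset:
  fixes K :: "((real ^ 'n) \<times> (real ^ 'n)) set"
  assumes "K \<in> sets borel" "K \<subseteq> torus \<times> sphere 0 1"
  shows "K \<in> sets state_space"
proof -
  have "(\<lambda>w. w) -` K \<inter> space state_space \<in> sets state_space"
    using id_measurable_state_space assms(1) by (rule measurable_sets)
  moreover have "(\<lambda>w. w) -` K \<inter> space state_space = K" using assms(2) by (auto simp: space_state_space)
  ultimately show ?thesis by simp
qed

definition int_shifts :: "((real ^ 'n) \<times> (real ^ 'n)) set" where
  "int_shifts = {t. (\<forall>i. fst t $ i \<in> \<int>) \<and> snd t = 0}"

lemma closed_int_shifts: "closed int_shifts"
proof -
  have "closed {t :: (real ^ 'n) \<times> (real ^ 'n). fst t $ i \<in> \<int>}" for i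
  proof -
    have "closed ((\<lambda>t :: (real ^ 'n) \<times> (real ^ 'n). fst t $ i) -` \<int>)"
      by (intro continuous_closed_vimage closed_Ints) (intro continuous_intros)
    then show ?thesis by (simp add: vimage_def)
  qed
  then show ?thesis
    unfolding int_shifts_def
    by (intro closed_Collect_conj closed_Collect_all closed_Collect_eq continuous_intros)
qed

lemma int_shifts_group:
  "0 \<in> int_shifts" "s \<in> int_shifts \<Longrightarrow> t \<in> int_shifts \<Longrightarrow> s + t \<in> int_shifts"
  "t \<in> int_shifts \<Longrightarrow> - t \<in> int_shifts"
  by (auto simp: int_shifts_def)

lemma infdist_translate:
  fixes A :: "'a::real_normed_vector set"
  assumes "(\<lambda>a. a + t) ` A = A" shows "infdist (w + t) A = infdist w A"
proof (cases "A = {}")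
  case False
  have "infdist (w + t) A = (INF a\<in>(\<lambda>a. a + t) ` A. dist (w + t) a)"
    using False assms by (simp add: infdist_notempty)
  also have "\<dots> = (INF a\<in>A. dist w a)" by (simp add: image_image)
  finally show ?thesis using False by (simp add: infdist_notempty)
qed (simp add: infdist_def)

lemma torus_int_shift_eq_0:
  assumes "x \<in> torus" "x + d \<in> torus" "\<And>i. d $ i \<in> \<int>" shows "d = 0"
proof -
  have "d $ i = 0" for i
  proof -
    obtain n where n: "d $ i = of_int n" using assms(3) Ints_cases by metis
    have "- 1 < d $ i" "d $ i < 1" using assms(1,2) unfolding torus_def by (auto dest!: spec[of _ i])
    then have "- 1 < n" "n < 1" unfolding n by linarith+
    then show ?thesis using n by simp
  qed
  then show ?thesis by (simp add: vec_eq_iff)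
qed

text \<open>
  The inequality extends to nonnegative continuous functions by density, then to compact sets \<open>K\<close>,
  whose indicators are decreasing limits of \<open>max 0 (1 - j dist(\<sqdot>, K))\<close>, and to Borel sets by inner
  regularity. To make these functions periodic, the distance is taken to the union of
  all integer translates of \<open>K\<close>. This union is closed, because \<open>K\<close> is compact, and its points over
  the fundamental cube are those of \<open>K\<close>.
\<close>

lemma measure_le_of_test_functions:
  fixes m N :: "((real ^ 'n) \<times> (real ^ 'n)) measure"
  assumes m: "m \<in> space (prob_algebra state_space)" and N: "N \<in> space (prob_algebra state_space)"
    and c: "0 \<le> c"
    and le: "\<And>g. vj_test_function g \<Longrightarrow> (\<And>x y. y \<in> sphere 0 1 \<Longrightarrow> 0 \<le> g (x, y)) \<Longrightarrow>
      c * (\<integral>w. g w \<partial>m) \<le> (\<integral>w. g w \<partial>N)"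
    and A: "A \<in> sets state_space"
  shows "c * measure m A \<le> measure N A"
proof -
  interpret m: prob_space m using m by (simp add: space_prob_algebra)
  interpret N: prob_space N using N by (simp add: space_prob_algebra)
  have ms: "sets m = sets state_space" and Ns: "sets N = sets state_space"
    using m N by (simp_all add: space_prob_algebra)
  have msp: "space m = torus \<times> sphere 0 1" and Nsp: "space N = torus \<times> sphere 0 1"
    using sets_eq_imp_space_eq[OF ms] sets_eq_imp_space_eq[OF Ns] by (simp_all add: space_state_space)
  have cont: "c * (\<integral>w. f w \<partial>m) \<le> (\<integral>w. f w \<partial>N)"
    if f: "state_continuous f" and nn: "\<And>w. 0 \<le> f w" for f
  proof (rule field_le_epsilon)
    fix e :: real assume e: "e > 0"
    define d where "d = e / (1 + c)"
    have d: "d > 0" "d * (1 + c) = e" using e c by (simp_all add: d_def)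
    from test_functions_dense_nonneg[OF f nn d(1)] obtain g where g: "vj_test_function g"
      "\<And>x y. y \<in> sphere 0 1 \<Longrightarrow> 0 \<le> g (x, y)" "\<And>x y. y \<in> sphere 0 1 \<Longrightarrow> \<bar>g (x, y) - f (x, y)\<bar> \<le> d"
      by auto
    note gc = test_imp_state_continuous[OF g(1)]
    have "(\<integral>w. f w \<partial>m) - (\<integral>w. g w \<partial>m) \<le> d"
      using state_continuous_integral_bound[OF state_continuous_diff[OF gc f] m g(3)]
      by (simp add: state_continuous_integrable[OF gc m] state_continuous_integrable[OF f m] abs_le_iff)
    then have "c * ((\<integral>w. f w \<partial>m) - (\<integral>w. g w \<partial>m)) \<le> c * d"
      using c by (rule mult_left_mono)
    then have "c * (\<integral>w. f w \<partial>m) \<le> c * (\<integral>w. g w \<partial>m) + c * d"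
      by (simp add: right_diff_distrib)
    also have "c * (\<integral>w. g w \<partial>m) \<le> (\<integral>w. g w \<partial>N)" using g by (intro le) auto
    also have "(\<integral>w. g w \<partial>N) \<le> (\<integral>w. f w \<partial>N) + d"
      using state_continuous_integral_bound[OF state_continuous_diff[OF gc f] N g(3)]
      by (simp add: state_continuous_integrable[OF gc N] state_continuous_integrable[OF f N] abs_le_iff)
    finally show "c * (\<integral>w. f w \<partial>m) \<le> (\<integral>w. f w \<partial>N) + e"
      unfolding d(2)[symmetric] by (simp add: algebra_simps)
  qed
  have compact: "c * measure m K \<le> measure N K" if K: "compact K" "K \<subseteq> torus \<times> sphere 0 1" for K
  proof (cases "K = {}")
    case False
    \<comment> \<open>The periodic extension of \<open>K\<close>.\<close>
    define L where "L = (\<Union>w\<in>K. \<Union>t\<in>int_shifts. {w + t})"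
    have cl: "closed L"
      unfolding L_def using K(1) closed_int_shifts by (rule compact_closed_sums)
    have LK: "w \<in> L \<longleftrightarrow> w \<in> K" if "w \<in> torus \<times> sphere 0 1" for w
    proof
      assume "w \<in> K" then show "w \<in> L" unfolding L_def using int_shifts_group(1) by force
    next
      assume "w \<in> L"
      then obtain v t where v: "v \<in> K" "t \<in> int_shifts" "w = v + t" unfolding L_def by auto
      have "fst v \<in> torus" "fst v + fst t \<in> torus"
        using that v K(2) by (auto simp flip: fst_add)
      then have "fst t = 0"
        using v(2) by (intro torus_int_shift_eq_0[of "fst v"]) (simp_all add: int_shifts_def)
      then have "t = 0" using v(2) by (simp add: int_shifts_def prod_eq_iff)
      then show "w \<in> K" using v by simp
    qed
    have ne: "L \<noteq> {}" using False int_shifts_group(1) unfolding L_def by blast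
    have Ltr: "(\<lambda>a. a + t) ` L = L" if t: "t \<in> int_shifts" for t
    proof -
      have sub: "(\<lambda>a. a + s) ` L \<subseteq> L" if "s \<in> int_shifts" for s
      proof (rule image_subsetI)
        fix w assume "w \<in> L"
        then obtain v t' where v: "v \<in> K" "t' \<in> int_shifts" "w = v + t'" unfolding L_def by blast
        then have "w + s = v + (t' + s)" "t' + s \<in> int_shifts"
          using that int_shifts_group(2) by (simp_all add: add.assoc)
        then show "w + s \<in> L" unfolding L_def using v(1) by blast
      qed
      have "L \<subseteq> (\<lambda>a. a + t) ` L"
      proof
        fix w assume "w \<in> L"
        then have "w + - t \<in> L" using sub[OF int_shifts_group(3)[OF t]] by blast
        then show "w \<in> (\<lambda>a. a + t) ` L" by (intro image_eqI[of _ _ "w + - t"]) auto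
      qed
      with sub[OF t] show ?thesis by auto
    qed
    define f where "f j w = max 0 (1 - real j * infdist w L)" for j w
    have fc: "state_continuous (f j)" for j
      unfolding state_continuous_def
    proof (intro conjI ballI)
      show "continuous_on (UNIV \<times> sphere 0 1) (f j)"
        unfolding f_def by (intro continuous_intros)
      fix y :: "real ^ 'n"
      show "periodic (\<lambda>x. f j (x, y))"
        unfolding periodic_def
      proof (intro allI impI)
        fix x z :: "real ^ 'n" assume "\<forall>i. x $ i - z $ i \<in> \<int>"
        then have "(x - z, 0) \<in> int_shifts" by (simp add: int_shifts_def)
        from infdist_translate[OF Ltr[OF this], of "(z, y)"]
        show "f j (x, y) = f j (z, y)" by (simp add: f_def)
      qed
    qed
    have lim: "(\<lambda>j. \<integral>w. f j w \<partial>P) \<longlonglongrightarrow> measure P K"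
      if P: "P \<in> space (prob_algebra state_space)" for P
    proof -
      interpret P: prob_space P using P by (simp add: space_prob_algebra)
      have Ps: "sets P = sets state_space" using P by (simp add: space_prob_algebra)
      have Psp: "space P = torus \<times> sphere 0 1"
        using sets_eq_imp_space_eq[OF Ps] by (simp add: space_state_space)
      have KP: "K \<in> sets P"
        unfolding Ps using K by (intro measurable_state_space_borel_subset borel_compact)
      have "(\<lambda>j. \<integral>w. f j w \<partial>P) \<longlonglongrightarrow> (\<integral>w. indicat_real K w \<partial>P)"
      proof (rule integral_dominated_convergence[where w = "\<lambda>_. 1"])
        show "AE w in P. (\<lambda>j. f j w) \<longlonglongrightarrow> indicat_real K w"
        proof (rule AE_I2)
          fix w assume w: "w \<in> space P"
          show "(\<lambda>j. f j w) \<longlonglongrightarrow> indicat_real K w"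
          proof (cases "w \<in> K")
            case True
            then have "w \<in> L" using LK w Psp by simp
            then have "infdist w L = 0" by simp
            then show ?thesis using True by (simp add: f_def)
          next
            case F: False
            then have "w \<notin> L" using LK w Psp by simp
            then have pos: "infdist w L > 0"
              using in_closed_iff_infdist_zero[OF cl ne, of w] infdist_nonneg[of w L] by linarith
            have "\<forall>\<^sub>F j in sequentially. f j w = 0"
              using eventually_ge_at_top[of "nat \<lceil>1 / infdist w L\<rceil>"]
            proof eventually_elim
              case (elim j)
              then have "1 / infdist w L \<le> real j" by linarith
              then have "1 \<le> real j * infdist w L" using pos by (simp add: divide_simps)
              then show ?case by (simp add: f_def)
            qed
            then show ?thesis using F by (simp add: tendsto_eventually)
          qed
        qed
        show "AE w in P. norm (f j w) \<le> 1" for j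
          by (intro AE_I2) (simp add: f_def infdist_nonneg)
      qed (use KP state_continuous_integrable[OF fc P] in auto)
      then show ?thesis using KP by simp
    qed
    have "c * (\<integral>w. f j w \<partial>m) \<le> (\<integral>w. f j w \<partial>N)" for j
      by (rule cont[OF fc]) (simp add: f_def)
    then show ?thesis
      using tendsto_mult_left[OF lim[OF m], of c] lim[OF N] by (intro LIMSEQ_le) auto
  qed simp
  define m' where "m' = distr m borel (\<lambda>w. w)"
  have idm: "(\<lambda>w. w) \<in> m \<rightarrow>\<^sub>M borel"
    using id_measurable_state_space by (simp add: measurable_cong_sets[OF ms refl])
  have AT: "A \<subseteq> torus \<times> sphere 0 1"
    using sets.sets_into_space[OF A] by (simp add: space_state_space)
  have m'A: "emeasure m' B = emeasure m B" if "B \<in> sets borel" "B \<subseteq> torus \<times> sphere 0 1" for B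
    unfolding m'_def using that idm by (subst emeasure_distr) (auto simp: msp intro!: arg_cong[where f = "emeasure m"])
  have "emeasure m A = (SUP K\<in>{K. K \<subseteq> A \<and> compact K}. emeasure m' K)"
    unfolding m'A[OF sets_state_space[OF A] AT, symmetric]
    by (rule inner_regular) (auto simp: m'_def m.finite_measure_distr idm sets_state_space[OF A]
       emeasure_distr)
  then have "ennreal c * emeasure m A = (SUP K\<in>{K. K \<subseteq> A \<and> compact K}. ennreal c * emeasure m' K)"
    by (simp add: SUP_mult_left_ennreal)
  also have "\<dots> \<le> emeasure N A"
  proof (rule SUP_least)
    fix K assume "K \<in> {K. K \<subseteq> A \<and> compact K}"
    then have K: "compact K" "K \<subseteq> A" "K \<subseteq> torus \<times> sphere 0 1" using AT by auto
    have "ennreal c * emeasure m' K = ennreal (c * measure m K)"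
      using K c by (simp add: m'A borel_compact m.emeasure_eq_measure ennreal_mult)
    also have "\<dots> \<le> ennreal (measure N K)" by (intro ennreal_leI compact K)
    also have "\<dots> = emeasure N K" by (simp add: N.emeasure_eq_measure)
    also have "\<dots> \<le> emeasure N A" using K A by (intro emeasure_mono) (auto simp: Ns)
    finally show "ennreal c * emeasure m' K \<le> emeasure N A" .
  qed
  finally have "ennreal (c * measure m A) \<le> ennreal (measure N A)"
    using c by (simp add: m.emeasure_eq_measure N.emeasure_eq_measure ennreal_mult)
  then show ?thesis by (simp add: ennreal_le_iff)
qed

section \<open>Transport and jump parts of the generator\<close>

lemma GDERIV_shift:
  assumes "GDERIV f (x + a) :> D" shows "GDERIV (\<lambda>x. f (x + a)) x :> D"
proof -
  have "((\<lambda>x. x + a) has_derivative (\<lambda>h. h)) (at x)"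
    by (auto intro!: derivative_eq_intros)
  from has_derivative_compose[OF this, of f "\<lambda>h. h \<bullet> D"] assms show ?thesis
    by (simp add: gderiv_def)
qed

lemma periodic_gradient:
  fixes U :: "real ^ 'n \<Rightarrow> real"
  assumes per: "periodic U" and diff: "\<And>x. U differentiable at x"
  shows "periodic (gradient U)"
  unfolding periodic_def
proof (intro allI impI)
  fix x z :: "real ^ 'n" assume int: "\<forall>i. x $ i - z $ i \<in> \<int>"
  have "GDERIV (\<lambda>v. U (v + (x - z))) z :> gradient U x"
    using GDERIV_gradient[OF diff, of x] by (intro GDERIV_shift) simp
  moreover have "(\<lambda>v. U (v + (x - z))) = U"
    using per int unfolding periodic_def by (intro ext) simp
  ultimately show "gradient U x = gradient U z" by (simp add: gradient_eq)
qed

lemma smooth_gradient: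
  fixes U :: "real ^ 'n \<Rightarrow> real"
  assumes "smooth U"
  shows "U differentiable at x" "continuous_on UNIV (gradient U)"
proof -
  have C: "C_diff (Suc 0) U" using assms unfolding smooth_def by blast
  then show diff: "U differentiable at x" for x by simp
  have "gradient U x $ i = frechet_derivative U (at x) (axis i 1)" for x i
  proof -
    have "(U has_derivative (\<lambda>h. h \<bullet> gradient U x)) (at x)"
      using GDERIV_gradient[OF diff] by (simp add: gderiv_def)
    then have "frechet_derivative U (at x) = (\<lambda>h. h \<bullet> gradient U x)"
      by (rule frechet_derivative_at[symmetric])
    then show ?thesis by (simp add: inner_axis')
  qed
  then have "gradient U = (\<lambda>x. \<chi> i. frechet_derivative U (at x) (axis i 1))"
    by (simp add: vec_eq_iff fun_eq_iff)
  moreover have "continuous_on UNIV (\<lambda>x. \<chi> i. frechet_derivative U (at x) (axis i 1))"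
    using C by (intro continuous_on_vec_lambda) simp
  ultimately show "continuous_on UNIV (gradient U)" by simp
qed

definition drift :: "((real ^ 'n) \<times> (real ^ 'n) \<Rightarrow> real) \<Rightarrow> (real ^ 'n) \<times> (real ^ 'n) \<Rightarrow> real" where
  "drift f = (\<lambda>(x, y). y \<bullet> gradient (\<lambda>x'. f (x', y)) x)"

lemma drift_apply: "drift f (x, y) = y \<bullet> gradient (\<lambda>x'. f (x', y)) x"
  by (simp add: drift_def)

lemma test_gradient:
  assumes f: "vj_test_function f" and y: "y \<in> sphere 0 1"
  shows "GDERIV (\<lambda>x'. f (x', y)) x :> gradient (\<lambda>x'. f (x', y)) x"
  using f y by (intro GDERIV_gradient) (simp add: vj_test_function_def)

lemma state_continuous_drift:
  fixes f :: "(real ^ 'n) \<times> (real ^ 'n) \<Rightarrow> real"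
  assumes f: "vj_test_function f" shows "state_continuous (drift f)"
  unfolding state_continuous_def
proof (intro conjI ballI)
  have "continuous_on (UNIV \<times> sphere 0 1) (\<lambda>w. snd w \<bullet> (case w of (x, y) \<Rightarrow> gradient (\<lambda>x'. f (x', y)) x))"
    using f by (intro continuous_intros) (simp add: vj_test_function_def)
  then show "continuous_on (UNIV \<times> sphere 0 1) (drift f)"
    by (rule continuous_on_eq) (auto simp: drift_def)
  fix y :: "real ^ 'n" assume "y \<in> sphere 0 1"
  then have "periodic (gradient (\<lambda>x. f (x, y)))"
    using f by (intro periodic_gradient) (simp_all add: vj_test_function_def)
  then show "periodic (\<lambda>x. drift f (x, y))"
    by (simp add: periodic_def drift_apply)
qed

lemma transport_gradient:
  fixes f :: "(real ^ 'n) \<times> (real ^ 'n) \<Rightarrow> real"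
  assumes f: "vj_test_function f" and y: "y \<in> sphere 0 1"
  shows "GDERIV (\<lambda>x'. transport s f (x', y)) x :> gradient (\<lambda>x'. f (x', y)) (x + s *\<^sub>R y)"
  unfolding transport_apply using test_gradient[OF f y] by (rule GDERIV_shift)

lemma test_function_transport:
  fixes f :: "(real ^ 'n) \<times> (real ^ 'n) \<Rightarrow> real"
  assumes f: "vj_test_function f" shows "vj_test_function (transport s f)"
proof -
  note sc = state_continuous_transport[OF test_imp_state_continuous[OF f], of s]
  have grad: "continuous_on (UNIV \<times> sphere 0 1) (\<lambda>(x, y). gradient (\<lambda>x'. f (x', y)) x)"
    using f by (simp add: vj_test_function_def)
  have flow: "continuous_on (UNIV \<times> sphere 0 1) (\<lambda>w :: (real ^ 'n) \<times> (real ^ 'n). (fst w + s *\<^sub>R snd w, snd w))"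
    by (intro continuous_intros)
  have "continuous_on (UNIV \<times> sphere 0 1)
      (\<lambda>w. (\<lambda>(x, y). gradient (\<lambda>x'. f (x', y)) x) (fst w + s *\<^sub>R snd w, snd w))"
    by (rule continuous_on_compose2[OF grad flow]) auto
  then have "continuous_on (UNIV \<times> sphere 0 1) (\<lambda>(x, y). gradient (\<lambda>x'. transport s f (x', y)) x)"
    by (rule continuous_on_eq) (auto simp: gradient_eq[OF transport_gradient[OF f]])
  moreover have "(\<lambda>x'. transport s f (x', y)) differentiable at x" if "y \<in> sphere 0 1" for x y
    using transport_gradient[OF f that] unfolding gderiv_def differentiable_def by blast
  ultimately show ?thesis
    using sc unfolding vj_test_function_def state_continuous_def by blast
qed

lemma transport_transport: "transport s (transport t f) = transport (s + t) f"
  by (auto simp: transport_def fun_eq_iff algebra_simps)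

lemma transport_0 [simp]: "transport 0 f = f"
  by (auto simp: transport_def)

lemma DERIV_along_flow:
  fixes f :: "(real ^ 'n) \<times> (real ^ 'n) \<Rightarrow> real"
  assumes f: "vj_test_function f" and y: "y \<in> sphere 0 1"
  shows "((\<lambda>t. f (x + t *\<^sub>R y, y)) has_real_derivative drift f (x + t *\<^sub>R y, y)) (at t)"
proof -
  have "((\<lambda>t. x + t *\<^sub>R y) has_derivative (\<lambda>h. h *\<^sub>R y)) (at t)"
    by (auto intro!: derivative_eq_intros)
  from has_derivative_compose[OF this test_gradient[OF f y, unfolded gderiv_def]]
  show ?thesis by (simp add: has_field_derivative_def drift_apply mult_commute_abs)
qed

text \<open>
  The generator of free transport on a test function is \<open>drift f\<close>, in the uniform norm: by the mean
  value theorem the error is governed by the modulus of continuity of \<open>drift f\<close>.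
\<close>

lemma transport_uniform_derivative:
  fixes f :: "(real ^ 'n) \<times> (real ^ 'n) \<Rightarrow> real"
  assumes f: "vj_test_function f" and e: "e > 0"
  shows "\<exists>d>0. \<forall>h x. \<forall>y\<in>sphere 0 1. \<bar>h\<bar> < d \<longrightarrow> \<bar>transport h f (x, y) - f (x, y) - h * drift f (x, y)\<bar> \<le> e * \<bar>h\<bar>"
proof -
  from state_continuous_uniformD[OF state_continuous_drift[OF f] e]
  obtain d where d: "d > 0" "\<And>x x' y y'. y \<in> sphere 0 1 \<Longrightarrow> y' \<in> sphere 0 1 \<Longrightarrow>
      norm (x' - x) + norm (y' - y) < d \<Longrightarrow> \<bar>drift f (x', y') - drift f (x, y)\<bar> < e" by blast
  have "\<bar>transport h f (x, y) - f (x, y) - h * drift f (x, y)\<bar> \<le> e * \<bar>h\<bar>"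
    if y: "y \<in> sphere 0 1" and h: "\<bar>h\<bar> < d" for h x y
  proof -
    define g where "g t = f (x + t *\<^sub>R y, y) - t * drift f (x, y)" for t
    define g' where "g' t = drift f (x + t *\<^sub>R y, y) - drift f (x, y)" for t
    have "(g has_real_derivative drift f (x + t *\<^sub>R y, y) - 1 * drift f (x, y)) (at t)" for t
      unfolding g_def[abs_def]
      by (rule DERIV_diff[OF DERIV_along_flow[OF f y] DERIV_cmult_right[OF DERIV_ident]])
    then have der: "(g has_field_derivative g' t) (at t within closed_segment 0 h)" for t
      by (simp add: g'_def has_field_derivative_at_within)
    have bnd: "norm (g' t) \<le> e" if "t \<in> closed_segment 0 h" for t
    proof -
      have "norm (t *\<^sub>R y) < d"
        using that h y by (auto simp: closed_segment_eq_real_ivl split: if_splits)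
      then show ?thesis
        using d(2)[OF y y, of "x + t *\<^sub>R y" x] by (simp add: g'_def less_imp_le)
    qed
    have "norm (g h - g 0) \<le> e * norm (h - 0)"
      by (rule field_differentiable_bound[OF convex_closed_segment der bnd]) auto
    then have "\<bar>g h - g 0\<bar> \<le> e * \<bar>h\<bar>" by simp
    moreover have "g h - g 0 = transport h f (x, y) - f (x, y) - h * drift f (x, y)"
      by (simp add: g_def transport_apply)
    ultimately show ?thesis by simp
  qed
  then show ?thesis using d(1) by blast
qed

lemma orthogonal_transformation_reflect:
  "orthogonal_transformation (reflect U x)"
proof -
  define u where "u = sgn (gradient U x)"
  have u: "u = 0 \<or> u \<bullet> u = 1"
    by (cases "gradient U x = 0") (auto simp: u_def norm_sgn simp flip: power2_norm_eq_inner)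
  have "linear (\<lambda>y. y - (2 * (y \<bullet> u)) *\<^sub>R u)"
    by (rule linearI) (simp_all add: algebra_simps inner_add_left)
  moreover have "(v - (2 * (v \<bullet> u)) *\<^sub>R u) \<bullet> (w - (2 * (w \<bullet> u)) *\<^sub>R u) = v \<bullet> w" for v w
    using u by (auto simp: inner_diff_left inner_diff_right inner_commute)
  ultimately show ?thesis
    unfolding orthogonal_transformation_def reflect_def u_def by blast
qed

lemma norm_reflect [simp]: "norm (reflect U x y) = norm y"
  using orthogonal_transformation_reflect[of U x] by (simp add: orthogonal_transformation)

lemma reflect_inner_gradient: "reflect U x y \<bullet> gradient U x = - (y \<bullet> gradient U x)"
proof (cases "gradient U x = 0")
  case False
  have "sgn (gradient U x) \<bullet> gradient U x = norm (gradient U x)"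
    using False by (simp add: sgn_div_norm power2_norm_eq_inner[symmetric] power2_eq_square)
  moreover have "(y \<bullet> sgn (gradient U x)) * norm (gradient U x) = y \<bullet> gradient U x"
    using False by (simp add: sgn_div_norm)
  ultimately show ?thesis
    by (simp add: reflect_def inner_diff_left)
qed simp

text \<open>
  \<open>M\<close> bounds the force uniformly, and \<open>M / \<epsilon>\<close> the rate of reflections.
\<close>

locale velocity_jump =
  fixes U :: "real ^ 'n \<Rightarrow> real" and r \<epsilon> M :: real
  assumes r_pos: "r > 0" and \<epsilon>_pos: "\<epsilon> > 0" and M_pos: "M > 0"
    and U_diff: "\<And>x. U differentiable at x"
    and cont_gradient: "continuous_on UNIV (gradient U)"
    and periodic_U: "periodic U"
    and gradient_le: "\<And>x. norm (gradient U x) \<le> M"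
begin

definition bounce_rate :: "(real ^ 'n) \<times> (real ^ 'n) \<Rightarrow> real" where
  "bounce_rate = (\<lambda>(x, y). max (y \<bullet> gradient U x) 0 / \<epsilon>)"

definition jump_part :: "((real ^ 'n) \<times> (real ^ 'n) \<Rightarrow> real) \<Rightarrow> (real ^ 'n) \<times> (real ^ 'n) \<Rightarrow> real" where
  "jump_part f = (\<lambda>(x, y). bounce_rate (x, y) * (f (x, reflect U x y) - f (x, y))
     + r * (resample f (x, y) - f (x, y)))"

definition total_rate :: real where "total_rate = M / \<epsilon> + r"

lemma total_rate_pos: "total_rate > 0"
  unfolding total_rate_def using r_pos \<epsilon>_pos M_pos by (simp add: add_pos_pos)

lemma vj_generator_eq: "vj_generator U r \<epsilon> f w = drift f w + jump_part f w"
  by (cases w) (simp add: vj_generator_def drift_apply jump_part_def bounce_rate_def resample_apply)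

lemma bounce_rate_bounds:
  assumes "y \<in> sphere 0 1"
  shows "0 \<le> bounce_rate (x, y)" "bounce_rate (x, y) \<le> M / \<epsilon>"
proof -
  have "y \<bullet> gradient U x \<le> norm y * norm (gradient U x)"
    by (rule norm_cauchy_schwarz)
  also have "\<dots> \<le> M" using assms gradient_le by simp
  finally show "0 \<le> bounce_rate (x, y)" "bounce_rate (x, y) \<le> M / \<epsilon>"
    using \<epsilon>_pos M_pos by (auto simp: bounce_rate_def intro!: divide_right_mono)
qed

lemma state_continuous_bounce_rate: "state_continuous bounce_rate"
  unfolding state_continuous_def
proof (intro conjI ballI)
  have "continuous_on (UNIV \<times> sphere 0 1) (\<lambda>w. max (snd w \<bullet> gradient U (fst w)) 0 / \<epsilon>)"
    using \<epsilon>_pos by (intro continuous_intros continuous_on_compose2[OF cont_gradient]) auto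
  then show "continuous_on (UNIV \<times> sphere 0 1) bounce_rate"
    by (rule continuous_on_eq) (auto simp: bounce_rate_def)
  show "periodic (\<lambda>x. bounce_rate (x, y))" for y
    using periodic_gradient[OF periodic_U U_diff] by (simp add: periodic_def bounce_rate_def)
qed

text \<open>
  The reflection is discontinuous at critical points of \<open>U\<close>, but its rate vanishes there.
\<close>

lemma state_continuous_bounce:
  assumes f: "state_continuous f"
  shows "state_continuous (\<lambda>(x, y). bounce_rate (x, y) * f (x, reflect U x y))"
proof -
  let ?S = "UNIV \<times> sphere 0 1 :: ((real ^ 'n) \<times> (real ^ 'n)) set"
  let ?F = "\<lambda>w. bounce_rate w * f (fst w, reflect U (fst w) (snd w))"
  obtain C where "0 < C" and C: "\<And>x y. y \<in> sphere 0 1 \<Longrightarrow> \<bar>f (x, y)\<bar> \<le> C"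
    using state_continuous_bounded[OF f] by blast
  have ratec: "(bounce_rate \<longlongrightarrow> bounce_rate w) (at w within ?S)" if "w \<in> ?S" for w
    using state_continuous_cont[OF state_continuous_bounce_rate] that unfolding continuous_on_def by blast
  have gradc: "((\<lambda>w. gradient U (fst w)) \<longlongrightarrow> gradient U (fst w)) (at w within ?S)" for w
    by (rule continuous_on_tendsto_compose[OF cont_gradient]) (auto intro!: tendsto_intros)
  have "continuous_on ?S ?F"
    unfolding continuous_on_def
  proof
    fix w assume w: "w \<in> ?S"
    have ev: "\<forall>\<^sub>F v in at w within ?S. v \<in> ?S" by (simp add: eventually_at_filter)
    show "(?F \<longlongrightarrow> ?F w) (at w within ?S)"
    proof (cases "gradient U (fst w) = 0")
      case False
      have "((\<lambda>w. reflect U (fst w) (snd w)) \<longlongrightarrow> reflect U (fst w) (snd w)) (at w within ?S)"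
        unfolding reflect_def using False by (intro tendsto_intros gradc)
      then have "((\<lambda>w. (fst w, reflect U (fst w) (snd w))) \<longlongrightarrow> (fst w, reflect U (fst w) (snd w))) (at w within ?S)"
        by (intro tendsto_intros)
      then have "((\<lambda>w. f (fst w, reflect U (fst w) (snd w))) \<longlongrightarrow> f (fst w, reflect U (fst w) (snd w))) (at w within ?S)"
        by (rule continuous_on_tendsto_compose[OF state_continuous_cont[OF f]])
          (use w ev in \<open>auto elim!: eventually_mono\<close>)
      then show ?thesis by (intro tendsto_mult ratec w)
    next
      case True
      then have 0: "bounce_rate w = 0" by (simp add: bounce_rate_def case_prod_beta)
      have "((\<lambda>v. bounce_rate v * C) \<longlongrightarrow> 0 * C) (at w within ?S)"
        using ratec[OF w] by (intro tendsto_intros) (simp add: 0)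
      then have "((\<lambda>v. bounce_rate v * C) \<longlongrightarrow> 0) (at w within ?S)" by simp
      moreover have "\<forall>\<^sub>F v in at w within ?S. norm (?F v) \<le> bounce_rate v * C"
        using ev
      proof eventually_elim
        case (elim v)
        then have "\<bar>f (fst v, reflect U (fst v) (snd v))\<bar> \<le> C" by (intro C) auto
        then show ?case
          using elim bounce_rate_bounds(1)[of "snd v" "fst v"] by (auto simp: abs_mult intro!: mult_left_mono)
      qed
      ultimately have "(?F \<longlongrightarrow> 0) (at w within ?S)" by (rule Lim_null_comparison[rotated])
      then show ?thesis by (simp add: 0)
    qed
  qed
  moreover have "periodic (\<lambda>x. bounce_rate (x, y) * f (x, reflect U x y))" if "y \<in> sphere 0 1" for y
    unfolding periodic_def
  proof (intro allI impI)
    fix x z :: "real ^ 'n" assume int: "\<forall>i. x $ i - z $ i \<in> \<int>"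
    have "gradient U x = gradient U z" using periodic_gradient[OF periodic_U U_diff] int by (simp add: periodic_def)
    then have "reflect U x y = reflect U z y" "bounce_rate (x, y) = bounce_rate (z, y)"
      by (simp_all add: reflect_def bounce_rate_def)
    moreover have "f (x, reflect U z y) = f (z, reflect U z y)"
      using f int that unfolding state_continuous_def periodic_def by simp
    ultimately show "bounce_rate (x, y) * f (x, reflect U x y) = bounce_rate (z, y) * f (z, reflect U z y)" by simp
  qed
  ultimately show ?thesis
    unfolding state_continuous_def by (simp add: case_prod_beta)
qed

text \<open>
  Uniformization: adding the constant \<open>total_rate\<close> turns the jump part into a positive operator,
  which is \<open>total_rate\<close> times a Markov operator.
\<close>

lemma jump_part_plus_total_rate:
  "jump_part f (x, y) + total_rate * f (x, y) =
     bounce_rate (x, y) * f (x, reflect U x y) + (M / \<epsilon> - bounce_rate (x, y)) * f (x, y) + r * resample f (x, y)"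
  by (simp add: jump_part_def total_rate_def algebra_simps)

lemma state_continuous_jump_part:
  assumes f: "state_continuous f" shows "state_continuous (jump_part f)"
proof -
  have "state_continuous (\<lambda>w. (\<lambda>(x, y). bounce_rate (x, y) * f (x, reflect U x y)) w
     - bounce_rate w * f w + r * (resample f w - f w))"
    by (intro state_continuous_add state_continuous_diff state_continuous_mult state_continuous_bounce
      state_continuous_bounce_rate state_continuous_resample state_continuous_const f)
  moreover have "jump_part f = (\<lambda>w. (\<lambda>(x, y). bounce_rate (x, y) * f (x, reflect U x y)) w
     - bounce_rate w * f w + r * (resample f w - f w))"
    by (auto simp: jump_part_def fun_eq_iff algebra_simps)
  ultimately show ?thesis by simp
qed

lemma jump_part_lower_bound:
  assumes f: "state_continuous f" and nn: "\<And>x y. y \<in> sphere 0 1 \<Longrightarrow> 0 \<le> f (x, y)" and y: "y \<in> sphere 0 1"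
  shows "r * resample f (x, y) \<le> jump_part f (x, y) + total_rate * f (x, y)"
  unfolding jump_part_plus_total_rate
  using bounce_rate_bounds[OF y, of x] nn y by (simp add: add_nonneg_nonneg)

lemma jump_part_bound:
  assumes f: "state_continuous f" and C: "\<And>x y. y \<in> sphere 0 1 \<Longrightarrow> \<bar>f (x, y)\<bar> \<le> C" and y: "y \<in> sphere 0 1"
  shows "\<bar>jump_part f (x, y) + total_rate * f (x, y)\<bar> \<le> total_rate * C"
proof -
  note b = bounce_rate_bounds[OF y, of x]
  have y': "reflect U x y \<in> sphere 0 1" using y by simp
  have "\<bar>resample f (x, y)\<bar> \<le> C"
  proof (rule abs_leI)
    show "resample f (x, y) \<le> C" using C by (intro resample_bounds(2)[OF f]) (simp add: abs_le_iff)
    have "- C \<le> resample f (x, y)"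
    proof (rule resample_bounds(1)[OF f])
      fix z :: "real ^ 'n" assume "z \<in> sphere 0 1"
      from C[OF this, of x] show "- C \<le> f (x, z)" by linarith
    qed
    then show "- resample f (x, y) \<le> C" by simp
  qed
  then have "\<bar>r * resample f (x, y)\<bar> \<le> r * C" using r_pos by (simp add: abs_mult)
  moreover have "\<bar>bounce_rate (x, y) * f (x, reflect U x y)\<bar> \<le> bounce_rate (x, y) * C"
    using b C[OF y', of x] by (simp add: abs_mult mult_left_mono)
  moreover have "\<bar>(M / \<epsilon> - bounce_rate (x, y)) * f (x, y)\<bar> \<le> (M / \<epsilon> - bounce_rate (x, y)) * C"
    using b C[OF y, of x] by (simp add: abs_mult mult_left_mono)
  moreover have "bounce_rate (x, y) * C + (M / \<epsilon> - bounce_rate (x, y)) * C + r * C = total_rate * C"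
    by (simp add: total_rate_def algebra_simps)
  ultimately show ?thesis unfolding jump_part_plus_total_rate by linarith
qed

end

section \<open>The forward equation and uniqueness of its solutions\<close>

lemma le_of_nonpos_derivative_within:
  fixes F :: "real \<Rightarrow> real"
  assumes ab: "a \<le> b"
    and der: "\<And>s. s \<in> {a..b} \<Longrightarrow> (F has_real_derivative F' s) (at s within {a..b})"
    and le: "\<And>s. s \<in> {a..b} \<Longrightarrow> F' s \<le> 0"
  shows "F b \<le> F a"
proof (rule DERIV_nonpos_imp_decreasing_open[OF ab])
  fix s assume s: "a < s" "s < b"
  have "(F has_real_derivative F' s) (at s)"
    using der[of s] s at_within_Icc_at[of a s b] by simp
  then show "\<exists>y. (F has_real_derivative y) (at s) \<and> y \<le> 0" using le[of s] s by auto
next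
  show "continuous_on {a..b} F"
    unfolding continuous_on_eq_continuous_within
    using der by (blast intro: DERIV_continuous)
qed

context velocity_jump
begin

lemma state_continuous_generator:
  assumes g: "vj_test_function g" shows "state_continuous (vj_generator U r \<epsilon> g)"
proof -
  have "vj_generator U r \<epsilon> g = (\<lambda>w. drift g w + jump_part g w)"
    by (rule ext) (rule vj_generator_eq)
  then show ?thesis
    by (simp add: state_continuous_add state_continuous_drift state_continuous_jump_part
      test_imp_state_continuous g)
qed

text \<open>
  Weak solutions of the Kolmogorov forward equation; the derivative is one-sided at \<open>t = 0\<close>.
\<close>

definition forward_solution :: "(real \<Rightarrow> ((real ^ 'n) \<times> (real ^ 'n)) measure) \<Rightarrow> bool" where
  "forward_solution N \<longleftrightarrow>
     (\<forall>t\<ge>0. N t \<in> space (prob_algebra state_space)) \<and>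
     (\<forall>g. vj_test_function g \<longrightarrow> (\<forall>t\<ge>0.
        ((\<lambda>t. \<integral>w. g w \<partial>N t) has_real_derivative (\<integral>w. vj_generator U r \<epsilon> g w \<partial>N t)) (at t within {0..})))"

lemma forward_solution_prob:
  "forward_solution N \<Longrightarrow> 0 \<le> t \<Longrightarrow> N t \<in> space (prob_algebra state_space)"
  by (simp add: forward_solution_def)

lemma integral_close:
  assumes m: "m \<in> space (prob_algebra state_space)"
    and f: "state_continuous f" and g: "state_continuous g"
    and e: "\<And>x y. y \<in> sphere 0 1 \<Longrightarrow> \<bar>g (x, y) - f (x, y)\<bar> \<le> e"
  shows "\<bar>(\<integral>w. g w \<partial>m) - (\<integral>w. f w \<partial>m)\<bar> \<le> e"
  using state_continuous_integral_bound[OF state_continuous_diff[OF g f] m e]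
  by (simp add: state_continuous_integrable[OF f m] state_continuous_integrable[OF g m])

lemma integral_mono_state:
  assumes m: "m \<in> space (prob_algebra state_space)"
    and f: "state_continuous f" and g: "state_continuous g"
    and le: "\<And>x y. y \<in> sphere 0 1 \<Longrightarrow> f (x, y) \<le> g (x, y)"
  shows "(\<integral>w. f w \<partial>m) \<le> (\<integral>w. g w \<partial>m)"
proof (rule integral_mono[OF state_continuous_integrable[OF f m] state_continuous_integrable[OF g m]])
  fix w assume "w \<in> space m"
  moreover have "space m = space state_space"
    using m by (intro sets_eq_imp_space_eq) (simp add: space_prob_algebra)
  ultimately show "f w \<le> g w" using le by (auto simp: space_state_space)
qed

lemma forward_solution_tendsto:
  assumes N: "forward_solution N" and f: "state_continuous f" and t: "0 \<le> t"
  shows "((\<lambda>s. \<integral>w. f w \<partial>N s) \<longlongrightarrow> (\<integral>w. f w \<partial>N t)) (at t within {0..})"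
proof (rule tendstoI)
  fix e :: real assume e: "e > 0"
  from test_functions_dense_uniformly[OF f, of "e / 3"] e obtain g where g: "vj_test_function g"
    and gf: "\<And>x y. y \<in> sphere 0 1 \<Longrightarrow> \<bar>g (x, y) - f (x, y)\<bar> \<le> e / 3" by auto
  note close = integral_close[OF forward_solution_prob[OF N] f test_imp_state_continuous[OF g] gf]
  have "((\<lambda>s. \<integral>w. g w \<partial>N s) \<longlongrightarrow> (\<integral>w. g w \<partial>N t)) (at t within {0..})"
  proof -
    have "((\<lambda>t. \<integral>w. g w \<partial>N t) has_real_derivative (\<integral>w. vj_generator U r \<epsilon> g w \<partial>N t)) (at t within {0..})"
      using N g t by (simp add: forward_solution_def)
    from DERIV_continuous[OF this] show ?thesis by (simp add: continuous_within)
  qed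
  then have "\<forall>\<^sub>F s in at t within {0..}. dist (\<integral>w. g w \<partial>N s) (\<integral>w. g w \<partial>N t) < e / 3"
    using e by (intro tendstoD) auto
  moreover have "\<forall>\<^sub>F s in at t within {0..}. s \<ge> 0"
    by (simp add: eventually_at_filter)
  ultimately show "\<forall>\<^sub>F s in at t within {0..}. dist (\<integral>w. f w \<partial>N s) (\<integral>w. f w \<partial>N t) < e"
  proof eventually_elim
    case (elim s)
    then show ?case using close[of s] close[of t] t unfolding dist_real_def by linarith
  qed
qed

text \<open>
  A product rule: the part of the derivative from \<open>N\<close> is minus the generator, and the part from the
  transported function is the drift, which cancels the drift part of the generator.
\<close>

lemma forward_solution_transport_derivative:
  assumes N: "forward_solution N" and f: "vj_test_function f" and s: "s \<in> {0..t}"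
  shows "((\<lambda>u. \<integral>w. transport u f w \<partial>N (t - u)) has_real_derivative
     - (\<integral>w. jump_part (transport s f) w \<partial>N (t - s))) (at s within {0..t})"
proof -
  define g where "g = transport s f"
  have g: "vj_test_function g" unfolding g_def using f by (rule test_function_transport)
  note gc = test_imp_state_continuous[OF g]
  note dc = state_continuous_drift[OF g] and jc = state_continuous_jump_part[OF gc]
  have pr: "N (t - u) \<in> space (prob_algebra state_space)" if "u \<in> {0..t}" for u
    using that by (intro forward_solution_prob[OF N]) simp
  let ?A = "at s within {0..t}"
  have flip: "LIM u ?A. t - u :> at (t - s) within {0..}"
    unfolding filterlim_at
  proof (intro conjI)
    show "\<forall>\<^sub>F u in ?A. t - u \<in> {0..} \<and> t - u \<noteq> t - s"
      by (auto simp: eventually_at_filter)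
    show "((\<lambda>u. t - u) \<longlongrightarrow> t - s) ?A" by (intro tendsto_intros)
  qed
  have G: "((\<lambda>u. \<integral>w. g w \<partial>N (t - u)) has_real_derivative (\<integral>w. vj_generator U r \<epsilon> g w \<partial>N (t - s)) * (- 1)) ?A"
  proof -
    have "((\<lambda>t. \<integral>w. g w \<partial>N t) has_real_derivative (\<integral>w. vj_generator U r \<epsilon> g w \<partial>N (t - s))) (at (t - s) within {0..})"
      using N g s by (auto simp: forward_solution_def)
    then have 1: "((\<lambda>t. \<integral>w. g w \<partial>N t) has_real_derivative (\<integral>w. vj_generator U r \<epsilon> g w \<partial>N (t - s)))
      (at (t - s) within (\<lambda>u. t - u) ` {0..t})"
      by (rule DERIV_subset) auto
    have 2: "((\<lambda>u. t - u) has_real_derivative - 1) ?A"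
      by (auto intro!: derivative_eq_intros)
    from DERIV_image_chain[OF 1 2] show ?thesis by (simp add: comp_def)
  qed
  let ?H = "\<lambda>u. (\<integral>w. transport u f w \<partial>N (t - u)) - (\<integral>w. g w \<partial>N (t - u))"
  let ?D = "\<lambda>u. \<integral>w. drift g w \<partial>N (t - u)"
  have "((\<lambda>u. (?H u - ?H s) / (u - s) - ?D u) \<longlongrightarrow> 0) ?A"
  proof (rule tendstoI)
    fix e :: real assume e: "e > 0"
    from transport_uniform_derivative[OF g, of "e / 2"] e obtain d where d: "d > 0"
      "\<And>h x y. y \<in> sphere 0 1 \<Longrightarrow> \<bar>h\<bar> < d \<Longrightarrow> \<bar>transport h g (x, y) - g (x, y) - h * drift g (x, y)\<bar> \<le> e / 2 * \<bar>h\<bar>"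
      by auto
    have "\<forall>\<^sub>F u in ?A. u \<in> {0..t} \<and> u \<noteq> s \<and> dist u s < d"
      using d(1) by (auto simp: eventually_at)
    then show "\<forall>\<^sub>F u in ?A. dist ((?H u - ?H s) / (u - s) - ?D u) 0 < e"
    proof eventually_elim
      case (elim u)
      let ?h = "u - s"
      have h: "\<bar>?h\<bar> < d" "?h \<noteq> 0" using elim by (auto simp: dist_real_def)
      have tr: "transport ?h g = transport u f" by (simp add: g_def transport_transport)
      have uc: "state_continuous (transport u f)"
        by (intro state_continuous_transport test_imp_state_continuous f)
      have p: "N (t - u) \<in> space (prob_algebra state_space)" using elim by (intro pr) simp
      have sc: "state_continuous (\<lambda>w. transport u f w - g w - ?h * drift g w)"
        by (intro state_continuous_diff state_continuous_mult uc gc dc state_continuous_const)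
      have "\<bar>\<integral>w. transport u f w - g w - ?h * drift g w \<partial>N (t - u)\<bar> \<le> e / 2 * \<bar>?h\<bar>"
        using d(2)[OF _ h(1)] unfolding tr by (intro state_continuous_integral_bound[OF sc p]) blast
      moreover have "(\<integral>w. transport u f w - g w - ?h * drift g w \<partial>N (t - u)) = ?H u - ?h * ?D u"
        using state_continuous_integrable[OF uc p] state_continuous_integrable[OF gc p]
          state_continuous_integrable[OF dc p] by simp
      moreover have "?H s = 0" by (simp add: g_def)
      ultimately have "\<bar>(?H u - ?H s) - ?h * ?D u\<bar> \<le> e / 2 * \<bar>?h\<bar>" by simp
      moreover have "(?H u - ?H s) / ?h - ?D u = ((?H u - ?H s) - ?h * ?D u) / ?h"
        using h(2) by (simp add: diff_divide_distrib)
      ultimately have "\<bar>(?H u - ?H s) / ?h - ?D u\<bar> \<le> e / 2"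
        using h(2) by (simp add: abs_divide divide_le_eq)
      then show ?case using e by simp
    qed
  qed
  moreover have "(?D \<longlongrightarrow> ?D s) ?A"
    using filterlim_compose[OF forward_solution_tendsto[OF N dc, of "t - s"] flip] s by simp
  ultimately have "((\<lambda>u. ((?H u - ?H s) / (u - s) - ?D u) + ?D u) \<longlongrightarrow> 0 + ?D s) ?A"
    by (rule tendsto_add)
  then have H: "(?H has_real_derivative ?D s) ?A"
    by (simp add: has_field_derivative_iff)
  have "(\<integral>w. vj_generator U r \<epsilon> g w \<partial>N (t - s)) = ?D s + (\<integral>w. jump_part g w \<partial>N (t - s))"
    unfolding vj_generator_eq using s
    by (intro Bochner_Integration.integral_add state_continuous_integrable[OF dc pr] state_continuous_integrable[OF jc pr])
  then show ?thesis
    using DERIV_add[OF H G] by (simp add: g_def)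
qed

lemma forward_solution_weighted_derivative:
  assumes N: "forward_solution N" and f: "vj_test_function f" and s: "s \<in> {0..t}"
  shows "((\<lambda>u. exp (- total_rate * u) * (\<integral>w. transport u f w \<partial>N (t - u))) has_real_derivative
     - (exp (- total_rate * s) * (\<integral>w. jump_part (transport s f) w + total_rate * transport s f w \<partial>N (t - s)))) (at s within {0..t})"
proof -
  have pr: "N (t - s) \<in> space (prob_algebra state_space)"
    using s by (intro forward_solution_prob[OF N]) simp
  have tc: "state_continuous (transport s f)"
    by (intro state_continuous_transport test_imp_state_continuous f)
  have sp: "(\<integral>w. jump_part (transport s f) w + total_rate * transport s f w \<partial>N (t - s))
    = (\<integral>w. jump_part (transport s f) w \<partial>N (t - s)) + total_rate * (\<integral>w. transport s f w \<partial>N (t - s))"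
    using state_continuous_integrable[OF state_continuous_jump_part[OF tc] pr] state_continuous_integrable[OF tc pr]
    by simp
  have "((\<lambda>u. exp (- total_rate * u)) has_real_derivative exp (- total_rate * s) * - total_rate) (at s within {0..t})"
    by (auto intro!: derivative_eq_intros)
  from DERIV_mult[OF this forward_solution_transport_derivative[OF N f s]]
  show ?thesis unfolding sp by (simp add: algebra_simps)
qed

text \<open>
  If \<open>S\<close> bounds the difference of the two solutions on the unit ball of the continuous functions, then
  the weighted difference along transport changes at a rate at most \<open>\<Lambda> S exp (- \<Lambda> s)\<close>, since
  \<open>B + \<Lambda>\<close> has norm \<open>\<Lambda>\<close>. It vanishes at \<open>s = t\<close> because the initial values agree.
\<close>

lemma forward_solution_difference_bound:
  assumes N: "forward_solution N" and N': "forward_solution N'" and eq0: "N 0 = N' 0"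
    and f: "vj_test_function f" and f1: "\<And>x y. y \<in> sphere 0 1 \<Longrightarrow> \<bar>f (x, y)\<bar> \<le> 1"
    and t: "0 \<le> t" "t \<le> \<tau>"
    and S: "\<And>k u. state_continuous k \<Longrightarrow> (\<And>x y. y \<in> sphere 0 1 \<Longrightarrow> \<bar>k (x, y)\<bar> \<le> 1) \<Longrightarrow> 0 \<le> u \<Longrightarrow> u \<le> \<tau> \<Longrightarrow>
      \<bar>(\<integral>w. k w \<partial>N u) - (\<integral>w. k w \<partial>N' u)\<bar> \<le> S"
  shows "(\<integral>w. f w \<partial>N' t) - (\<integral>w. f w \<partial>N t) \<le> S * (1 - exp (- total_rate * \<tau>))"
proof -
  have S0: "0 \<le> S" using S[of "\<lambda>_. 0" 0] t by simp
  let ?\<Lambda> = total_rate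
  let ?k = "\<lambda>s w. jump_part (transport s f) w + ?\<Lambda> * transport s f w"
  let ?F = "\<lambda>u. exp (- ?\<Lambda> * u) * (\<integral>w. transport u f w \<partial>N (t - u)) - exp (- ?\<Lambda> * u) * (\<integral>w. transport u f w \<partial>N' (t - u))
     + S * exp (- ?\<Lambda> * u)"
  let ?F' = "\<lambda>s. - (exp (- ?\<Lambda> * s) * (\<integral>w. ?k s w \<partial>N (t - s))) - - (exp (- ?\<Lambda> * s) * (\<integral>w. ?k s w \<partial>N' (t - s)))
     + S * (exp (- ?\<Lambda> * s) * - ?\<Lambda>)"
  have "?F t \<le> ?F 0"
  proof (rule le_of_nonpos_derivative_within[where F = ?F and F' = ?F'])
    fix s assume s: "s \<in> {0..t}"
    have "((\<lambda>u. S * exp (- ?\<Lambda> * u)) has_real_derivative S * (exp (- ?\<Lambda> * s) * - ?\<Lambda>)) (at s within {0..t})"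
      by (auto intro!: derivative_eq_intros)
    then show "(?F has_real_derivative ?F' s) (at s within {0..t})"
      by (intro DERIV_add DERIV_diff forward_solution_weighted_derivative[OF N f s]
        forward_solution_weighted_derivative[OF N' f s])
    have tc: "state_continuous (transport s f)"
      by (intro state_continuous_transport test_imp_state_continuous f)
    have kc: "state_continuous (?k s)"
      by (intro state_continuous_add state_continuous_mult state_continuous_const state_continuous_jump_part tc)
    have "\<bar>?k s (x, y)\<bar> \<le> ?\<Lambda> * 1" if "y \<in> sphere 0 1" for x y
      using that f1 by (intro jump_part_bound[OF tc]) (simp_all add: transport_apply)
    then have k1: "\<bar>?k s (x, y) * (1 / ?\<Lambda>)\<bar> \<le> 1" if "y \<in> sphere 0 1" for x y
      using that total_rate_pos by (simp add: abs_mult)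
    have "\<bar>(\<integral>w. ?k s w * (1 / ?\<Lambda>) \<partial>N (t - s)) - (\<integral>w. ?k s w * (1 / ?\<Lambda>) \<partial>N' (t - s))\<bar> \<le> S"
      using s t by (intro S state_continuous_mult state_continuous_const kc k1) auto
    then have "\<bar>((\<integral>w. ?k s w \<partial>N (t - s)) - (\<integral>w. ?k s w \<partial>N' (t - s))) / ?\<Lambda>\<bar> \<le> S"
      by (simp add: diff_divide_distrib)
    then have "\<bar>(\<integral>w. ?k s w \<partial>N (t - s)) - (\<integral>w. ?k s w \<partial>N' (t - s))\<bar> \<le> S * ?\<Lambda>"
      using total_rate_pos by (simp add: abs_divide divide_le_eq)
    then have "(\<integral>w. ?k s w \<partial>N' (t - s)) - (\<integral>w. ?k s w \<partial>N (t - s)) - S * ?\<Lambda> \<le> 0" by linarith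
    then have "exp (- ?\<Lambda> * s) * ((\<integral>w. ?k s w \<partial>N' (t - s)) - (\<integral>w. ?k s w \<partial>N (t - s)) - S * ?\<Lambda>) \<le> 0"
      by (intro mult_nonneg_nonpos) auto
    then show "?F' s \<le> 0" by (simp add: algebra_simps)
  qed (rule t)
  then have "S * exp (- ?\<Lambda> * t) \<le> (\<integral>w. f w \<partial>N t) - (\<integral>w. f w \<partial>N' t) + S"
    by (simp add: eq0)
  moreover have "S * exp (- ?\<Lambda> * \<tau>) \<le> S * exp (- ?\<Lambda> * t)"
    using S0 t total_rate_pos by (intro mult_left_mono) auto
  ultimately show ?thesis by (simp add: algebra_simps)
qed

text \<open>
  The supremum \<open>S\<close> of the differences over times up to \<open>\<tau>\<close> satisfies
  \<open>S \<le> S (1 - exp (- \<Lambda> \<tau>))\<close>, so it is \<open>0\<close>.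
\<close>

lemma forward_solution_unique:
  assumes N: "forward_solution N" and N': "forward_solution N'" and eq0: "N 0 = N' 0"
    and f: "state_continuous f" and \<tau>: "0 \<le> \<tau>"
  shows "(\<integral>w. f w \<partial>N \<tau>) = (\<integral>w. f w \<partial>N' \<tau>)"
proof -
  define X where "X = {\<bar>(\<integral>w. k w \<partial>N u) - (\<integral>w. k w \<partial>N' u)\<bar> | k u. state_continuous k \<and>
      (\<forall>x. \<forall>y\<in>sphere 0 1. \<bar>k (x, y)\<bar> \<le> 1) \<and> 0 \<le> u \<and> u \<le> \<tau>}"
  define S where "S = Sup X"
  have "0 \<in> X" unfolding X_def
    by (intro CollectI exI[of _ "\<lambda>_. 0"] exI[of _ 0]) (simp add: \<tau>)
  have X2: "v \<le> 2" if vX: "v \<in> X" for v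
  proof -
    obtain k u where k': "state_continuous k \<and> (\<forall>x. \<forall>y\<in>sphere 0 1. \<bar>k (x, y)\<bar> \<le> 1) \<and> 0 \<le> u"
      and v: "v = \<bar>(\<integral>w. k w \<partial>N u) - (\<integral>w. k w \<partial>N' u)\<bar>"
      using vX unfolding X_def by blast
    then have k: "state_continuous k" "y \<in> sphere 0 1 \<Longrightarrow> \<bar>k (x, y)\<bar> \<le> 1" "0 \<le> u" for x y by simp_all
    have "\<bar>\<integral>w. k w \<partial>N u\<bar> \<le> 1" "\<bar>\<integral>w. k w \<partial>N' u\<bar> \<le> 1"
      by (intro state_continuous_integral_bound[OF k(1)] forward_solution_prob[OF N] forward_solution_prob[OF N'] k; assumption)+
    then show ?thesis unfolding v by linarith
  qed
  then have bdd: "bdd_above X" by (rule bdd_aboveI)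
  have SX: "\<bar>(\<integral>w. k w \<partial>N u) - (\<integral>w. k w \<partial>N' u)\<bar> \<le> S"
    if "state_continuous k" "\<And>x y. y \<in> sphere 0 1 \<Longrightarrow> \<bar>k (x, y)\<bar> \<le> 1" "0 \<le> u" "u \<le> \<tau>" for k u
  proof -
    have "\<bar>(\<integral>w. k w \<partial>N u) - (\<integral>w. k w \<partial>N' u)\<bar> \<in> X" unfolding X_def using that by blast
    then show ?thesis unfolding S_def using bdd by (rule cSup_upper)
  qed
  have S0: "0 \<le> S" unfolding S_def by (rule cSup_upper[OF \<open>0 \<in> X\<close> bdd])
  let ?q = "1 - exp (- total_rate * \<tau>)"
  have "v \<le> S * ?q" if vX: "v \<in> X" for v
  proof (rule field_le_epsilon)
    fix e :: real assume e: "e > 0"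
    obtain k u where k': "state_continuous k \<and> (\<forall>x. \<forall>y\<in>sphere 0 1. \<bar>k (x, y)\<bar> \<le> 1)" and u: "0 \<le> u" "u \<le> \<tau>"
      and v: "v = \<bar>(\<integral>w. k w \<partial>N u) - (\<integral>w. k w \<partial>N' u)\<bar>"
      using vX unfolding X_def by blast
    then have k: "state_continuous k" "y \<in> sphere 0 1 \<Longrightarrow> \<bar>k (x, y)\<bar> \<le> 1" for x y by simp_all
    have "\<And>x y. y \<in> sphere 0 1 \<Longrightarrow> - 1 \<le> k (x, y) \<and> k (x, y) \<le> 1"
      using k(2) by (simp add: abs_le_iff minus_le_iff)
    from test_functions_dense[OF k(1) _ this, of "e / 2"] e obtain g where g: "vj_test_function g"
      and g1: "\<And>x y. y \<in> sphere 0 1 \<Longrightarrow> - 1 \<le> g (x, y) \<and> g (x, y) \<le> 1"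
      and gk: "\<And>x y. y \<in> sphere 0 1 \<Longrightarrow> \<bar>g (x, y) - k (x, y)\<bar> \<le> e / 2" by auto
    have g1': "\<And>x y. y \<in> sphere 0 1 \<Longrightarrow> \<bar>g (x, y)\<bar> \<le> 1" using g1 by (simp add: abs_le_iff minus_le_iff)
    have "(\<integral>w. g w \<partial>N' u) - (\<integral>w. g w \<partial>N u) \<le> S * ?q"
      by (rule forward_solution_difference_bound[OF N N' eq0 g g1' u SX])
    moreover have "(\<integral>w. g w \<partial>N u) - (\<integral>w. g w \<partial>N' u) \<le> S * ?q"
      by (rule forward_solution_difference_bound[OF N' N eq0[symmetric] g g1' u])
        (use SX in \<open>simp_all add: abs_minus_commute\<close>)
    moreover have "\<bar>(\<integral>w. g w \<partial>N u) - (\<integral>w. k w \<partial>N u)\<bar> \<le> e / 2"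
      by (rule integral_close[OF forward_solution_prob[OF N u(1)] k(1) test_imp_state_continuous[OF g] gk])
    moreover have "\<bar>(\<integral>w. g w \<partial>N' u) - (\<integral>w. k w \<partial>N' u)\<bar> \<le> e / 2"
      by (rule integral_close[OF forward_solution_prob[OF N' u(1)] k(1) test_imp_state_continuous[OF g] gk])
    ultimately show "v \<le> S * ?q + e" unfolding v by linarith
  qed
  then have "S \<le> S * ?q"
    unfolding S_def using \<open>0 \<in> X\<close> by (intro cSup_least) (auto simp: S_def)
  then have "S * exp (- total_rate * \<tau>) \<le> 0" by (simp add: algebra_simps)
  then have Sz: "S = 0" using S0 by (simp add: mult_le_0_iff)
  obtain C where C0: "0 < C" and C: "\<And>x y. y \<in> sphere 0 1 \<Longrightarrow> \<bar>f (x, y)\<bar> \<le> C"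
    using state_continuous_bounded[OF f] by blast
  have "\<bar>(\<integral>w. f w * (1 / C) \<partial>N \<tau>) - (\<integral>w. f w * (1 / C) \<partial>N' \<tau>)\<bar> \<le> S"
    using C C0 \<tau> by (intro SX state_continuous_mult f state_continuous_const) (auto simp: abs_mult)
  then show ?thesis using C0 by (simp add: Sz)
qed

text \<open>
  The contribution of paths without any jump up to time \<open>t\<close>.
\<close>

lemma forward_solution_lower_bound_transport:
  assumes N: "forward_solution N" and f: "state_continuous f"
    and nn: "\<And>x y. y \<in> sphere 0 1 \<Longrightarrow> 0 \<le> f (x, y)" and t: "0 \<le> t"
  shows "exp (- total_rate * t) * (\<integral>w. transport t f w \<partial>N 0) \<le> (\<integral>w. f w \<partial>N t)"
proof (rule field_le_epsilon)
  fix e :: real assume e: "e > 0"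
  let ?\<Lambda> = total_rate
  from test_functions_dense_nonneg[OF f nn, of "e / 2"] e obtain g where g: "vj_test_function g"
    and g0: "\<And>x y. y \<in> sphere 0 1 \<Longrightarrow> 0 \<le> g (x, y)"
    and gf: "\<And>x y. y \<in> sphere 0 1 \<Longrightarrow> \<bar>g (x, y) - f (x, y)\<bar> \<le> e / 2" by auto
  note gc = test_imp_state_continuous[OF g]
  have "exp (- ?\<Lambda> * t) * (\<integral>w. transport t g w \<partial>N (t - t)) \<le> exp (- ?\<Lambda> * 0) * (\<integral>w. transport 0 g w \<partial>N (t - 0))"
  proof (rule le_of_nonpos_derivative_within[OF t forward_solution_weighted_derivative[OF N g]])
    fix s assume s: "s \<in> {0..t}"
    have tc: "state_continuous (transport s g)" by (rule state_continuous_transport[OF gc])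
    have pr: "N (t - s) \<in> space (prob_algebra state_space)"
      using s by (intro forward_solution_prob[OF N]) simp
    have "0 \<le> jump_part (transport s g) (x, y) + ?\<Lambda> * transport s g (x, y)" if y: "y \<in> sphere 0 1" for x y
    proof -
      have "0 \<le> r * resample (transport s g) (x, y)"
        using r_pos g0 by (intro mult_nonneg_nonneg resample_bounds(1)[OF tc]) (auto simp: transport_apply)
      also have "\<dots> \<le> jump_part (transport s g) (x, y) + ?\<Lambda> * transport s g (x, y)"
        using g0 by (intro jump_part_lower_bound[OF tc _ y]) (simp add: transport_apply)
      finally show ?thesis .
    qed
    then have "(\<integral>w. 0 \<partial>N (t - s)) \<le> (\<integral>w. jump_part (transport s g) w + ?\<Lambda> * transport s g w \<partial>N (t - s))"
      by (intro integral_mono_state[OF pr] state_continuous_add state_continuous_mult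
        state_continuous_jump_part tc state_continuous_const)
    then show "- (exp (- ?\<Lambda> * s) * (\<integral>w. jump_part (transport s g) w + ?\<Lambda> * transport s g w \<partial>N (t - s))) \<le> 0"
      by simp
  qed
  then have main: "exp (- ?\<Lambda> * t) * (\<integral>w. transport t g w \<partial>N 0) \<le> (\<integral>w. g w \<partial>N t)" by simp
  have "\<bar>(\<integral>w. transport t g w \<partial>N 0) - (\<integral>w. transport t f w \<partial>N 0)\<bar> \<le> e / 2"
    using gf by (intro integral_close forward_solution_prob[OF N] state_continuous_transport f gc)
      (simp_all add: transport_apply)
  then have "(\<integral>w. transport t f w \<partial>N 0) - (\<integral>w. transport t g w \<partial>N 0) \<le> e / 2" by linarith
  then have "exp (- ?\<Lambda> * t) * ((\<integral>w. transport t f w \<partial>N 0) - (\<integral>w. transport t g w \<partial>N 0)) \<le> exp (- ?\<Lambda> * t) * (e / 2)"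
    by (intro mult_left_mono) auto
  moreover have "exp (- ?\<Lambda> * t) * (e / 2) \<le> 1 * (e / 2)"
    using t total_rate_pos e by (intro mult_right_mono) auto
  moreover have "\<bar>(\<integral>w. g w \<partial>N t) - (\<integral>w. f w \<partial>N t)\<bar> \<le> e / 2"
    by (rule integral_close[OF forward_solution_prob[OF N t] f gc gf])
  ultimately show "exp (- ?\<Lambda> * t) * (\<integral>w. transport t f w \<partial>N 0) \<le> (\<integral>w. f w \<partial>N t) + e"
    using main unfolding right_diff_distrib by linarith
qed

end

section \<open>Minorization for solutions of the forward equation\<close>

text \<open>
  The uniform measure on the product of torus and sphere, with respect to which the process is
  minorized.
\<close>

definition base_measure :: "((real ^ 'n) \<times> (real ^ 'n)) measure" where
  "base_measure = restrict_space lborel torus \<Otimes>\<^sub>M uniform_sphere"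

lemma prob_space_torus: "prob_space (restrict_space lborel (torus :: (real ^ 'n) set))"
  by (rule prob_spaceI) (simp add: space_restrict_space emeasure_restrict_space emeasure_torus)

lemma base_measure_prob: "base_measure \<in> space (prob_algebra state_space)"
proof -
  have "sets base_measure = sets state_space"
    unfolding base_measure_def state_space_def
    by (intro sets_pair_measure_cong sets_uniform_sphere sets_restrict_space_cong) simp
  then show ?thesis
    using prob_space_pair[OF prob_space_torus prob_space_uniform_sphere]
    by (simp add: space_prob_algebra base_measure_def)
qed

lemma integral_base_measure:
  fixes h :: "(real ^ 'n) \<times> (real ^ 'n) \<Rightarrow> real"
  assumes h: "state_continuous h"
  shows "(\<integral>w. h w \<partial>base_measure) = (\<integral>x. resample h (x, y0) \<partial>restrict_space lborel torus)"
proof -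
  interpret T: prob_space "restrict_space lborel (torus :: (real ^ 'n) set)" by (rule prob_space_torus)
  interpret S: prob_space "uniform_sphere :: (real ^ 'n) measure" by (rule prob_space_uniform_sphere)
  interpret pair_prob_space "restrict_space lborel (torus :: (real ^ 'n) set)" "uniform_sphere :: (real ^ 'n) measure" ..
  have "integrable (restrict_space lborel torus \<Otimes>\<^sub>M uniform_sphere) h"
    using state_continuous_integrable[OF h base_measure_prob] by (simp add: base_measure_def)
  from integral_fst'[OF this] show ?thesis
    by (simp add: base_measure_def resample_apply)
qed

lemma integral_base_measure_swap:
  fixes h :: "(real ^ 'n) \<times> (real ^ 'n) \<Rightarrow> real"
  assumes h: "state_continuous h"
  shows "(\<integral>w. h w \<partial>base_measure) = (\<integral>y. (\<integral>x. h (x, y) \<partial>restrict_space lborel torus) \<partial>uniform_sphere)"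
proof -
  interpret T: prob_space "restrict_space lborel (torus :: (real ^ 'n) set)" by (rule prob_space_torus)
  interpret S: prob_space "uniform_sphere :: (real ^ 'n) measure" by (rule prob_space_uniform_sphere)
  interpret pair_prob_space "restrict_space lborel (torus :: (real ^ 'n) set)" "uniform_sphere :: (real ^ 'n) measure" ..
  have "integrable (restrict_space lborel torus \<Otimes>\<^sub>M uniform_sphere) (case_prod (\<lambda>x y. h (x, y)))"
    using state_continuous_integrable[OF h base_measure_prob] by (simp add: base_measure_def)
  from integral_snd[OF this] show ?thesis by (simp add: base_measure_def)
qed

lemma integral_torus_translate:
  fixes k :: "real ^ 'n \<Rightarrow> real"
  assumes k [measurable]: "k \<in> borel_measurable borel" and per: "periodic k" and C: "\<And>x. \<bar>k x\<bar> \<le> C"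
  shows "(\<integral>x. k (v + x) \<partial>restrict_space lborel torus) = (\<integral>x. k x \<partial>restrict_space lborel torus)"
proof -
  let ?T = "restrict_space lborel (torus :: (real ^ 'n) set)"
  interpret T: prob_space ?T by (rule prob_space_torus)
  have m: "(\<lambda>x. g (c + x)) \<in> borel_measurable ?T" if "g \<in> borel_measurable borel" for g :: "real ^ 'n \<Rightarrow> real" and c
  proof -
    have "(\<lambda>x. g (c + x)) \<in> borel_measurable borel" using that by measurable
    then show ?thesis by (intro measurable_restrict_space1) simp
  qed
  have int: "integrable ?T (\<lambda>x. k (c + x))" for c
    using C m[OF k] by (intro T.integrable_const_bound[where B = C]) auto
  have nn: "(\<integral>x. k (c + x) + C \<partial>?T) = enn2real (\<integral>\<^sup>+x. ennreal (k (c + x) + C) * indicator torus x \<partial>lborel)" for c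
  proof -
    have "(\<integral>x. k (c + x) + C \<partial>?T) = enn2real (\<integral>\<^sup>+x. ennreal (k (c + x) + C) \<partial>?T)"
    proof (rule integral_eq_nn_integral)
      show "(\<lambda>x. k (c + x) + C) \<in> borel_measurable ?T" using m[OF k] by (intro borel_measurable_add) auto
      show "AE x in ?T. 0 \<le> k (c + x) + C"
      proof (rule AE_I2)
        show "0 \<le> k (c + x) + C" for x using C[of "c + x"] by linarith
      qed
    qed
    then show ?thesis by (simp add: nn_integral_restrict_space)
  qed
  \<comment> \<open>Adding \<open>C\<close> reduces the claim to nonnegative functions.\<close>
  have per': "periodic (\<lambda>x. ennreal (k x + C))" using per unfolding periodic_def by metis
  have "(\<integral>\<^sup>+x. ennreal (k (v + x) + C) * indicator torus x \<partial>lborel) = (\<integral>\<^sup>+x. ennreal (k (0 + x) + C) * indicator torus x \<partial>lborel)"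
    using nn_integral_torus_translate[OF _ per', of v] by simp
  then have "(\<integral>x. k (v + x) + C \<partial>?T) = (\<integral>x. k (0 + x) + C \<partial>?T)"
    by (simp only: nn)
  then show ?thesis using int[of v] int[of 0] by simp
qed

lemma integral_transport_base_measure:
  fixes h :: "(real ^ 'n) \<times> (real ^ 'n) \<Rightarrow> real"
  assumes h: "state_continuous h"
  shows "(\<integral>w. transport s h w \<partial>base_measure) = (\<integral>w. h w \<partial>base_measure)"
  unfolding integral_base_measure_swap[OF h] integral_base_measure_swap[OF state_continuous_transport[OF h]]
proof (rule Bochner_Integration.integral_cong[OF refl])
  fix y :: "real ^ 'n" assume "y \<in> space uniform_sphere"
  then have y: "y \<in> sphere 0 1" by (simp add: space_uniform_sphere)
  obtain C where "0 < C" and C: "\<And>x y. y \<in> sphere 0 1 \<Longrightarrow> \<bar>h (x, y)\<bar> \<le> C"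
    using state_continuous_bounded[OF h] by blast
  have "(\<lambda>x. h (x, y)) \<in> borel_measurable borel"
    by (intro borel_measurable_continuous_onI state_continuous_section[OF h y] continuous_intros)
  moreover have "periodic (\<lambda>x. h (x, y))" using h y by (simp add: state_continuous_def)
  ultimately have "(\<integral>x. h (s *\<^sub>R y + x, y) \<partial>restrict_space lborel torus) = (\<integral>x. h (x, y) \<partial>restrict_space lborel torus)"
    using C[OF y] by (rule integral_torus_translate[where k = "\<lambda>x. h (x, y)"])
  then show "(\<integral>x. transport s h (x, y) \<partial>restrict_space lborel torus) = (\<integral>x. h (x, y) \<partial>restrict_space lborel torus)"
    by (simp add: transport_apply add.commute)
qed

lemma continuous_on_two_leg_average:
  fixes f :: "(real ^ 'n) \<times> (real ^ 'n) \<Rightarrow> real"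
  assumes f: "state_continuous f" and y: "y \<in> sphere 0 1"
  shows "continuous_on A (\<lambda>s. resample (transport s f) (x + (\<tau> - s) *\<^sub>R y, y))"
  unfolding continuous_on_iff
proof (intro ballI allI impI)
  fix s e :: real assume e: "e > 0"
  then have "e / 2 > 0" by simp
  from state_continuous_uniformD[OF f this]
  obtain d where d: "d > 0" "\<And>x x' y y'. y \<in> sphere 0 1 \<Longrightarrow> y' \<in> sphere 0 1 \<Longrightarrow>
      norm (x' - x) + norm (y' - y) < d \<Longrightarrow> \<bar>f (x', y') - f (x, y)\<bar> < e / 2" by blast
  have "dist (resample (transport s' f) (x + (\<tau> - s') *\<^sub>R y, y)) (resample (transport s f) (x + (\<tau> - s) *\<^sub>R y, y)) < e"
    if s': "dist s' s < d / 2" for s'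
  proof -
    have "\<bar>transport s' f (x + (\<tau> - s') *\<^sub>R y, z) - transport s f (x + (\<tau> - s) *\<^sub>R y, z)\<bar> \<le> e / 2"
      if z: "z \<in> sphere 0 1" for z
    proof -
      have "(x + (\<tau> - s') *\<^sub>R y + s' *\<^sub>R z) - (x + (\<tau> - s) *\<^sub>R y + s *\<^sub>R z) = (s' - s) *\<^sub>R (z - y)"
        by (simp add: algebra_simps)
      also have "norm \<dots> \<le> \<bar>s' - s\<bar> * 2"
        using norm_triangle_ineq4[of z y] y z by (simp add: mult_left_mono)
      also have "\<dots> < d" using s' by (simp add: dist_real_def)
      finally show ?thesis
        using d(2)[OF z z, of "x + (\<tau> - s') *\<^sub>R y + s' *\<^sub>R z" "x + (\<tau> - s) *\<^sub>R y + s *\<^sub>R z"]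
        by (simp add: transport_apply less_imp_le)
    qed
    from resample_diff_bound[OF state_continuous_transport[OF f] state_continuous_transport[OF f] this]
    have "\<bar>resample (transport s' f) (x + (\<tau> - s') *\<^sub>R y, y) - resample (transport s f) (x + (\<tau> - s) *\<^sub>R y, y)\<bar> \<le> e / 2"
      by blast
    then show ?thesis using e by (simp add: dist_real_def)
  qed
  then show "\<exists>d>0. \<forall>s'\<in>A. dist s' s < d \<longrightarrow>
      dist (resample (transport s' f) (x + (\<tau> - s') *\<^sub>R y, y)) (resample (transport s f) (x + (\<tau> - s) *\<^sub>R y, y)) < e"
    using d(1) by (intro exI[of _ "d / 2"]) auto
qed

text \<open>
  The constant of \<open>two_leg_flight_lower_bound\<close>.
\<close>

definition minor_const :: "'n::finite itself \<Rightarrow> real" where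
  "minor_const _ = sqrt (real CARD('n)) / 24 /
     (fact CARD('n) * (6 * sqrt (real CARD('n))) ^ CARD('n) * measure lborel (ball 0 1 :: (real ^ 'n) set))"

lemma minor_const_pos: "minor_const TYPE('n::finite) > 0"
  unfolding minor_const_def using measure_unit_ball_pos[where 'n = 'n]
  by (intro divide_pos_pos mult_pos_pos zero_less_power) auto

text \<open>
  The second leg is followed by another resampling, so that the function to be averaged
  depends on the position only.
\<close>

lemma two_leg_average_lower_bound:
  fixes h :: "(real ^ 'n) \<times> (real ^ 'n) \<Rightarrow> real"
  assumes h: "state_continuous h" and nn: "\<And>x y. y \<in> sphere 0 1 \<Longrightarrow> 0 \<le> h (x, y)"
    and y: "y \<in> sphere 0 1"
    and \<tau>: "3 / 4 * sqrt (real CARD('n)) \<le> \<tau>" "\<tau> \<le> sqrt (real CARD('n))"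
  shows "minor_const TYPE('n) * (\<integral>w. h w \<partial>base_measure)
    \<le> integral {0..\<tau>} (\<lambda>s. resample (transport s (resample h)) (x + (\<tau> - s) *\<^sub>R y, y))"
proof -
  define K where "K p = resample h (p, y)" for p
  note rc = state_continuous_resample[OF h]
  have rK: "resample h (p, z) = K p" for p z by (simp add: K_def resample_apply)
  have K0: "0 \<le> K p" for p unfolding K_def by (rule resample_bounds(1)[OF h nn])
  have Km [measurable]: "K \<in> borel_measurable borel"
    unfolding K_def[abs_def] by (intro borel_measurable_continuous_onI state_continuous_section[OF rc y] continuous_intros)
  have Kper: "periodic (\<lambda>p. ennreal (K p))"
    using rc y unfolding state_continuous_def periodic_def K_def by metis
  obtain C where "0 < C" and C': "\<And>x y. y \<in> sphere 0 1 \<Longrightarrow> \<bar>resample h (x, y)\<bar> \<le> C"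
    using state_continuous_bounded[OF rc] by blast
  have C: "\<bar>K p\<bar> \<le> C" for p using C'[OF y] by (simp add: K_def)
  let ?q = "\<lambda>s. resample (transport s (resample h)) (x + (\<tau> - s) *\<^sub>R y, y)"
  have q: "(\<integral>\<^sup>+z. ennreal (K (x + (\<tau> - s) *\<^sub>R y + s *\<^sub>R z)) \<partial>uniform_sphere) = ennreal (?q s)" for s
  proof -
    have "integrable uniform_sphere (\<lambda>z. transport s (resample h) (x + (\<tau> - s) *\<^sub>R y, z))"
      by (rule state_continuous_integrable_sphere[OF state_continuous_transport[OF rc]])
    then have "integrable uniform_sphere (\<lambda>z. K (x + (\<tau> - s) *\<^sub>R y + s *\<^sub>R z))"
      by (simp add: transport_apply rK)
    then show ?thesis
      using K0 by (simp add: nn_integral_eq_integral resample_apply[of "transport s (resample h)"] transport_apply rK)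
  qed
  have q0: "0 \<le> ?q s" for s
    by (rule resample_bounds(1)[OF state_continuous_transport[OF rc]]) (simp add: transport_apply rK K0)
  have qi: "(?q has_integral integral {0..\<tau>} ?q) {0..\<tau>}"
    by (intro integrable_integral integrable_continuous_interval continuous_on_two_leg_average[OF rc y])
  interpret T: prob_space "restrict_space lborel (torus :: (real ^ 'n) set)" by (rule prob_space_torus)
  have Ki: "integrable (restrict_space lborel torus) K"
    by (rule T.integrable_const_bound[where B = C]) (use C in \<open>auto intro!: measurable_restrict_space1\<close>)
  have b: "(\<integral>\<^sup>+p. ennreal (K p) * indicator torus p \<partial>lborel) = ennreal (\<integral>w. h w \<partial>base_measure)"
  proof -
    have "(\<integral>\<^sup>+p. ennreal (K p) * indicator torus p \<partial>lborel) = (\<integral>\<^sup>+p. ennreal (K p) \<partial>restrict_space lborel torus)"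
      by (simp add: nn_integral_restrict_space)
    also have "\<dots> = ennreal (\<integral>p. K p \<partial>restrict_space lborel torus)"
      using K0 by (intro nn_integral_eq_integral Ki) auto
    finally show ?thesis by (simp add: integral_base_measure[OF h, of y] K_def)
  qed
  have b0: "0 \<le> (\<integral>w. h w \<partial>base_measure)"
    unfolding integral_base_measure[OF h, of y] using K0 by (intro integral_nonneg_AE) (simp add: K_def)
  have "ennreal (minor_const TYPE('n)) * (\<integral>\<^sup>+p. ennreal (K p) * indicator torus p \<partial>lborel)
    \<le> (\<integral>\<^sup>+s. (\<integral>\<^sup>+z. ennreal (K (x + (\<tau> - s) *\<^sub>R y + s *\<^sub>R z)) \<partial>uniform_sphere) * indicator {0..\<tau>} s \<partial>lborel)"
    unfolding minor_const_def using y \<tau> Kper by (intro two_leg_flight_lower_bound) auto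
  also have "\<dots> = ennreal (integral {0..\<tau>} ?q)"
    unfolding q using q0 qi by (rule nn_integral_has_integral_lebesgue')
  finally have "ennreal (minor_const TYPE('n) * (\<integral>w. h w \<partial>base_measure)) \<le> ennreal (integral {0..\<tau>} ?q)"
    unfolding b using minor_const_pos[where 'n = 'n] b0 by (simp add: ennreal_mult)
  moreover have "0 \<le> integral {0..\<tau>} ?q" using q0 by (intro integral_nonneg has_integral_integrable[OF qi]) auto
  ultimately show ?thesis by (simp add: ennreal_le_iff)
qed

context velocity_jump
begin

lemma integral_return_state:
  assumes "state_continuous g" "x \<in> torus" "y \<in> sphere 0 1"
  shows "(\<integral>w. g w \<partial>return state_space (x, y)) = g (x, y)"
  using state_continuous_measurable[OF assms(1)] assms(2,3)
  by (intro integral_return) (simp_all add: space_state_space)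

text \<open>
  The contribution of paths whose only jump up to time \<open>\<tau>\<close> is a resampling, at time \<open>\<tau> - s\<close>.
\<close>

lemma forward_solution_one_resampling:
  assumes N: "forward_solution N" and N0: "N 0 = return state_space (x, y)"
    and xy: "x \<in> torus" "y \<in> sphere 0 1"
    and f: "state_continuous f" and nn: "\<And>x y. y \<in> sphere 0 1 \<Longrightarrow> 0 \<le> f (x, y)" and \<tau>: "0 \<le> \<tau>"
  shows "r * exp (- total_rate * \<tau>) * integral {0..\<tau>} (\<lambda>s. resample (transport s f) (x + (\<tau> - s) *\<^sub>R y, y))
    \<le> (\<integral>w. f w \<partial>N \<tau>)"
proof (rule field_le_epsilon)
  let ?\<Lambda> = total_rate
  let ?q = "\<lambda>f s. resample (transport s f) (x + (\<tau> - s) *\<^sub>R y, y)"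
  let ?c = "r * exp (- ?\<Lambda> * \<tau>)"
  have c0: "0 \<le> ?c" using r_pos by simp
  have test: "?c * integral {0..\<tau>} (?q g) \<le> (\<integral>w. g w \<partial>N \<tau>)"
    if g: "vj_test_function g" and g0: "\<And>x y. y \<in> sphere 0 1 \<Longrightarrow> 0 \<le> g (x, y)" for g
  proof -
    note gc = test_imp_state_continuous[OF g]
    have tc: "state_continuous (transport s g)" for s by (rule state_continuous_transport[OF gc])
    let ?k = "\<lambda>s w. jump_part (transport s g) w + ?\<Lambda> * transport s g w"
    let ?F = "\<lambda>u. exp (- ?\<Lambda> * u) * (\<integral>w. transport u g w \<partial>N (\<tau> - u)) + ?c * integral {0..u} (?q g)"
    let ?F' = "\<lambda>s. - (exp (- ?\<Lambda> * s) * (\<integral>w. ?k s w \<partial>N (\<tau> - s))) + ?c * ?q g s"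
    have "?F \<tau> \<le> ?F 0"
    proof (rule le_of_nonpos_derivative_within[where F = ?F and F' = ?F', OF \<tau>])
      fix s assume s: "s \<in> {0..\<tau>}"
      have pr: "N (\<tau> - s) \<in> space (prob_algebra state_space)"
        using s by (intro forward_solution_prob[OF N]) simp
      show "(?F has_real_derivative ?F' s) (at s within {0..\<tau>})"
        by (intro DERIV_add forward_solution_weighted_derivative[OF N g s] DERIV_cmult
          integral_has_real_derivative continuous_on_two_leg_average gc xy s)
      note Rc = state_continuous_resample[OF tc]
      have R0: "0 \<le> resample (transport s g) (x, y)" for x y
        using g0 by (intro resample_bounds(1)[OF tc]) (simp add: transport_apply)
      have "exp (- ?\<Lambda> * (\<tau> - s)) * ?q g s = exp (- ?\<Lambda> * (\<tau> - s)) * (\<integral>w. transport (\<tau> - s) (resample (transport s g)) w \<partial>N 0)"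
        unfolding N0 integral_return_state[OF state_continuous_transport[OF Rc] xy] by (simp add: transport_apply)
      also have "\<dots> \<le> (\<integral>w. resample (transport s g) w \<partial>N (\<tau> - s))"
        using R0 s by (intro forward_solution_lower_bound_transport[OF N Rc]) auto
      finally have "r * (exp (- ?\<Lambda> * (\<tau> - s)) * ?q g s) \<le> r * (\<integral>w. resample (transport s g) w \<partial>N (\<tau> - s))"
        using r_pos by (intro mult_left_mono) auto
      also have "\<dots> = (\<integral>w. r * resample (transport s g) w \<partial>N (\<tau> - s))" by simp
      also have "\<dots> \<le> (\<integral>w. ?k s w \<partial>N (\<tau> - s))"
        using g0 by (intro integral_mono_state[OF pr] state_continuous_add state_continuous_mult
          state_continuous_jump_part tc Rc state_continuous_const jump_part_lower_bound) (simp_all add: transport_apply)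
      finally have "exp (- ?\<Lambda> * s) * (r * (exp (- ?\<Lambda> * (\<tau> - s)) * ?q g s)) \<le> exp (- ?\<Lambda> * s) * (\<integral>w. ?k s w \<partial>N (\<tau> - s))"
        by (intro mult_left_mono) auto
      moreover have "exp (- ?\<Lambda> * s) * (r * (exp (- ?\<Lambda> * (\<tau> - s)) * ?q g s)) = ?c * ?q g s"
        by (simp add: mult.assoc[symmetric] mult.commute[of "exp (- ?\<Lambda> * s)"] exp_add[symmetric])
          (simp add: mult.assoc exp_add[symmetric] algebra_simps)
      ultimately show "?F' s \<le> 0" by linarith
    qed
    moreover have "0 \<le> exp (- ?\<Lambda> * \<tau>) * (\<integral>w. transport \<tau> g w \<partial>N (\<tau> - \<tau>))"
      unfolding diff_self N0 integral_return_state[OF tc xy] using g0 xy by (simp add: transport_apply)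
    ultimately show ?thesis by simp
  qed
  fix e :: real assume e: "e > 0"
  define d where "d = e / (1 + ?c * \<tau>)"
  have d: "0 < d" "d * (1 + ?c * \<tau>) = e"
  proof -
    have "0 < 1 + ?c * \<tau>" using mult_nonneg_nonneg[OF c0 \<tau>] by linarith
    then show "0 < d" "d * (1 + ?c * \<tau>) = e" using e by (simp_all add: d_def)
  qed
  from test_functions_dense_nonneg[OF f nn d(1)] obtain g where g: "vj_test_function g"
    and g0: "\<And>x y. y \<in> sphere 0 1 \<Longrightarrow> 0 \<le> g (x, y)"
    and gf: "\<And>x y. y \<in> sphere 0 1 \<Longrightarrow> \<bar>g (x, y) - f (x, y)\<bar> \<le> d" by auto
  note gc = test_imp_state_continuous[OF g]
  have "integral {0..\<tau>} (?q f) \<le> integral {0..\<tau>} (\<lambda>s. ?q g s + d)"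
  proof (rule integral_le)
    show "?q f integrable_on {0..\<tau>}" "(\<lambda>s. ?q g s + d) integrable_on {0..\<tau>}"
      by (intro integrable_continuous_interval continuous_intros continuous_on_two_leg_average f gc xy)+
    fix s
    have "\<bar>?q g s - ?q f s\<bar> \<le> d"
      using gf by (intro resample_diff_bound state_continuous_transport f gc) (simp add: transport_apply)
    then show "?q f s \<le> ?q g s + d" by linarith
  qed
  also have "\<dots> = integral {0..\<tau>} (?q g) + \<tau> * d"
    using \<tau> by (subst Henstock_Kurzweil_Integration.integral_add)
      (auto intro!: integrable_continuous_interval continuous_on_two_leg_average gc xy)
  finally have "?c * integral {0..\<tau>} (?q f) \<le> ?c * (integral {0..\<tau>} (?q g) + \<tau> * d)"
    using c0 by (rule mult_left_mono)
  also have "\<dots> = ?c * integral {0..\<tau>} (?q g) + ?c * \<tau> * d" by (simp add: algebra_simps)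
  also have "?c * integral {0..\<tau>} (?q g) \<le> (\<integral>w. g w \<partial>N \<tau>)" by (rule test[OF g g0])
  also have "(\<integral>w. g w \<partial>N \<tau>) \<le> (\<integral>w. f w \<partial>N \<tau>) + d"
    using integral_close[OF forward_solution_prob[OF N \<tau>] f gc gf] by linarith
  finally show "?c * integral {0..\<tau>} (?q f) \<le> (\<integral>w. f w \<partial>N \<tau>) + e"
    unfolding d(2)[symmetric] by (simp add: algebra_simps)
qed

text \<open>
  The contribution of paths with exactly two resamplings up to time \<open>L\<close>, the last one at time
  \<open>L - s\<close> with \<open>s \<le> L / 4\<close>. This leaves a time between \<open>3 L / 4\<close> and \<open>L\<close> for the flight up to
  then, which makes the position uniform; the last flight preserves the uniform measure.
\<close>

lemma forward_solution_minorization: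
  defines "L \<equiv> sqrt (real CARD('n))"
  assumes N: "forward_solution N" and N0: "N 0 = return state_space (x, y)"
    and xy: "x \<in> torus" "y \<in> sphere 0 1"
    and f: "vj_test_function f" and nn: "\<And>x y. y \<in> sphere 0 1 \<Longrightarrow> 0 \<le> f (x, y)"
  shows "r\<^sup>2 * minor_const TYPE('n) * (L / 4) * exp (- total_rate * L) * (\<integral>w. f w \<partial>base_measure)
    \<le> (\<integral>w. f w \<partial>N L)"
proof -
  have L: "L > 0" by (simp add: L_def)
  let ?\<Lambda> = total_rate
  let ?c = "r\<^sup>2 * minor_const TYPE('n) * exp (- ?\<Lambda> * L) * (\<integral>w. f w \<partial>base_measure)"
  note fc = test_imp_state_continuous[OF f]
  have tc: "state_continuous (transport s f)" for s by (rule state_continuous_transport[OF fc])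
  let ?k = "\<lambda>s w. jump_part (transport s f) w + ?\<Lambda> * transport s f w"
  \<comment> \<open>The term \<open>?c * u\<close> collects, per unit of time, the contribution of a last resampling at \<open>L - u\<close>.\<close>
  let ?F = "\<lambda>u. exp (- ?\<Lambda> * u) * (\<integral>w. transport u f w \<partial>N (L - u)) + ?c * u"
  let ?F' = "\<lambda>s. - (exp (- ?\<Lambda> * s) * (\<integral>w. ?k s w \<partial>N (L - s))) + ?c * 1"
  have "?F (L / 4) \<le> ?F 0"
  proof (rule le_of_nonpos_derivative_within[where F = ?F and F' = ?F'])
    fix s assume s: "s \<in> {0..L / 4}"
    then have sL: "s \<in> {0..L}" using L by auto
    have pr: "N (L - s) \<in> space (prob_algebra state_space)"
      using sL by (intro forward_solution_prob[OF N]) simp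
    have "(?F has_real_derivative ?F' s) (at s within {0..L})"
      by (intro DERIV_add forward_solution_weighted_derivative[OF N f sL] DERIV_cmult DERIV_ident)
    then show "(?F has_real_derivative ?F' s) (at s within {0..L / 4})"
      by (rule DERIV_subset) (use L in auto)
    note Rc = state_continuous_resample[OF tc]
    have t0: "0 \<le> transport s f (x, y)" if "y \<in> sphere 0 1" for x y
      using nn that by (simp add: transport_apply)
    have R0: "0 \<le> resample (transport s f) (x, y)" for x y
      using t0 by (intro resample_bounds(1)[OF tc])
    have "minor_const TYPE('n) * (\<integral>w. f w \<partial>base_measure)
       \<le> integral {0..L - s} (\<lambda>u. resample (transport u (resample (transport s f))) (x + (L - s - u) *\<^sub>R y, y))"
      unfolding integral_transport_base_measure[OF fc, of s, symmetric]
      using s L_def by (intro two_leg_average_lower_bound[OF tc t0 xy(2)]) auto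
    then have "r * exp (- ?\<Lambda> * (L - s)) * (minor_const TYPE('n) * (\<integral>w. f w \<partial>base_measure))
       \<le> r * exp (- ?\<Lambda> * (L - s)) * integral {0..L - s} (\<lambda>u. resample (transport u (resample (transport s f))) (x + (L - s - u) *\<^sub>R y, y))"
      using r_pos by (intro mult_left_mono) auto
    also have "\<dots> \<le> (\<integral>w. resample (transport s f) w \<partial>N (L - s))"
      using sL R0 by (intro forward_solution_one_resampling[OF N N0 xy Rc]) auto
    finally have "r * (r * exp (- ?\<Lambda> * (L - s)) * (minor_const TYPE('n) * (\<integral>w. f w \<partial>base_measure)))
       \<le> r * (\<integral>w. resample (transport s f) w \<partial>N (L - s))"
      using r_pos by (intro mult_left_mono) auto
    also have "\<dots> = (\<integral>w. r * resample (transport s f) w \<partial>N (L - s))" by simp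
    also have "\<dots> \<le> (\<integral>w. ?k s w \<partial>N (L - s))"
      using t0 by (intro integral_mono_state[OF pr] state_continuous_add state_continuous_mult
        state_continuous_jump_part tc Rc state_continuous_const jump_part_lower_bound) simp_all
    finally have "exp (- ?\<Lambda> * s) * (r * (r * exp (- ?\<Lambda> * (L - s)) * (minor_const TYPE('n) * (\<integral>w. f w \<partial>base_measure))))
        \<le> exp (- ?\<Lambda> * s) * (\<integral>w. ?k s w \<partial>N (L - s))"
      by (intro mult_left_mono) auto
    moreover have "exp (- ?\<Lambda> * s) * exp (- ?\<Lambda> * (L - s)) = exp (- ?\<Lambda> * L)"
      by (simp add: exp_add[symmetric] algebra_simps)
    then have "exp (- ?\<Lambda> * s) * (r * (r * exp (- ?\<Lambda> * (L - s)) * (minor_const TYPE('n) * (\<integral>w. f w \<partial>base_measure)))) = ?c * 1"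
      by (simp add: power2_eq_square mult_ac flip: \<open>exp (- ?\<Lambda> * s) * exp (- ?\<Lambda> * (L - s)) = exp (- ?\<Lambda> * L)\<close>)
    ultimately show "?F' s \<le> 0" by linarith
  qed (use L in simp)
  moreover have "(\<integral>w. 0 \<partial>N (L - L / 4)) \<le> (\<integral>w. transport (L / 4) f w \<partial>N (L - L / 4))"
    using L nn by (intro integral_mono_state forward_solution_prob[OF N] tc state_continuous_const)
      (simp_all add: transport_apply)
  then have "0 \<le> exp (- ?\<Lambda> * (L / 4)) * (\<integral>w. transport (L / 4) f w \<partial>N (L - L / 4))"
    by simp
  ultimately have "?c * (L / 4) \<le> (\<integral>w. f w \<partial>N L)" by simp
  then show ?thesis by (simp add: mult_ac)
qed

end

section \<open>Stationarity of the Gibbs measure\<close>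

lemma reflect_reflect: "reflect U x (reflect U x y) = y"
proof -
  define u where "u = sgn (gradient U x)"
  have u: "u = 0 \<or> u \<bullet> u = 1"
    by (cases "gradient U x = 0") (auto simp: u_def norm_sgn simp flip: power2_norm_eq_inner)
  then show ?thesis
  proof
    assume "u \<bullet> u = 1"
    then have "(y - (2 * (y \<bullet> u)) *\<^sub>R u) \<bullet> u = - (y \<bullet> u)" by (simp add: inner_diff_left)
    then show ?thesis unfolding reflect_def u_def[symmetric] by simp
  qed (simp add: reflect_def u_def[symmetric])
qed

lemma integral_uniform_sphere_reflect:
  fixes \<phi> :: "real ^ 'n \<Rightarrow> real"
  assumes "\<phi> \<in> borel_measurable uniform_sphere"
  shows "(\<integral>y. \<phi> (reflect U x y) \<partial>uniform_sphere) = (\<integral>y. \<phi> y \<partial>uniform_sphere)"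
proof -
  have lin: "linear (reflect U x)"
    using orthogonal_transformation_reflect by (rule orthogonal_transformation_linear)
  have "reflect U x \<in> uniform_sphere \<rightarrow>\<^sub>M uniform_sphere"
    unfolding measurable_cong_sets[OF sets_uniform_sphere sets_uniform_sphere]
    by (rule measurable_restrict_space3)
      (auto intro!: borel_measurable_continuous_onI continuous_on_linear_vec lin)
  then have "(\<integral>y. \<phi> (reflect U x y) \<partial>uniform_sphere) = (\<integral>y. \<phi> y \<partial>distr uniform_sphere uniform_sphere (reflect U x))"
    using assms by (intro integral_distr[symmetric])
  then show ?thesis
    by (simp add: distr_uniform_sphere_orthogonal[OF orthogonal_transformation_reflect])
qed

text \<open>
  Integration by parts on the torus, obtained as the derivative at \<open>0\<close> of the invariance of the
  uniform measure under transport.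
\<close>

lemma integral_drift_base_measure:
  fixes f :: "(real ^ 'n) \<times> (real ^ 'n) \<Rightarrow> real"
  assumes f: "vj_test_function f"
  shows "(\<integral>w. drift f w \<partial>base_measure) = 0"
proof -
  note fc = test_imp_state_continuous[OF f] and dc = state_continuous_drift[OF f]
  note i = state_continuous_integrable[OF _ base_measure_prob]
  have "\<bar>\<integral>w. drift f w \<partial>base_measure\<bar> \<le> 0"
  proof (rule field_le_epsilon)
    fix e :: real assume e: "e > 0"
    from transport_uniform_derivative[OF f e] obtain d where d: "d > 0"
      "\<And>h x y. y \<in> sphere 0 1 \<Longrightarrow> \<bar>h\<bar> < d \<Longrightarrow> \<bar>transport h f (x, y) - f (x, y) - h * drift f (x, y)\<bar> \<le> e * \<bar>h\<bar>"
      by auto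
    define h where "h = d / 2"
    have h: "0 < h" "\<bar>h\<bar> < d" using d by (simp_all add: h_def)
    have tc: "state_continuous (transport h f)" by (rule state_continuous_transport[OF fc])
    have sc: "state_continuous (\<lambda>w. transport h f w - f w - h * drift f w)"
      by (intro state_continuous_diff state_continuous_mult tc fc dc state_continuous_const)
    have "\<bar>\<integral>w. transport h f w - f w - h * drift f w \<partial>base_measure\<bar> \<le> e * \<bar>h\<bar>"
      using d(2)[OF _ h(2)] by (rule state_continuous_integral_bound[OF sc base_measure_prob])
    moreover have "(\<integral>w. transport h f w - f w - h * drift f w \<partial>base_measure) = - (h * (\<integral>w. drift f w \<partial>base_measure))"
      using i[OF tc] i[OF fc] i[OF dc] by (simp add: integral_transport_base_measure[OF fc])
    ultimately have "h * \<bar>\<integral>w. drift f w \<partial>base_measure\<bar> \<le> h * e"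
      using h by (simp add: abs_mult mult.commute)
    then show "\<bar>\<integral>w. drift f w \<partial>base_measure\<bar> \<le> 0 + e" using h by simp
  qed
  then show ?thesis by simp
qed

context velocity_jump
begin

definition weight :: "real ^ 'n \<Rightarrow> real" where "weight x = exp (- U x / \<epsilon>)"

lemma weight_pos: "0 < weight x" by (simp add: weight_def)

lemma continuous_U: "continuous_on UNIV U"
  using U_diff by (meson continuous_at_imp_continuous_on differentiable_imp_continuous_within)

lemma state_continuous_weight: "state_continuous (\<lambda>(x, y). weight x)"
proof -
  have "continuous_on (UNIV \<times> sphere 0 1) (\<lambda>w :: (real ^ 'n) \<times> (real ^ 'n). exp (- U (fst w) / \<epsilon>))"
    using \<epsilon>_pos by (intro continuous_intros continuous_on_compose2[OF continuous_U]) auto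
  moreover have "periodic weight" using periodic_U unfolding periodic_def weight_def by metis
  ultimately show ?thesis
    by (simp add: state_continuous_def case_prod_beta weight_def[abs_def])
qed

lemma GDERIV_weight: "GDERIV weight x :> (- weight x / \<epsilon>) *\<^sub>R gradient U x"
proof -
  have "((\<lambda>t. exp (- t / \<epsilon>)) has_real_derivative - exp (- U x / \<epsilon>) / \<epsilon>) (at (U x))"
    using \<epsilon>_pos by (auto intro!: derivative_eq_intros)
  from GDERIV_DERIV_compose[OF GDERIV_gradient[OF U_diff] this]
  show ?thesis by (simp add: weight_def[abs_def])
qed

lemma weighted_GDERIV:
  assumes g: "vj_test_function g" and y: "y \<in> sphere 0 1"
  shows "GDERIV (\<lambda>x. g (x, y) * weight x) x :>
    weight x *\<^sub>R gradient (\<lambda>x. g (x, y)) x + (g (x, y) * (- weight x / \<epsilon>)) *\<^sub>R gradient U x"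
  using GDERIV_mult[OF test_gradient[OF g y] GDERIV_weight] by (simp add: add.commute)

lemma weighted_test_function:
  assumes g: "vj_test_function g"
  shows "vj_test_function (\<lambda>(x, y). g (x, y) * weight x)"
proof -
  have "state_continuous (\<lambda>w. g w * (\<lambda>(x, y). weight x) w)"
    by (intro state_continuous_mult state_continuous_weight test_imp_state_continuous g)
  then have sc: "state_continuous (\<lambda>(x, y). g (x, y) * weight x)" by (simp add: case_prod_unfold)
  have wc: "continuous_on (UNIV \<times> sphere 0 1) (\<lambda>w :: (real ^ 'n) \<times> (real ^ 'n). weight (fst w))"
    using state_continuous_cont[OF state_continuous_weight] by (simp add: case_prod_beta)
  have gradc: "continuous_on (UNIV \<times> sphere 0 1) (\<lambda>w. gradient (\<lambda>x'. g (x', snd w)) (fst w))"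
    using g by (simp add: vj_test_function_def case_prod_beta)
  have "continuous_on (UNIV \<times> sphere 0 1) (\<lambda>w. weight (fst w) *\<^sub>R gradient (\<lambda>x'. g (x', snd w)) (fst w)
     + (g w * (- weight (fst w) / \<epsilon>)) *\<^sub>R gradient U (fst w))"
    using \<epsilon>_pos by (intro continuous_intros wc gradc state_continuous_cont[OF test_imp_state_continuous[OF g]]
      continuous_on_compose2[OF cont_gradient]) auto
  then have "continuous_on (UNIV \<times> sphere 0 1)
     (\<lambda>(x, y). gradient (\<lambda>x'. (\<lambda>(x, y). g (x, y) * weight x) (x', y)) x)"
    by (rule continuous_on_eq) (auto simp: gradient_eq[OF weighted_GDERIV[OF g]])
  moreover have "(\<lambda>x'. g (x', y) * weight x') differentiable at x" if "y \<in> sphere 0 1" for x y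
    using weighted_GDERIV[OF g that] unfolding gderiv_def differentiable_def by blast
  ultimately show ?thesis
    using sc unfolding vj_test_function_def state_continuous_def by simp
qed

lemma drift_weighted:
  assumes g: "vj_test_function g" and y: "y \<in> sphere 0 1"
  shows "drift (\<lambda>(x, y). g (x, y) * weight x) (x, y)
    = weight x * (drift g (x, y) - (y \<bullet> gradient U x) / \<epsilon> * g (x, y))"
  unfolding drift_apply prod.case gradient_eq[OF weighted_GDERIV[OF g y]]
  by (simp add: inner_add_right algebra_simps)

lemma state_continuous_slope: "state_continuous (\<lambda>(x, y). (y \<bullet> gradient U x) / \<epsilon>)"
proof -
  have "continuous_on (UNIV \<times> sphere 0 1) (\<lambda>w. snd w \<bullet> gradient U (fst w) / \<epsilon>)"
    using \<epsilon>_pos by (intro continuous_intros continuous_on_compose2[OF cont_gradient]) auto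
  then show ?thesis
    using periodic_gradient[OF periodic_U U_diff]
    by (simp add: state_continuous_def case_prod_beta periodic_def)
qed

text \<open>
  Averaged over the velocities, a reflection can be moved from the function to the rate, because the
  uniform measure on the sphere is invariant under it; the rates of a velocity and of its
  reflection differ by the slope of \<open>U / \<epsilon>\<close> along the velocity.
\<close>

lemma resample_jump_part:
  assumes g: "state_continuous g"
  shows "resample (jump_part g) (x, y) = - resample (\<lambda>(x, y). (y \<bullet> gradient U x) / \<epsilon> * g (x, y)) (x, y)"
proof -
  interpret S: prob_space "uniform_sphere :: (real ^ 'n) measure" by (rule prob_space_uniform_sphere)
  note ints = state_continuous_integrable_sphere[of _ x]
  have c1: "state_continuous (\<lambda>(x, y). bounce_rate (x, y) * g (x, reflect U x y))" by (rule state_continuous_bounce[OF g])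
  have c2: "state_continuous (\<lambda>w. bounce_rate w * g w)"
    by (intro state_continuous_mult state_continuous_bounce_rate g)
  have c3: "state_continuous (\<lambda>w. (\<lambda>(x, y). (y \<bullet> gradient U x) / \<epsilon>) w * g w)"
    by (intro state_continuous_mult state_continuous_slope g)
  have i1: "integrable uniform_sphere (\<lambda>z. bounce_rate (x, z) * g (x, reflect U x z))"
    and i2: "integrable uniform_sphere (\<lambda>z. bounce_rate (x, z) * g (x, z))"
    and i3: "integrable uniform_sphere (\<lambda>z. (z \<bullet> gradient U x) / \<epsilon> * g (x, z))"
    and i4: "integrable uniform_sphere (\<lambda>z. g (x, z))"
    using ints[OF c1] ints[OF c2] ints[OF c3] ints[OF g] by simp_all
  have rr: "bounce_rate (x, reflect U x z) = bounce_rate (x, z) - (z \<bullet> gradient U x) / \<epsilon>" for z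
    using \<epsilon>_pos by (auto simp: bounce_rate_def reflect_inner_gradient max_def diff_divide_distrib[symmetric])
  have "(\<integral>z. bounce_rate (x, z) * g (x, reflect U x z) \<partial>uniform_sphere)
    = (\<integral>z. (\<lambda>z. bounce_rate (x, reflect U x z) * g (x, z)) (reflect U x z) \<partial>uniform_sphere)"
    by (simp add: reflect_reflect)
  also have "\<dots> = (\<integral>z. bounce_rate (x, reflect U x z) * g (x, z) \<partial>uniform_sphere)"
  proof (rule integral_uniform_sphere_reflect)
    have "(\<lambda>z. bounce_rate (x, z) * g (x, z) - (z \<bullet> gradient U x) / \<epsilon> * g (x, z)) \<in> borel_measurable uniform_sphere"
      by (intro borel_measurable_diff borel_measurable_integrable i2 i3)
    then show "(\<lambda>z. bounce_rate (x, reflect U x z) * g (x, z)) \<in> borel_measurable uniform_sphere"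
      by (simp add: rr left_diff_distrib)
  qed
  also have "\<dots> = (\<integral>z. bounce_rate (x, z) * g (x, z) \<partial>uniform_sphere) - (\<integral>z. (z \<bullet> gradient U x) / \<epsilon> * g (x, z) \<partial>uniform_sphere)"
    unfolding rr left_diff_distrib using i2 i3 by (rule Bochner_Integration.integral_diff)
  finally have 1: "(\<integral>z. bounce_rate (x, z) * g (x, reflect U x z) \<partial>uniform_sphere)
    = (\<integral>z. bounce_rate (x, z) * g (x, z) \<partial>uniform_sphere) - (\<integral>z. (z \<bullet> gradient U x) / \<epsilon> * g (x, z) \<partial>uniform_sphere)" .
  have R: "resample g (x, z) = (\<integral>z. g (x, z) \<partial>uniform_sphere)" for z by (rule resample_apply)
  have "resample (jump_part g) (x, y) = (\<integral>z. bounce_rate (x, z) * g (x, reflect U x z) - bounce_rate (x, z) * g (x, z)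
      + r * ((\<integral>z. g (x, z) \<partial>uniform_sphere) - g (x, z)) \<partial>uniform_sphere)"
  proof -
    have "jump_part g (x, z) = bounce_rate (x, z) * g (x, reflect U x z) - bounce_rate (x, z) * g (x, z)
      + r * ((\<integral>z. g (x, z) \<partial>uniform_sphere) - g (x, z))" for z
      by (simp add: jump_part_def R right_diff_distrib)
    then show ?thesis by (simp only: resample_apply[of "jump_part g"])
  qed
  also have "\<dots> = (\<integral>z. bounce_rate (x, z) * g (x, reflect U x z) \<partial>uniform_sphere) - (\<integral>z. bounce_rate (x, z) * g (x, z) \<partial>uniform_sphere)"
    using i1 i2 i4 by (simp add: S.prob_space)
  also have "\<dots> = - resample (\<lambda>(x, y). (y \<bullet> gradient U x) / \<epsilon> * g (x, y)) (x, y)"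
    unfolding 1 by (simp add: resample_apply)
  finally show ?thesis .
qed

text \<open>
  The drift differentiates the weight and the jump part contributes the slope of \<open>U / \<epsilon>\<close>; the two
  terms cancel.
\<close>

lemma integral_generator_weighted:
  assumes g: "vj_test_function g"
  shows "(\<integral>(x, y). weight x * vj_generator U r \<epsilon> g (x, y) \<partial>base_measure) = 0"
proof -
  note gc = test_imp_state_continuous[OF g]
  let ?w = "\<lambda>(x, y). weight x" and ?s = "\<lambda>(x, y). (y \<bullet> gradient U x) / \<epsilon>"
  note dc = state_continuous_drift[OF weighted_test_function[OF g]]
  have jc: "state_continuous (\<lambda>w. ?w w * jump_part g w)"
    by (intro state_continuous_mult state_continuous_weight state_continuous_jump_part gc)
  have sgc: "state_continuous (\<lambda>w. ?w w * (?s w * g w))"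
    by (intro state_continuous_mult state_continuous_weight state_continuous_slope gc)
  note i = state_continuous_integrable[OF _ base_measure_prob]
  have sp: "space base_measure = (torus \<times> sphere 0 1 :: ((real ^ 'n) \<times> (real ^ 'n)) set)"
    using base_measure_prob[where 'a = 'n] sets_eq_imp_space_eq[of base_measure "state_space :: ((real ^ 'n) \<times> (real ^ 'n)) measure"]
    by (simp add: space_prob_algebra space_state_space)
  have "(\<integral>(x, y). weight x * vj_generator U r \<epsilon> g (x, y) \<partial>base_measure)
    = (\<integral>w. drift (\<lambda>(x, y). g (x, y) * weight x) w + (?w w * (?s w * g w) + ?w w * jump_part g w) \<partial>base_measure)"
  proof (rule Bochner_Integration.integral_cong[OF refl])
    fix w :: "(real ^ 'n) \<times> (real ^ 'n)" assume "w \<in> space base_measure"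
    then obtain x y where w: "w = (x, y)" and y: "y \<in> sphere 0 1" unfolding sp by (cases w) auto
    show "(\<lambda>(x, y). weight x * vj_generator U r \<epsilon> g (x, y)) w
      = drift (\<lambda>(x, y). g (x, y) * weight x) w + (?w w * (?s w * g w) + ?w w * jump_part g w)"
      unfolding w drift_weighted[OF g y] vj_generator_eq by (simp add: algebra_simps)
  qed
  also have "\<dots> = (\<integral>w. ?w w * (?s w * g w) \<partial>base_measure) + (\<integral>w. ?w w * jump_part g w \<partial>base_measure)"
    using i[OF dc] i[OF sgc] i[OF jc] by (simp add: integral_drift_base_measure[OF weighted_test_function[OF g]])
  also have "\<dots> = 0"
  proof -
    have "resample (\<lambda>w. ?w w * k w) (x, y) = weight x * resample k (x, y)" for k x y
      by (simp add: resample_apply)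
    then have "resample (\<lambda>w. ?w w * jump_part g w) (x, 0) = - resample (\<lambda>w. ?w w * (?s w * g w)) (x, 0)" for x
      by (simp add: resample_jump_part[OF gc]) (simp add: resample_apply)
    then show ?thesis
      by (simp add: integral_base_measure[OF sgc, of 0] integral_base_measure[OF jc, of 0])
  qed
  finally show ?thesis .
qed

lemma partition_pos: "0 < (\<integral>x. weight x \<partial>restrict_space lborel torus)"
proof -
  interpret T: prob_space "restrict_space lborel (torus :: (real ^ 'n) set)" by (rule prob_space_torus)
  have "continuous_on (UNIV \<times> sphere 0 1) (\<lambda>w :: (real ^ 'n) \<times> (real ^ 'n). U (fst w))"
    by (intro continuous_on_compose2[OF continuous_U] continuous_on_fst continuous_on_id) auto
  then have "state_continuous (\<lambda>(x, y). U x)"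
    using periodic_U by (simp add: state_continuous_def case_prod_unfold)
  from state_continuous_bounded[OF this] obtain C where "0 < C"
    and C': "\<And>x y :: real ^ 'n. y \<in> sphere 0 1 \<Longrightarrow> \<bar>U x\<bar> \<le> C" by auto
  have "axis undefined 1 \<in> sphere (0 :: real ^ 'n) 1" by simp
  from C'[OF this] have C: "\<bar>U x\<bar> \<le> C" for x by simp
  have U: "- U x / \<epsilon> \<le> C / \<epsilon>" "- C / \<epsilon> \<le> - U x / \<epsilon>" for x
    by (rule divide_right_mono; use C[of x] \<epsilon>_pos in linarith)+
  have "weight \<in> borel_measurable borel"
    unfolding weight_def[abs_def] using \<epsilon>_pos
    by (intro borel_measurable_continuous_onI continuous_intros continuous_U) auto
  then have int: "integrable (restrict_space lborel torus) weight"
    by (intro T.integrable_const_bound[where B = "exp (C / \<epsilon>)"] measurable_restrict_space1)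
      (use U in \<open>auto simp: weight_def\<close>)
  have "exp (- C / \<epsilon>) \<le> (\<integral>x. weight x \<partial>restrict_space lborel torus)"
    by (rule T.integral_ge_const[OF int]) (use U in \<open>auto simp: weight_def\<close>)
  then show ?thesis using exp_gt_zero[of "- C / \<epsilon>"] by linarith
qed

lemma integral_gibbs:
  assumes f: "state_continuous f"
  shows "(\<integral>w. f w \<partial>gibbs U \<epsilon>)
    = (\<integral>(x, y). weight x * f (x, y) \<partial>base_measure) / (\<integral>x. weight x \<partial>restrict_space lborel torus)"
proof -
  let ?Z = "\<integral>x. weight x \<partial>restrict_space lborel torus"
  have sb: "sets base_measure = sets (state_space :: ((real ^ 'n) \<times> (real ^ 'n)) measure)"
    using base_measure_prob[where 'a = 'n] by (simp add: space_prob_algebra)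
  have eq: "gibbs U \<epsilon> = density base_measure (\<lambda>w. ennreal ((\<lambda>(x, y). weight x) w / ?Z))"
    unfolding gibbs_def base_measure_def weight_def[abs_def] by (simp add: case_prod_unfold)
  have "(\<integral>w. f w \<partial>gibbs U \<epsilon>) = (\<integral>w. ((\<lambda>(x, y). weight x) w / ?Z) *\<^sub>R f w \<partial>base_measure)"
    unfolding eq
  proof (rule integral_density)
    show "f \<in> borel_measurable base_measure"
      using state_continuous_measurable[OF f] by (simp add: measurable_cong_sets[OF sb refl])
    show "(\<lambda>w. (\<lambda>(x, y). weight x) w / ?Z) \<in> borel_measurable base_measure"
      using state_continuous_measurable[OF state_continuous_weight]
      by (intro borel_measurable_divide) (simp_all add: measurable_cong_sets[OF sb refl])
    show "AE w in base_measure. 0 \<le> (\<lambda>(x, y). weight x) w / ?Z"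
      using partition_pos weight_pos by (auto simp: case_prod_beta less_imp_le)
  qed
  then show ?thesis by (simp add: case_prod_unfold)
qed

lemma gibbs_prob: "gibbs U \<epsilon> \<in> space (prob_algebra state_space)"
proof -
  let ?Z = "\<integral>x. weight x \<partial>restrict_space lborel torus"
  have sb: "sets base_measure = sets (state_space :: ((real ^ 'n) \<times> (real ^ 'n)) measure)"
    using base_measure_prob[where 'a = 'n] by (simp add: space_prob_algebra)
  have eq: "gibbs U \<epsilon> = density base_measure (\<lambda>w. ennreal ((\<lambda>(x, y). weight x) w / ?Z))"
    unfolding gibbs_def base_measure_def weight_def[abs_def] by (simp add: case_prod_unfold)
  have wc: "state_continuous (\<lambda>w. (\<lambda>(x, y). weight x) w * (1 / ?Z))"
    by (intro state_continuous_mult state_continuous_weight state_continuous_const)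
  note int = state_continuous_integrable[OF wc base_measure_prob]
  interpret S: prob_space "uniform_sphere :: (real ^ 'n) measure" by (rule prob_space_uniform_sphere)
  have "emeasure (gibbs U \<epsilon>) (space (gibbs U \<epsilon>)) = (\<integral>\<^sup>+w. ennreal ((\<lambda>(x, y). weight x) w * (1 / ?Z)) \<partial>base_measure)"
    unfolding eq using borel_measurable_integrable[OF int]
    by (simp add: emeasure_density cong: nn_integral_cong)
  also have "\<dots> = ennreal (\<integral>w. (\<lambda>(x, y). weight x) w * (1 / ?Z) \<partial>base_measure)"
    by (rule nn_integral_eq_integral[OF int])
      (use partition_pos weight_pos in \<open>auto simp: case_prod_beta less_imp_le\<close>)
  also have "(\<integral>w. (\<lambda>(x, y). weight x) w * (1 / ?Z) \<partial>base_measure) = 1"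
    using partition_pos by (simp add: integral_base_measure[OF state_continuous_weight, of 0] resample_apply S.prob_space)
  finally have "prob_space (gibbs U \<epsilon>)" by (intro prob_spaceI) simp
  moreover have "sets (gibbs U \<epsilon>) = sets state_space" unfolding eq using sb by simp
  ultimately show ?thesis by (simp add: space_prob_algebra)
qed

lemma forward_solution_gibbs: "forward_solution (\<lambda>_. gibbs U \<epsilon>)"
  unfolding forward_solution_def
proof (intro conjI allI impI gibbs_prob)
  fix g :: "(real ^ 'n) \<times> (real ^ 'n) \<Rightarrow> real" and t :: real
  assume g: "vj_test_function g"
  from integral_gibbs[OF state_continuous_generator[OF g]] integral_generator_weighted[OF g]
  show "((\<lambda>t. \<integral>w. g w \<partial>gibbs U \<epsilon>) has_real_derivative (\<integral>w. vj_generator U r \<epsilon> g w \<partial>gibbs U \<epsilon>)) (at t within {0..})"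
    by simp
qed

end

section \<open>Exponential decay for the semigroup\<close>

lemma bind_in_prob_algebra:
  assumes "\<mu> \<in> space (prob_algebra S)" "K \<in> S \<rightarrow>\<^sub>M prob_algebra S"
  shows "\<mu> \<bind> K \<in> space (prob_algebra S)"
  using prob_space_bind'[OF assms] sets_bind'[OF assms] by (simp add: space_prob_algebra)

lemma integral_bind_state:
  fixes f :: "(real ^ 'n) \<times> (real ^ 'n) \<Rightarrow> real"
  assumes \<mu>: "\<mu> \<in> space (prob_algebra state_space)" and K: "K \<in> state_space \<rightarrow>\<^sub>M prob_algebra state_space"
    and f: "state_continuous f"
  shows "(\<integral>w. f w \<partial>(\<mu> \<bind> K)) = (\<integral>w. (\<integral>v. f v \<partial>K w) \<partial>\<mu>)"
    and "integrable \<mu> (\<lambda>w. \<integral>v. f v \<partial>K w)"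
proof -
  interpret prob_space \<mu> using \<mu> by (simp add: space_prob_algebra)
  have s: "sets \<mu> = sets state_space" using \<mu> by (simp add: space_prob_algebra)
  have sp: "space \<mu> = space state_space" using s by (rule sets_eq_imp_space_eq)
  have Kw: "K w \<in> space (prob_algebra state_space)" if "w \<in> space \<mu>" for w
    using measurable_space[OF K] that sp by simp
  have K': "K \<in> \<mu> \<rightarrow>\<^sub>M subprob_algebra state_space"
    using measurable_prob_algebraD[OF K] by (simp add: measurable_cong_sets[OF s refl])
  obtain C where "0 < C" and C: "\<And>x y. y \<in> sphere 0 1 \<Longrightarrow> \<bar>f (x, y)\<bar> \<le> C"
    using state_continuous_bounded[OF f] by blast
  have C': "\<bar>f w\<bar> \<le> C" if "w \<in> space state_space" for w
    using that C by (auto simp: space_state_space)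
  have "AE w in \<mu>. emeasure (K w) (space (K w)) \<le> ennreal 1"
  proof (rule AE_I2)
    fix w assume "w \<in> space \<mu>"
    then interpret Kw: prob_space "K w" using Kw by (simp add: space_prob_algebra)
    show "emeasure (K w) (space (K w)) \<le> ennreal 1" by (simp add: Kw.emeasure_space_1)
  qed
  then show "(\<integral>w. f w \<partial>(\<mu> \<bind> K)) = (\<integral>w. (\<integral>v. f v \<partial>K w) \<partial>\<mu>)"
    by (intro integral_bind[OF state_continuous_measurable[OF f] C' K' finite_measure_axioms])
  have "(\<lambda>w. \<integral>v. f v \<partial>K w) \<in> borel_measurable \<mu>"
    using measurable_compose[OF K' integral_measurable_subprob_algebra[OF state_continuous_measurable[OF f]]] .
  then show "integrable \<mu> (\<lambda>w. \<integral>v. f v \<partial>K w)"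
    using state_continuous_integral_bound[OF f Kw C]
    by (intro integrable_const_bound[where B = C]) auto
qed

context velocity_jump
begin

lemma semigroup_kernel:
  "vj_semigroup U r \<epsilon> P \<Longrightarrow> 0 \<le> t \<Longrightarrow> P t \<in> state_space \<rightarrow>\<^sub>M prob_algebra state_space"
  by (simp add: vj_semigroup_def)

lemma semigroup_bind_add:
  assumes P: "vj_semigroup U r \<epsilon> P" and \<mu>: "\<mu> \<in> space (prob_algebra state_space)" and t: "0 \<le> s" "0 \<le> t"
  shows "\<mu> \<bind> P (s + t) = (\<mu> \<bind> P s) \<bind> P t"
proof -
  have s: "sets \<mu> = sets state_space" using \<mu> by (simp add: space_prob_algebra)
  have sp: "space \<mu> = space state_space" using s by (rule sets_eq_imp_space_eq)
  have Ps: "P s \<in> \<mu> \<rightarrow>\<^sub>M subprob_algebra state_space" and Pt: "P t \<in> state_space \<rightarrow>\<^sub>M subprob_algebra state_space"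
    using measurable_prob_algebraD[OF semigroup_kernel[OF P]] t by (simp_all add: measurable_cong_sets[OF s refl])
  have "(\<mu> \<bind> P s) \<bind> P t = \<mu> \<bind> (\<lambda>w. P s w \<bind> P t)" by (rule bind_assoc[OF Ps Pt])
  also have "\<dots> = \<mu> \<bind> P (s + t)"
    using P t sp by (intro bind_cong_All) (simp add: vj_semigroup_def)
  finally show ?thesis ..
qed

lemma semigroup_0:
  assumes P: "vj_semigroup U r \<epsilon> P" and \<mu>: "\<mu> \<in> space (prob_algebra state_space)"
  shows "\<mu> \<bind> P 0 = \<mu>"
proof -
  have s: "sets \<mu> = sets state_space" using \<mu> by (simp add: space_prob_algebra)
  have "\<mu> \<bind> P 0 = \<mu> \<bind> return state_space"
    using P sets_eq_imp_space_eq[OF s] by (intro bind_cong_All) (simp add: vj_semigroup_def)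
  also have "\<dots> = \<mu>" using s by (rule bind_return'')
  finally show ?thesis .
qed

text \<open>
  The definition of the generator, integrated against an initial law, with an error that is uniform
  in this law.
\<close>

lemma semigroup_small_time:
  assumes P: "vj_semigroup U r \<epsilon> P" and f: "vj_test_function f" and e: "e > 0"
  shows "\<exists>d>0. \<forall>h \<mu>. 0 < h \<longrightarrow> h < d \<longrightarrow> \<mu> \<in> space (prob_algebra state_space) \<longrightarrow>
    \<bar>(\<integral>w. f w \<partial>(\<mu> \<bind> P h)) - (\<integral>w. f w \<partial>\<mu>) - h * (\<integral>w. vj_generator U r \<epsilon> f w \<partial>\<mu>)\<bar> \<le> e * h"
proof -
  note fc = test_imp_state_continuous[OF f] and Lc = state_continuous_generator[OF f]
  have "uniform_limit (space state_space) (\<lambda>t w. ((\<integral>w'. f w' \<partial>P t w) - f w) / t) (vj_generator U r \<epsilon> f) (at_right 0)"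
    using P f by (simp add: vj_semigroup_def)
  then have "\<forall>\<^sub>F h in at_right 0. \<forall>w\<in>space state_space.
      dist (((\<integral>w'. f w' \<partial>P h w) - f w) / h) (vj_generator U r \<epsilon> f w) < e"
    using e by (rule uniform_limitD)
  then obtain d where d: "d > 0" and D: "\<And>h w. 0 < h \<Longrightarrow> h < d \<Longrightarrow> w \<in> space state_space \<Longrightarrow>
      dist (((\<integral>w'. f w' \<partial>P h w) - f w) / h) (vj_generator U r \<epsilon> f w) < e"
    unfolding eventually_at_right_field by auto
  have "\<bar>(\<integral>w. f w \<partial>(\<mu> \<bind> P h)) - (\<integral>w. f w \<partial>\<mu>) - h * (\<integral>w. vj_generator U r \<epsilon> f w \<partial>\<mu>)\<bar> \<le> e * h"
    if h: "0 < h" "h < d" and \<mu>: "\<mu> \<in> space (prob_algebra state_space)" for h \<mu>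
  proof -
    interpret prob_space \<mu> using \<mu> by (simp add: space_prob_algebra)
    have sp: "space \<mu> = space state_space"
      using \<mu> by (intro sets_eq_imp_space_eq) (simp add: space_prob_algebra)
    note b = integral_bind_state[OF \<mu> semigroup_kernel[OF P less_imp_le[OF h(1)]] fc]
    note i = b(2) state_continuous_integrable[OF fc \<mu>] state_continuous_integrable[OF Lc \<mu>]
    let ?k = "\<lambda>w. (\<integral>v. f v \<partial>P h w) - f w - h * vj_generator U r \<epsilon> f w"
    have ki: "integrable \<mu> ?k" using i by simp
    have kb: "\<bar>?k w\<bar> \<le> e * h" if w: "w \<in> space \<mu>" for w
    proof -
      have "?k w = h * (((\<integral>v. f v \<partial>P h w) - f w) / h - vj_generator U r \<epsilon> f w)"
        using h by (simp add: field_simps)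
      also have "\<bar>\<dots>\<bar> = h * \<bar>((\<integral>v. f v \<partial>P h w) - f w) / h - vj_generator U r \<epsilon> f w\<bar>"
        using h by (simp add: abs_mult)
      also have "\<dots> \<le> h * e"
        using D[OF h, of w] w h sp by (intro mult_left_mono) (auto simp: dist_real_def)
      finally show ?thesis by (simp add: mult.commute)
    qed
    have "AE w in \<mu>. ?k w \<le> e * h" "AE w in \<mu>. - (e * h) \<le> ?k w"
      by (rule AE_I2, drule kb, linarith)+
    then have "(\<integral>w. ?k w \<partial>\<mu>) \<le> e * h" "- (e * h) \<le> (\<integral>w. ?k w \<partial>\<mu>)"
      using integral_le_const[OF ki] integral_ge_const[OF ki] by blast+
    moreover have "(\<integral>w. ?k w \<partial>\<mu>) = (\<integral>w. f w \<partial>(\<mu> \<bind> P h)) - (\<integral>w. f w \<partial>\<mu>) - h * (\<integral>w. vj_generator U r \<epsilon> f w \<partial>\<mu>)"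
      unfolding b(1) using i by simp
    ultimately show ?thesis by (simp add: abs_le_iff)
  qed
  then show ?thesis using d by blast
qed

lemma semigroup_weak_continuity:
  assumes P: "vj_semigroup U r \<epsilon> P" and \<mu>: "\<mu> \<in> space (prob_algebra state_space)"
    and k: "state_continuous k" and t: "0 \<le> t"
  shows "((\<lambda>s. \<integral>w. k w \<partial>(\<mu> \<bind> P s)) \<longlongrightarrow> (\<integral>w. k w \<partial>(\<mu> \<bind> P t))) (at t within {0..})"
proof (rule tendstoI)
  let ?N = "\<lambda>s. \<mu> \<bind> P s"
  have N: "?N s \<in> space (prob_algebra state_space)" if "0 \<le> s" for s
    using that by (intro bind_in_prob_algebra \<mu> semigroup_kernel[OF P])
  fix e :: real assume e: "e > 0"
  from test_functions_dense_uniformly[OF k, of "e / 3"] e obtain g where g: "vj_test_function g"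
    and gk: "\<And>x y. y \<in> sphere 0 1 \<Longrightarrow> \<bar>g (x, y) - k (x, y)\<bar> \<le> e / 3" by auto
  note close = integral_close[OF N k test_imp_state_continuous[OF g] gk]
  note Lc = state_continuous_generator[OF g]
  obtain B where B0: "0 < B" and B: "\<And>x y. y \<in> sphere 0 1 \<Longrightarrow> \<bar>vj_generator U r \<epsilon> g (x, y)\<bar> \<le> B"
    using state_continuous_bounded[OF Lc] by blast
  from semigroup_small_time[OF P g zero_less_one] obtain d where d: "d > 0"
    and D: "\<And>h \<mu>. 0 < h \<Longrightarrow> h < d \<Longrightarrow> \<mu> \<in> space (prob_algebra state_space) \<Longrightarrow>
      \<bar>(\<integral>w. g w \<partial>(\<mu> \<bind> P h)) - (\<integral>w. g w \<partial>\<mu>) - h * (\<integral>w. vj_generator U r \<epsilon> g w \<partial>\<mu>)\<bar> \<le> 1 * h" by blast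
  have inc: "\<bar>(\<integral>w. g w \<partial>?N (a + h)) - (\<integral>w. g w \<partial>?N a)\<bar> \<le> h * (B + 1)"
    if "0 \<le> a" "0 < h" "h < d" for a h
  proof -
    have "\<bar>\<integral>w. vj_generator U r \<epsilon> g w \<partial>?N a\<bar> \<le> B"
      using that by (intro state_continuous_integral_bound[OF Lc N B]) auto
    then have "h * \<bar>\<integral>w. vj_generator U r \<epsilon> g w \<partial>?N a\<bar> \<le> h * B"
      using that by (intro mult_left_mono) auto
    then have "\<bar>h * (\<integral>w. vj_generator U r \<epsilon> g w \<partial>?N a)\<bar> \<le> h * B"
      using that by (simp add: abs_mult)
    then show ?thesis
      using D[OF that(2,3) N[OF that(1)]] that
      by (simp add: semigroup_bind_add[OF P \<mu>] distrib_left)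
  qed
  have inc': "\<bar>(\<integral>w. g w \<partial>?N s) - (\<integral>w. g w \<partial>?N t)\<bar> \<le> \<bar>s - t\<bar> * (B + 1)" if "0 \<le> s" "\<bar>s - t\<bar> < d" for s
  proof (cases s t rule: linorder_cases)
    case less
    then show ?thesis using inc[of s "t - s"] that by (simp add: abs_minus_commute)
  next
    case greater
    then show ?thesis using inc[of t "s - t"] that t by simp
  qed simp
  have dd: "0 < min d (e / (3 * (B + 1)))" using d e B0 by simp
  have "dist (\<integral>w. k w \<partial>?N s) (\<integral>w. k w \<partial>?N t) < e"
    if s: "s \<in> {0..}" "dist s t < min d (e / (3 * (B + 1)))" for s
  proof -
    have st: "\<bar>s - t\<bar> < d" "\<bar>s - t\<bar> * (B + 1) < e / 3"
      using s B0 by (auto simp: dist_real_def divide_simps) (simp add: algebra_simps)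
    have s0: "0 \<le> s" using s by simp
    show ?thesis
      using inc'[OF s0 st(1)] st(2) close[OF s0] close[OF t] unfolding dist_real_def by linarith
  qed
  then show "\<forall>\<^sub>F s in at t within {0..}. dist (\<integral>w. k w \<partial>?N s) (\<integral>w. k w \<partial>?N t) < e"
    unfolding eventually_at using dd by blast
qed

text \<open>
  The uniformity in the initial law gives difference quotients over \<open>[a, a + h]\<close> close to the
  generator at time \<open>a\<close>; for left derivatives weak continuity at \<open>t\<close> is needed in addition.
\<close>

lemma forward_solution_semigroup:
  assumes P: "vj_semigroup U r \<epsilon> P" and \<mu>: "\<mu> \<in> space (prob_algebra state_space)"
  shows "forward_solution (\<lambda>t. \<mu> \<bind> P t)"
  unfolding forward_solution_def
proof (intro conjI allI impI)
  show N: "\<mu> \<bind> P t \<in> space (prob_algebra state_space)" if "0 \<le> t" for t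
    using that by (intro bind_in_prob_algebra \<mu> semigroup_kernel[OF P])
  let ?N = "\<lambda>s. \<mu> \<bind> P s"
  fix g :: "(real ^ 'n) \<times> (real ^ 'n) \<Rightarrow> real" and t :: real
  assume g: "vj_test_function g" and t: "0 \<le> t"
  note Lc = state_continuous_generator[OF g]
  let ?G = "\<lambda>s. \<integral>w. g w \<partial>?N s" and ?D = "\<lambda>s. \<integral>w. vj_generator U r \<epsilon> g w \<partial>?N s"
  let ?A = "at t within {0..}"
  \<comment> \<open>The generator is evaluated at the earlier of the two times, where the interval starts.\<close>
  have "((\<lambda>s. (?G s - ?G t) / (s - t) - ?D (min s t)) \<longlongrightarrow> 0) ?A"
  proof (rule tendstoI)
    fix e :: real assume e: "e > 0"
    from semigroup_small_time[OF P g, of "e / 2"] e obtain d where d: "d > 0"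
      and D: "\<And>h \<mu>. 0 < h \<Longrightarrow> h < d \<Longrightarrow> \<mu> \<in> space (prob_algebra state_space) \<Longrightarrow>
        \<bar>(\<integral>w. g w \<partial>(\<mu> \<bind> P h)) - (\<integral>w. g w \<partial>\<mu>) - h * (\<integral>w. vj_generator U r \<epsilon> g w \<partial>\<mu>)\<bar> \<le> e / 2 * h"
      by (metis half_gt_zero)
    have step: "\<bar>(?G (a + h) - ?G a) / h - ?D a\<bar> \<le> e / 2" if "0 \<le> a" "0 < h" "h < d" for a h
    proof -
      have "\<bar>?G (a + h) - ?G a - h * ?D a\<bar> \<le> e / 2 * h"
        using D[OF that(2,3) N[OF that(1)]] that by (simp add: semigroup_bind_add[OF P \<mu>])
      moreover have "(?G (a + h) - ?G a) / h - ?D a = (?G (a + h) - ?G a - h * ?D a) / h"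
        using that by (simp add: diff_divide_distrib)
      ultimately show ?thesis using that by (simp add: abs_divide divide_le_eq)
    qed
    have "dist ((?G s - ?G t) / (s - t) - ?D (min s t)) 0 < e" if s: "s \<in> {0..}" "s \<noteq> t" "dist s t < d" for s
    proof (cases "s < t")
      case True
      then have "(?G s - ?G t) / (s - t) = (?G (s + (t - s)) - ?G s) / (t - s)"
        by (simp add: divide_simps) (simp add: algebra_simps)
      then show ?thesis using step[of s "t - s"] True s e by (simp add: dist_real_def)
    next
      case False
      then show ?thesis using step[of t "s - t"] s t e by (simp add: dist_real_def)
    qed
    then show "\<forall>\<^sub>F s in ?A. dist ((?G s - ?G t) / (s - t) - ?D (min s t)) 0 < e"
      unfolding eventually_at using d by blast
  qed
  moreover have "((\<lambda>s. ?D (min s t)) \<longlongrightarrow> ?D t) ?A"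
  proof (rule tendstoI)
    fix e :: real assume "e > 0"
    from tendstoD[OF semigroup_weak_continuity[OF P \<mu> Lc t] this] obtain d where "d > 0"
      "\<And>s. s \<in> {0..} \<Longrightarrow> s \<noteq> t \<Longrightarrow> dist s t < d \<Longrightarrow> dist (?D s) (?D t) < e"
      unfolding eventually_at by blast
    then show "\<forall>\<^sub>F s in ?A. dist (?D (min s t)) (?D t) < e"
      unfolding eventually_at using \<open>e > 0\<close> by (intro exI[of _ d]) (auto simp: min_def)
  qed
  ultimately have "((\<lambda>s. ((?G s - ?G t) / (s - t) - ?D (min s t)) + ?D (min s t)) \<longlongrightarrow> 0 + ?D t) ?A"
    by (rule tendsto_add)
  then show "(?G has_real_derivative ?D t) ?A"
    by (simp add: has_field_derivative_iff)
qed

lemma gibbs_invariant: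
  assumes P: "vj_semigroup U r \<epsilon> P" and t: "0 \<le> t"
  shows "gibbs U \<epsilon> \<bind> P t = gibbs U \<epsilon>"
proof (rule measure_eqI)
  let ?\<nu> = "gibbs U \<epsilon>"
  have N: "?\<nu> \<bind> P t \<in> space (prob_algebra state_space)"
    by (intro bind_in_prob_algebra gibbs_prob semigroup_kernel[OF P t])
  then interpret N: prob_space "?\<nu> \<bind> P t" by (simp add: space_prob_algebra)
  interpret G: prob_space ?\<nu> using gibbs_prob by (simp add: space_prob_algebra)
  have sN: "sets (?\<nu> \<bind> P t) = sets state_space" and sG: "sets ?\<nu> = sets state_space"
    using N gibbs_prob by (simp_all add: space_prob_algebra)
  then show "sets (?\<nu> \<bind> P t) = sets ?\<nu>" by simp
  have eq: "(\<integral>w. f w \<partial>(?\<nu> \<bind> P t)) = (\<integral>w. f w \<partial>?\<nu>)" if "vj_test_function f" for f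
    by (rule forward_solution_unique[OF forward_solution_semigroup[OF P gibbs_prob] forward_solution_gibbs
      semigroup_0[OF P gibbs_prob] test_imp_state_continuous[OF that] t])
  fix A assume "A \<in> sets (?\<nu> \<bind> P t)"
  then have A: "A \<in> sets state_space" by (simp add: sN)
  have "1 * measure ?\<nu> A \<le> measure (?\<nu> \<bind> P t) A" "1 * measure (?\<nu> \<bind> P t) A \<le> measure ?\<nu> A"
    by (rule measure_le_of_test_functions[OF gibbs_prob N _ _ A] measure_le_of_test_functions[OF N gibbs_prob _ _ A];
      simp add: eq)+
  then show "emeasure (?\<nu> \<bind> P t) A = emeasure ?\<nu> A"
    by (simp add: N.emeasure_eq_measure G.emeasure_eq_measure)
qed

lemma semigroup_minorization:
  defines "L \<equiv> sqrt (real CARD('n))"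
  assumes P: "vj_semigroup U r \<epsilon> P" and w: "w \<in> space state_space" and A: "A \<in> sets state_space"
  shows "r\<^sup>2 * minor_const TYPE('n) * (L / 4) * exp (- total_rate * L) * measure base_measure A \<le> measure (P L w) A"
proof (rule measure_le_of_test_functions[OF base_measure_prob _ _ _ A])
  have L: "0 \<le> L" by (simp add: L_def)
  show "0 \<le> r\<^sup>2 * minor_const TYPE('n) * (L / 4) * exp (- total_rate * L)"
    using L minor_const_pos[where 'n = 'n] by simp
  show "P L w \<in> space (prob_algebra state_space)"
    using measurable_space[OF semigroup_kernel[OF P L] w] .
  obtain x y where xy: "w = (x, y)" "x \<in> torus" "y \<in> sphere 0 1"
    using w by (auto simp: space_state_space)
  have ret: "return state_space w \<in> space (prob_algebra state_space)"
    using w by (simp add: space_prob_algebra prob_space_return)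
  have start: "return state_space w \<bind> P t = P t w" if "0 \<le> t" for t
    using measurable_prob_algebraD[OF semigroup_kernel[OF P that]] w by (rule bind_return)
  have N0: "return state_space w \<bind> P 0 = return state_space (x, y)"
    using semigroup_0[OF P ret] xy by simp
  fix g :: "(real ^ 'n) \<times> (real ^ 'n) \<Rightarrow> real"
  assume "vj_test_function g" "\<And>x y. y \<in> sphere 0 1 \<Longrightarrow> 0 \<le> g (x, y)"
  from forward_solution_minorization[OF forward_solution_semigroup[OF P ret] N0 xy(2,3) this]
  show "r\<^sup>2 * minor_const TYPE('n) * (L / 4) * exp (- total_rate * L) * (\<integral>w. g w \<partial>base_measure) \<le> (\<integral>w. g w \<partial>P L w)"
    by (simp add: start[OF L] flip: L_def)
qed

text \<open>
  Contraction over \<open>\<lfloor>t / L\<rfloor>\<close> periods of length \<open>L\<close>; the remaining time does not increase the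
  distance. Losing at most one period accounts for the shift of \<open>t\<close> by \<open>L\<close>.
\<close>

lemma semigroup_tv_decay:
  defines "L \<equiv> sqrt (real CARD('n))"
  defines "\<eta> \<equiv> r\<^sup>2 * minor_const TYPE('n) * (L / 4) * exp (- total_rate * L)"
  assumes P: "vj_semigroup U r \<epsilon> P" and \<mu>: "\<mu> \<in> space (prob_algebra state_space)" and t: "0 \<le> t"
  shows "tv_dist (\<mu> \<bind> P t) (gibbs U \<epsilon>) \<le> exp (- (\<eta> / L * (t - L))) * tv_dist \<mu> (gibbs U \<epsilon>)"
proof -
  let ?\<nu> = "gibbs U \<epsilon>"
  have L: "L > 0" by (simp add: L_def)
  have K: "P s \<in> state_space \<rightarrow>\<^sub>M prob_algebra state_space" if "0 \<le> s" for s
    using P that by (rule semigroup_kernel)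
  interpret B: prob_space "base_measure :: ((real ^ 'n) \<times> (real ^ 'n)) measure"
    using base_measure_prob[where 'a = 'n] by (simp add: space_prob_algebra)
  have minor: "\<eta> * measure base_measure A \<le> measure (P L w) A"
    if "w \<in> space state_space" "A \<in> sets state_space" for w A
    using semigroup_minorization[OF P that] by (simp add: \<eta>_def L_def)
  have \<eta>0: "0 \<le> \<eta>" unfolding \<eta>_def using L minor_const_pos[where 'n = 'n] by simp
  have \<eta>1: "\<eta> \<le> 1"
  proof -
    have sb: "space base_measure = space (state_space :: ((real ^ 'n) \<times> (real ^ 'n)) measure)"
      using base_measure_prob[where 'a = 'n] by (intro sets_eq_imp_space_eq) (simp add: space_prob_algebra)
    then obtain w :: "(real ^ 'n) \<times> (real ^ 'n)" where w: "w \<in> space state_space" using B.not_empty by auto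
    interpret W: prob_space "P L w"
      using measurable_space[OF K w] L by (simp add: space_prob_algebra)
    show ?thesis
      using minor[OF w sets.top] order_trans[OF _ W.prob_le_1] B.prob_space sb by fastforce
  qed
  have Nn: "tv_dist (\<mu> \<bind> P (s + real n * L)) ?\<nu> \<le> (1 - \<eta>) ^ n * tv_dist \<mu> ?\<nu>" if s: "0 \<le> s" for s n
  proof (induction n)
    case 0
    have "tv_dist (\<mu> \<bind> P s) (?\<nu> \<bind> P s) \<le> (1 - 0) * tv_dist \<mu> ?\<nu>"
      by (rule tv_dist_bind_le[OF K[OF s] \<mu> gibbs_prob base_measure_prob state_space_diagonal]) auto
    then show ?case by (simp add: gibbs_invariant[OF P s])
  next
    case (Suc n)
    have sn: "0 \<le> s + real n * L" using s L by simp
    have "\<mu> \<bind> P (s + real (Suc n) * L) = (\<mu> \<bind> P (s + real n * L)) \<bind> P L"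
      using semigroup_bind_add[OF P \<mu> sn, of L] L by (simp add: algebra_simps)
    moreover have "tv_dist ((\<mu> \<bind> P (s + real n * L)) \<bind> P L) (?\<nu> \<bind> P L)
      \<le> (1 - \<eta>) * tv_dist (\<mu> \<bind> P (s + real n * L)) ?\<nu>"
      using L \<eta>0 \<eta>1 minor
      by (intro tv_dist_bind_le[OF K bind_in_prob_algebra[OF \<mu> K[OF sn]] gibbs_prob base_measure_prob state_space_diagonal]) auto
    moreover have "(1 - \<eta>) * tv_dist (\<mu> \<bind> P (s + real n * L)) ?\<nu> \<le> (1 - \<eta>) * ((1 - \<eta>) ^ n * tv_dist \<mu> ?\<nu>)"
      using \<eta>1 Suc.IH by (intro mult_left_mono) auto
    ultimately show ?case using L by (simp add: gibbs_invariant[OF P])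
  qed
  define n where "n = nat \<lfloor>t / L\<rfloor>"
  have n: "real n \<le> t / L" "t / L - 1 \<le> real n"
    using t L by (auto simp: n_def of_nat_nat)
  have "0 \<le> t - real n * L" using n(1) L by (simp add: divide_simps)
  from Nn[OF this, of n] have "tv_dist (\<mu> \<bind> P t) ?\<nu> \<le> (1 - \<eta>) ^ n * tv_dist \<mu> ?\<nu>" by simp
  also have "\<dots> \<le> exp (- (\<eta> / L * (t - L))) * tv_dist \<mu> ?\<nu>"
  proof (rule mult_right_mono)
    have "(1 - \<eta>) ^ n \<le> exp (- \<eta>) ^ n"
      using \<eta>1 exp_ge_add_one_self[of "- \<eta>"] by (intro power_mono) auto
    also have "\<dots> = exp (- (\<eta> * real n))" by (simp add: exp_of_nat_mult[symmetric] mult.commute)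
    also have "\<dots> \<le> exp (- (\<eta> * (t / L - 1)))"
      using n(2) \<eta>0 by (simp add: mult_left_mono)
    also have "\<eta> * (t / L - 1) = \<eta> / L * (t - L)" using L by (simp add: field_simps)
    finally show "(1 - \<eta>) ^ n \<le> exp (- (\<eta> / L * (t - L)))" .
    show "0 \<le> tv_dist \<mu> ?\<nu>"
      using \<mu> gibbs_prob by (intro tv_dist_nonneg) (simp_all add: space_prob_algebra)
  qed
  finally show ?thesis .
qed

end

theorem theorem4:
  fixes U :: "real ^ 'n \<Rightarrow> real" and r :: real
  assumes "r > 0" and "smooth U" and "periodic U"
  shows "\<exists>c>0. \<exists>\<theta>>0. \<forall>\<epsilon>>0. \<forall>P. vj_semigroup U r \<epsilon> P \<longrightarrow>
    (\<forall>t\<ge>0. \<forall>\<mu>\<in>space (prob_algebra state_space).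
       tv_dist (\<mu> \<bind> P t) (gibbs U \<epsilon>)
         \<le> exp (- (c * exp (- \<theta> / \<epsilon>) * (t - sqrt (real CARD('n))))) * tv_dist \<mu> (gibbs U \<epsilon>))"
proof -
  let ?L = "sqrt (real CARD('n))"
  have L: "?L > 0" by simp
  have diff: "U differentiable at x" for x by (rule smooth_gradient[OF assms(2)])
  have gcont: "continuous_on UNIV (gradient U)" by (rule smooth_gradient[OF assms(2)])
  have "continuous_on (UNIV \<times> sphere 0 1) (\<lambda>w :: (real ^ 'n) \<times> (real ^ 'n). norm (gradient U (fst w)))"
    by (intro continuous_on_norm continuous_on_compose2[OF gcont] continuous_on_fst continuous_on_id) auto
  then have "state_continuous (\<lambda>(x, y). norm (gradient U x))"
    using periodic_gradient[OF assms(3) diff] by (simp add: state_continuous_def case_prod_unfold periodic_def)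
  from state_continuous_bounded[OF this] obtain M where M: "0 < M"
    and M': "\<And>x y :: real ^ 'n. y \<in> sphere 0 1 \<Longrightarrow> \<bar>norm (gradient U x)\<bar> \<le> M" by auto
  \<comment> \<open>Any unit vector will do.\<close>
  have "axis undefined 1 \<in> sphere (0 :: real ^ 'n) 1" by simp
  from M'[OF this] have gle: "norm (gradient U x) \<le> M" for x by simp
  define c where "c = r\<^sup>2 * minor_const TYPE('n) * (1 / 4) * exp (- r * ?L)"
  have "c > 0" unfolding c_def using assms(1) minor_const_pos[where 'n = 'n] by simp
  moreover have "M * ?L > 0" using M L by (rule mult_pos_pos)
  moreover have "tv_dist (\<mu> \<bind> P t) (gibbs U \<epsilon>)
         \<le> exp (- (c * exp (- (M * ?L) / \<epsilon>) * (t - ?L))) * tv_dist \<mu> (gibbs U \<epsilon>)"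
    if "\<epsilon> > 0" "vj_semigroup U r \<epsilon> P" "t \<ge> 0" "\<mu> \<in> space (prob_algebra state_space)" for \<epsilon> P t \<mu>
  proof -
    interpret velocity_jump U r \<epsilon> M
      by unfold_locales (use assms(1,3) that(1) M diff gcont gle in auto)
    have "exp (- total_rate * ?L) = exp (- r * ?L) * exp (- (M * ?L) / \<epsilon>)"
      by (simp add: total_rate_def exp_add[symmetric] algebra_simps)
    then have eq: "r\<^sup>2 * minor_const TYPE('n) * (?L / 4) * exp (- total_rate * ?L) / ?L = c * exp (- (M * ?L) / \<epsilon>)"
      using L by (simp add: c_def)
    show ?thesis using semigroup_tv_decay[OF that(2,4,3)] unfolding eq .
  qed
  ultimately show ?thesis by blast
qed

end
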